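(* Let $(M,\varphi,\xi,\eta,g)$ be a compact three-dimensional normal almost contact metric manifold (equivalently, a compact three-dimensional trans-Sasakian manifold) of constant rank. If $(M,\varphi,\xi,\eta,g)$ is $\eta$-Einstein, then the structure is either (i) an $\alpha$-Sasakian structure homothetic to a Sasakian structure, or (ii) a $\beta_s$-Kenmotsu structure with expansion $\Theta$ (so $\beta_s=\Theta$) satisfying $\partial\Theta=0$ for every local adapted complex frame $\{\xi,\partial,\bar\partial\}$.
   Context: Manifolds are smooth, connected and without boundary. An almost contact metric (ACM) structure on a three-dimensional manifold $M$ is a tuple $(\varphi,\xi,\eta,g)$ with $g$ a Riemannian metric, $\xi$ a vector field, $\eta$ the metric dual one-form of $\xi$, and $\varphi$ an endomorphism field of $TM$ with $\varphi^2=-I+\eta\otimes\xi$, $\eta(\xi)=1$, $\varphi(\xi)=0$, $g(\varphi X,\varphi Y)=g(X,Y)-\eta(X)\eta(Y)$. Normal: $[\varphi,\varphi]+2\xi\otimes d\eta=0$, where $[\varphi,\varphi]$ is the Nijenhuis torsion of $\varphi$ and $d\eta(X,Y)=\tfrac12(X\eta(Y)-Y\eta(X)-\eta([X,Y]))$ (equivalently, in dimension three, $\nabla_{\varphi X}\xi=\varphi\nabla_X\xi$ for all $X$, with $\nabla$ the Levi-Civita connection). Rank: the structure has rank 1 if $d\eta=0$, rank 2 if $d\eta\neq0$ and $\eta\wedge d\eta=0$, rank 3 if $\eta\wedge d\eta\neq0$; constant rank means that the rank is the same at all points of $M$. $\eta$-Einstein: $\mathrm{Ric}=a\,g+b\,\eta\otimes\eta$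 for some $a,b\in C^\infty(M)$. Trans-Sasakian of type $(\alpha,\beta_s)$, with $\alpha,\beta_s\in C^\infty(M)$: $(\nabla_X\varphi)Y=\alpha(g(X,Y)\xi-\eta(Y)X)+\beta_s(g(\varphi X,Y)\xi-\eta(Y)\varphi X)$ for all $X,Y$. It is called $\alpha$-Sasakian if $\beta_s=0$, Sasakian if $\alpha=1$ and $\beta_s=0$, and $\beta_s$-Kenmotsu if $\alpha=0$. Homothetic to a Sasakian structure means: after possibly replacing $(\xi,\eta)$ by $(-\xi,-\eta)$, there is a constant $c>0$ such that $(\varphi,c^{-1}\xi,c\,\eta,c^2g)$ is a Sasakian structure. A local adapted complex frame is $\{\xi,\partial,\bar\partial\}$ on an open set, where $\partial=\frac1{\sqrt2}(e_2-ie_3)$ with $\{\xi,e_2,e_3\}$ a local orthonormal frame such that $\varphi(\partial)=i\partial$ ($g$ and $\varphi$ extended complex-linearly). The expansion is $\Theta=\mathrm{Re}\,g(\nabla_{\bar\partial}\xi,\partial)$, which does not depend on the frame. *)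

theory Defs
  imports "HOL-Analysis.Analysis"
begin

section \<open>Smooth maps on open subsets of Euclidean space\<close>

abbreviation dder :: "(real^'n \<Rightarrow> 'b::real_normed_vector) \<Rightarrow> real^'n \<Rightarrow> real^'n \<Rightarrow> 'b" where
  "dder f u v \<equiv> frechet_derivative f (at u) v"

primrec Ck_on :: "nat \<Rightarrow> (real^'n) set \<Rightarrow> (real^'n \<Rightarrow> 'b::real_normed_vector) \<Rightarrow> bool" where
  "Ck_on 0 S f = continuous_on S f"
| "Ck_on (Suc k) S f =
     ((\<forall>u\<in>S. f differentiable (at u)) \<and> (\<forall>v. Ck_on k S (\<lambda>u. dder f u v)))"

text \<open>Only used for open \<open>S\<close>.\<close>

definition smooth_on :: "(real^'n) set \<Rightarrow> (real^'n \<Rightarrow> 'b::real_normed_vector) \<Rightarrow> bool" where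
  "smooth_on S f \<longleftrightarrow> (\<forall>k. Ck_on k S f)"


section \<open>Smooth manifolds\<close>

text \<open>
  The manifold is the whole type \<open>'a\<close>, Hausdorff and second countable by its sort, with an
  \<open>n\<close>-dimensional smooth structure given by an atlas.
\<close>

type_synonym ('a, 'n) chart = "'a set \<times> ('a \<Rightarrow> real^'n)"

definition chart_dom :: "('a, 'n) chart \<Rightarrow> 'a set" where
  "chart_dom c = fst c"

definition coord :: "('a, 'n) chart \<Rightarrow> 'a \<Rightarrow> real^'n" where
  "coord c = snd c"

definition chart_img :: "('a, 'n) chart \<Rightarrow> (real^'n) set" where
  "chart_img c = coord c ` chart_dom c"

definition param :: "('a, 'n) chart \<Rightarrow> real^'n \<Rightarrow> 'a" where
  "param c = inv_into (chart_dom c) (coord c)"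

definition is_chart :: "('a::topological_space, 'n::finite) chart \<Rightarrow> bool" where
  "is_chart c \<longleftrightarrow> open (chart_dom c) \<and> open (chart_img c) \<and>
     homeomorphism (chart_dom c) (chart_img c) (coord c) (param c)"

definition transition :: "('a, 'n) chart \<Rightarrow> ('a, 'n) chart \<Rightarrow> real^'n \<Rightarrow> real^'n" where
  "transition c c' = coord c' \<circ> param c"

definition overlap :: "('a, 'n) chart \<Rightarrow> ('a, 'n) chart \<Rightarrow> (real^'n) set" where
  "overlap c c' = coord c ` (chart_dom c \<inter> chart_dom c')"

definition jacobian_mat :: "('a, 'n::finite) chart \<Rightarrow> ('a, 'n) chart \<Rightarrow> real^'n \<Rightarrow> real^'n^'n" where
  "jacobian_mat c c' u = matrix (frechet_derivative (transition c c') (at u))"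

definition smooth_atlas ::
    "('a::{t2_space,second_countable_topology}, 'n::finite) chart set \<Rightarrow> bool" where
  "smooth_atlas A \<longleftrightarrow> (\<forall>c\<in>A. is_chart c) \<and> (\<Union>c\<in>A. chart_dom c) = UNIV \<and>
     (\<forall>c\<in>A. \<forall>c'\<in>A. smooth_on (overlap c c') (transition c c'))"

definition smooth_fun :: "('a, 'n::finite) chart set \<Rightarrow> ('a \<Rightarrow> real) \<Rightarrow> bool" where
  "smooth_fun A f \<longleftrightarrow> (\<forall>c\<in>A. smooth_on (chart_img c) (f \<circ> param c))"


section \<open>Tensor fields\<close>

text \<open>
  A tensor field is given by its components in the charts of the atlas: for each chart \<open>c\<close> a
  smooth array-valued function on the open set \<open>chart_img c\<close>, the components in two charts
  being related on the overlap by the tensor transformation law.  The values at a chart outside the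
  atlas, or at a point outside \<open>chart_img c\<close>, are irrelevant.
\<close>

type_synonym ('a, 'n) vec_field = "('a, 'n) chart \<Rightarrow> real^'n \<Rightarrow> real^'n"
type_synonym ('a, 'n) mat_field = "('a, 'n) chart \<Rightarrow> real^'n \<Rightarrow> real^'n^'n"

definition vector_field_on ::
    "('a, 'n::finite) chart set \<Rightarrow> 'a set \<Rightarrow> ('a, 'n) vec_field \<Rightarrow> bool" where
  "vector_field_on A V X \<longleftrightarrow>
     (\<forall>c\<in>A. smooth_on (coord c ` (chart_dom c \<inter> V)) (X c)) \<and>
     (\<forall>c\<in>A. \<forall>c'\<in>A. \<forall>u \<in> coord c ` (chart_dom c \<inter> chart_dom c' \<inter> V).
        X c' (transition c c' u) = jacobian_mat c c' u *v X c u)"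

definition one_form :: "('a, 'n::finite) chart set \<Rightarrow> ('a, 'n) vec_field \<Rightarrow> bool" where
  "one_form A \<omega> \<longleftrightarrow>
     (\<forall>c\<in>A. smooth_on (chart_img c) (\<omega> c)) \<and>
     (\<forall>c\<in>A. \<forall>c'\<in>A. \<forall>u\<in>overlap c c'.
        \<omega> c u = transpose (jacobian_mat c c' u) *v \<omega> c' (transition c c' u))"

definition endo_field :: "('a, 'n::finite) chart set \<Rightarrow> ('a, 'n) mat_field \<Rightarrow> bool" where
  "endo_field A \<phi> \<longleftrightarrow>
     (\<forall>c\<in>A. smooth_on (chart_img c) (\<phi> c)) \<and>
     (\<forall>c\<in>A. \<forall>c'\<in>A. \<forall>u\<in>overlap c c'.
        \<phi> c' (transition c c' u) ** jacobian_mat c c' u = jacobian_mat c c' u ** \<phi> c u)"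

definition bform :: "real^'n^'n \<Rightarrow> real^'n \<Rightarrow> real^'n \<Rightarrow> real" where
  "bform B v w = v \<bullet> (B *v w)"

definition riemannian_metric :: "('a, 'n::finite) chart set \<Rightarrow> ('a, 'n) mat_field \<Rightarrow> bool" where
  "riemannian_metric A g \<longleftrightarrow>
     (\<forall>c\<in>A. smooth_on (chart_img c) (g c)) \<and>
     (\<forall>c\<in>A. \<forall>c'\<in>A. \<forall>u\<in>overlap c c'.
        g c u = transpose (jacobian_mat c c' u) ** g c' (transition c c' u) ** jacobian_mat c c' u) \<and>
     (\<forall>c\<in>A. \<forall>u\<in>chart_img c. transpose (g c u) = g c u \<and> (\<forall>v. v \<noteq> 0 \<longrightarrow> bform (g c u) v v > 0))"


section \<open>Differential geometry in one chart\<close>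

text \<open>
  In this section vector fields, one-forms and matrix fields are functions of the coordinates
  \<open>u\<close> in the image of one chart.
\<close>

definition lie_bracket ::
    "(real^'n \<Rightarrow> real^'n) \<Rightarrow> (real^'n \<Rightarrow> real^'n) \<Rightarrow> real^'n \<Rightarrow> real^'n" where
  "lie_bracket X Y u = dder Y u (X u) - dder X u (Y u)"

definition ext_deriv ::
    "(real^'n \<Rightarrow> real^'n) \<Rightarrow> (real^'n \<Rightarrow> real^'n) \<Rightarrow> (real^'n \<Rightarrow> real^'n) \<Rightarrow> real^'n \<Rightarrow> real" where
  "ext_deriv \<omega> X Y u = (1/2) *
     (dder (\<lambda>y. \<omega> y \<bullet> Y y) u (X u) - dder (\<lambda>y. \<omega> y \<bullet> X y) u (Y u) - \<omega> u \<bullet> lie_bracket X Y u)"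

text \<open>
  The value of \<open>d\<omega>\<close> at \<open>u\<close> on two vectors, obtained by extending them to constant coordinate
  fields; \<open>d\<omega>\<close> is tensorial, so the extension does not matter.
\<close>

definition ext_deriv_at :: "(real^'n \<Rightarrow> real^'n) \<Rightarrow> real^'n \<Rightarrow> real^'n \<Rightarrow> real^'n \<Rightarrow> real" where
  "ext_deriv_at \<omega> u v w = ext_deriv \<omega> (\<lambda>_. v) (\<lambda>_. w) u"

text \<open>\<open>\<omega> \<and> d\<omega>\<close>, up to a positive normalisation constant; only its vanishing is used.\<close>

definition wedge_d_at ::
    "(real^'n \<Rightarrow> real^'n) \<Rightarrow> real^'n \<Rightarrow> real^'n \<Rightarrow> real^'n \<Rightarrow> real^'n \<Rightarrow> real" where
  "wedge_d_at \<omega> u v w z = (\<omega> u \<bullet> v) * ext_deriv_at \<omega> u w z +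
     (\<omega> u \<bullet> w) * ext_deriv_at \<omega> u z v + (\<omega> u \<bullet> z) * ext_deriv_at \<omega> u v w"

definition nijenhuis ::
    "(real^'n \<Rightarrow> real^'n^'n) \<Rightarrow> (real^'n \<Rightarrow> real^'n) \<Rightarrow> (real^'n \<Rightarrow> real^'n) \<Rightarrow> real^'n \<Rightarrow> real^'n" where
  "nijenhuis P X Y u =
     P u *v (P u *v lie_bracket X Y u) + lie_bracket (\<lambda>y. P y *v X y) (\<lambda>y. P y *v Y y) u
     - P u *v lie_bracket (\<lambda>y. P y *v X y) Y u - P u *v lie_bracket X (\<lambda>y. P y *v Y y) u"

text \<open>\<open>christoffel G u k i j\<close> is the symbol with upper index \<open>k\<close> and lower indices \<open>i\<close>, \<open>j\<close>.\<close>

definition christoffel :: "(real^'n \<Rightarrow> real^'n^'n) \<Rightarrow> real^'n \<Rightarrow> 'n::finite \<Rightarrow> 'n \<Rightarrow> 'n \<Rightarrow> real" where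
  "christoffel G u k i j = (1/2) * (\<Sum>l\<in>UNIV. matrix_inv (G u) $ k $ l *
     (dder (\<lambda>y. G y $ j $ l) u (axis i 1) + dder (\<lambda>y. G y $ i $ l) u (axis j 1)
      - dder (\<lambda>y. G y $ i $ j) u (axis l 1)))"

text \<open>The Levi-Civita connection \<open>\<nabla>\<^sub>X Y\<close> of \<open>G\<close>.\<close>

definition nabla ::
    "(real^'n::finite \<Rightarrow> real^'n^'n) \<Rightarrow> (real^'n \<Rightarrow> real^'n) \<Rightarrow> (real^'n \<Rightarrow> real^'n) \<Rightarrow> real^'n \<Rightarrow> real^'n" where
  "nabla G X Y u = dder Y u (X u) +
     (\<chi> k. \<Sum>i\<in>UNIV. \<Sum>j\<in>UNIV. christoffel G u k i j * X u $ i * Y u $ j)"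

definition nabla_endo ::
    "(real^'n::finite \<Rightarrow> real^'n^'n) \<Rightarrow> (real^'n \<Rightarrow> real^'n^'n) \<Rightarrow>
     (real^'n \<Rightarrow> real^'n) \<Rightarrow> (real^'n \<Rightarrow> real^'n) \<Rightarrow> real^'n \<Rightarrow> real^'n" where
  "nabla_endo G P X Y u = nabla G X (\<lambda>y. P y *v Y y) u - P u *v nabla G X Y u"

definition curvature ::
    "(real^'n::finite \<Rightarrow> real^'n^'n) \<Rightarrow> (real^'n \<Rightarrow> real^'n) \<Rightarrow> (real^'n \<Rightarrow> real^'n) \<Rightarrow>
     (real^'n \<Rightarrow> real^'n) \<Rightarrow> real^'n \<Rightarrow> real^'n" where
  "curvature G X Y Z u = nabla G X (nabla G Y Z) u - nabla G Y (nabla G X Z) u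
     - nabla G (lie_bracket X Y) Z u"

text \<open>The trace of \<open>X \<mapsto> R(X, v) w\<close>.\<close>

definition ricci :: "(real^'n::finite \<Rightarrow> real^'n^'n) \<Rightarrow> real^'n \<Rightarrow> real^'n \<Rightarrow> real^'n \<Rightarrow> real" where
  "ricci G u v w = (\<Sum>k\<in>UNIV. curvature G (\<lambda>_. axis k 1) (\<lambda>_. v) (\<lambda>_. w) u $ k)"


section \<open>Almost contact metric structures in dimension three\<close>

definition acm_structure ::
    "('a, 3) chart set \<Rightarrow> ('a, 3) mat_field \<Rightarrow> ('a, 3) vec_field \<Rightarrow> ('a, 3) vec_field \<Rightarrow>
     ('a, 3) mat_field \<Rightarrow> bool" where
  "acm_structure A \<phi> \<xi> \<eta> g \<longleftrightarrow>
     riemannian_metric A g \<and> vector_field_on A UNIV \<xi> \<and> one_form A \<eta> \<and> endo_field A \<phi> \<and>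
     (\<forall>c\<in>A. \<forall>u\<in>chart_img c.
        (\<forall>v. \<eta> c u \<bullet> v = bform (g c u) (\<xi> c u) v) \<and>
        (\<forall>v. \<phi> c u *v (\<phi> c u *v v) = - v + (\<eta> c u \<bullet> v) *\<^sub>R \<xi> c u) \<and>
        \<eta> c u \<bullet> \<xi> c u = 1 \<and>
        \<phi> c u *v \<xi> c u = 0 \<and>
        (\<forall>v w. bform (g c u) (\<phi> c u *v v) (\<phi> c u *v w) =
               bform (g c u) v w - (\<eta> c u \<bullet> v) * (\<eta> c u \<bullet> w)))"

text \<open>
  Identities between tensor fields are local, so the vector fields \<open>X\<close>, \<open>Y\<close> below range over the
  smooth vector fields on each chart.
\<close>

definition normal_structure ::
    "('a, 3) chart set \<Rightarrow> ('a, 3) mat_field \<Rightarrow> ('a, 3) vec_field \<Rightarrow> ('a, 3) vec_field \<Rightarrow> bool" where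
  "normal_structure A \<phi> \<xi> \<eta> \<longleftrightarrow>
     (\<forall>c\<in>A. \<forall>X Y. smooth_on (chart_img c) X \<longrightarrow> smooth_on (chart_img c) Y \<longrightarrow>
        (\<forall>u\<in>chart_img c.
           nijenhuis (\<phi> c) X Y u + (2 * ext_deriv (\<eta> c) X Y u) *\<^sub>R \<xi> c u = 0))"

definition rank_at :: "(real^3 \<Rightarrow> real^3) \<Rightarrow> real^3 \<Rightarrow> nat" where
  "rank_at \<omega> u =
     (if \<forall>v w. ext_deriv_at \<omega> u v w = 0 then 1
      else if \<forall>v w z. wedge_d_at \<omega> u v w z = 0 then 2
      else 3)"

definition constant_rank :: "('a, 3) chart set \<Rightarrow> ('a, 3) vec_field \<Rightarrow> bool" where
  "constant_rank A \<eta> \<longleftrightarrow> (\<exists>r. \<forall>c\<in>A. \<forall>u\<in>chart_img c. rank_at (\<eta> c) u = r)"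

definition eta_einstein ::
    "('a, 3) chart set \<Rightarrow> ('a, 3) vec_field \<Rightarrow> ('a, 3) mat_field \<Rightarrow> bool" where
  "eta_einstein A \<eta> g \<longleftrightarrow>
     (\<exists>a b. smooth_fun A a \<and> smooth_fun A b \<and>
        (\<forall>c\<in>A. \<forall>u\<in>chart_img c. \<forall>v w.
           ricci (g c) u v w =
             a (param c u) * bform (g c u) v w + b (param c u) * (\<eta> c u \<bullet> v) * (\<eta> c u \<bullet> w)))"

definition trans_sasakian ::
    "('a, 3) chart set \<Rightarrow> ('a, 3) mat_field \<Rightarrow> ('a, 3) vec_field \<Rightarrow> ('a, 3) vec_field \<Rightarrow>
     ('a, 3) mat_field \<Rightarrow> ('a \<Rightarrow> real) \<Rightarrow> ('a \<Rightarrow> real) \<Rightarrow> bool" where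
  "trans_sasakian A \<phi> \<xi> \<eta> g \<alpha> \<beta> \<longleftrightarrow>
     acm_structure A \<phi> \<xi> \<eta> g \<and> smooth_fun A \<alpha> \<and> smooth_fun A \<beta> \<and>
     (\<forall>c\<in>A. \<forall>X Y. smooth_on (chart_img c) X \<longrightarrow> smooth_on (chart_img c) Y \<longrightarrow>
        (\<forall>u\<in>chart_img c.
           nabla_endo (g c) (\<phi> c) X Y u =
             \<alpha> (param c u) *\<^sub>R (bform (g c u) (X u) (Y u) *\<^sub>R \<xi> c u - (\<eta> c u \<bullet> Y u) *\<^sub>R X u) +
             \<beta> (param c u) *\<^sub>R (bform (g c u) (\<phi> c u *v X u) (Y u) *\<^sub>R \<xi> c u
                                - (\<eta> c u \<bullet> Y u) *\<^sub>R (\<phi> c u *v X u))))"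

definition alpha_sasakian ::
    "('a, 3) chart set \<Rightarrow> ('a, 3) mat_field \<Rightarrow> ('a, 3) vec_field \<Rightarrow> ('a, 3) vec_field \<Rightarrow>
     ('a, 3) mat_field \<Rightarrow> ('a \<Rightarrow> real) \<Rightarrow> bool" where
  "alpha_sasakian A \<phi> \<xi> \<eta> g \<alpha> \<longleftrightarrow> trans_sasakian A \<phi> \<xi> \<eta> g \<alpha> (\<lambda>_. 0)"

definition sasakian ::
    "('a, 3) chart set \<Rightarrow> ('a, 3) mat_field \<Rightarrow> ('a, 3) vec_field \<Rightarrow> ('a, 3) vec_field \<Rightarrow>
     ('a, 3) mat_field \<Rightarrow> bool" where
  "sasakian A \<phi> \<xi> \<eta> g \<longleftrightarrow> trans_sasakian A \<phi> \<xi> \<eta> g (\<lambda>_. 1) (\<lambda>_. 0)"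

definition beta_kenmotsu ::
    "('a, 3) chart set \<Rightarrow> ('a, 3) mat_field \<Rightarrow> ('a, 3) vec_field \<Rightarrow> ('a, 3) vec_field \<Rightarrow>
     ('a, 3) mat_field \<Rightarrow> ('a \<Rightarrow> real) \<Rightarrow> bool" where
  "beta_kenmotsu A \<phi> \<xi> \<eta> g \<beta> \<longleftrightarrow> trans_sasakian A \<phi> \<xi> \<eta> g (\<lambda>_. 0) \<beta>"

text \<open>The sign \<open>s\<close> accounts for the possible replacement of \<open>(\<xi>, \<eta>)\<close> by \<open>(-\<xi>, -\<eta>)\<close>.\<close>

definition homothetic_to_sasakian ::
    "('a, 3) chart set \<Rightarrow> ('a, 3) mat_field \<Rightarrow> ('a, 3) vec_field \<Rightarrow> ('a, 3) vec_field \<Rightarrow>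
     ('a, 3) mat_field \<Rightarrow> bool" where
  "homothetic_to_sasakian A \<phi> \<xi> \<eta> g \<longleftrightarrow>
     (\<exists>s k::real. s \<in> {1, -1} \<and> k > 0 \<and>
        sasakian A \<phi> (\<lambda>c u. (s * inverse k) *\<^sub>R \<xi> c u) (\<lambda>c u. (s * k) *\<^sub>R \<eta> c u)
          (\<lambda>c u. k\<^sup>2 *\<^sub>R g c u))"


section \<open>Adapted complex frames and the expansion\<close>

definition re_vec :: "complex^'n \<Rightarrow> real^'n" where
  "re_vec z = (\<chi> i. Re (z $ i))"

definition im_vec :: "complex^'n \<Rightarrow> real^'n" where
  "im_vec z = (\<chi> i. Im (z $ i))"

definition complexify :: "real^'n \<Rightarrow> complex^'n" where
  "complexify v = (\<chi> i. complex_of_real (v $ i))"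

definition conj_vec :: "complex^'n \<Rightarrow> complex^'n" where
  "conj_vec z = (\<chi> i. cnj (z $ i))"

text \<open>
  The complex-linear extensions of a real-linear functional, of a real-linear map and of a
  real-bilinear form.
\<close>

definition cfunctional :: "(real^'n \<Rightarrow> real) \<Rightarrow> complex^'n \<Rightarrow> complex" where
  "cfunctional L z = Complex (L (re_vec z)) (L (im_vec z))"

definition clinear_ext :: "(real^'n \<Rightarrow> real^'n) \<Rightarrow> complex^'n \<Rightarrow> complex^'n" where
  "clinear_ext L z = complexify (L (re_vec z)) + \<i> *s complexify (L (im_vec z))"

definition cbform :: "real^'n^'n \<Rightarrow> complex^'n \<Rightarrow> complex^'n \<Rightarrow> complex" where
  "cbform B z w =
     Complex (bform B (re_vec z) (re_vec w) - bform B (im_vec z) (im_vec w))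
             (bform B (re_vec z) (im_vec w) + bform B (im_vec z) (re_vec w))"

definition del :: "real^3 \<Rightarrow> real^3 \<Rightarrow> complex^3" where
  "del v w = complex_of_real (1 / sqrt 2) *s (complexify v - \<i> *s complexify w)"

text \<open>
  The condition that \<open>{x, v, w}\<close> is an orthonormal basis with \<open>\<phi>(\<partial>) = i \<partial>\<close>, at one point.
\<close>

definition adapted_basis ::
    "real^3^3 \<Rightarrow> real^3^3 \<Rightarrow> real^3 \<Rightarrow> real^3 \<Rightarrow> real^3 \<Rightarrow> bool" where
  "adapted_basis G P x v w \<longleftrightarrow>
     bform G x x = 1 \<and> bform G v v = 1 \<and> bform G w w = 1 \<and>
     bform G x v = 0 \<and> bform G x w = 0 \<and> bform G v w = 0 \<and>
     clinear_ext ((*v) P) (del v w) = \<i> *s del v w"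

definition adapted_frame ::
    "('a::topological_space, 3) chart set \<Rightarrow> ('a, 3) mat_field \<Rightarrow> ('a, 3) vec_field \<Rightarrow>
     ('a, 3) mat_field \<Rightarrow> 'a set \<Rightarrow> ('a, 3) vec_field \<Rightarrow> ('a, 3) vec_field \<Rightarrow> bool" where
  "adapted_frame A \<phi> \<xi> g V e2 e3 \<longleftrightarrow>
     open V \<and> vector_field_on A V e2 \<and> vector_field_on A V e3 \<and>
     (\<forall>c\<in>A. \<forall>u \<in> coord c ` (chart_dom c \<inter> V).
        adapted_basis (g c u) (\<phi> c u) (\<xi> c u) (e2 c u) (e3 c u))"

text \<open>
  \<open>\<nabla>\<^sub>Z \<xi>\<close> at a point depends only on the value of \<open>Z\<close> there, so the expansion at \<open>p\<close> is evaluated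
  on the adapted bases of the tangent space at \<open>p\<close>, in any chart around \<open>p\<close>.
\<close>

definition expansion ::
    "('a, 3) chart set \<Rightarrow> ('a, 3) mat_field \<Rightarrow> ('a, 3) vec_field \<Rightarrow> ('a, 3) mat_field \<Rightarrow>
     'a \<Rightarrow> real" where
  "expansion A \<phi> \<xi> g p =
     (THE t. \<forall>c\<in>A. p \<in> chart_dom c \<longrightarrow>
        (let u = coord c p in
         \<forall>v w. adapted_basis (g c u) (\<phi> c u) (\<xi> c u) v w \<longrightarrow>
           t = Re (cbform (g c u)
                     (clinear_ext (\<lambda>z. nabla (g c) (\<lambda>_. z) (\<xi> c) u) (conj_vec (del v w)))
                     (del v w))))"

text \<open>The function \<open>\<partial>f\<close> for the frame \<open>{\<xi>, \<partial>, \<partial>-bar}\<close> built from \<open>e2\<close>, \<open>e3\<close>, in the chart \<open>c\<close>.\<close>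

definition del_deriv ::
    "('a, 3) chart \<Rightarrow> ('a, 3) vec_field \<Rightarrow> ('a, 3) vec_field \<Rightarrow> ('a \<Rightarrow> real) \<Rightarrow> 'a \<Rightarrow> complex" where
  "del_deriv c e2 e3 f p =
     cfunctional (dder (f \<circ> param c) (coord c p)) (del (e2 c (coord c p)) (e3 c (coord c p)))"

end

theory Submission
  imports Defs
begin

text \<open>
  On a normal structure \<open>\<nabla>\<xi> = -\<alpha> \<phi> + \<beta> (I - \<eta> \<otimes> \<xi>)\<close> with smooth functions \<open>\<alpha>\<close> and \<open>\<beta>\<close>: normality
  says that the flow of \<open>\<xi>\<close> preserves \<open>\<phi>\<close> and \<open>\<eta>\<close>, so \<open>\<nabla>\<xi>\<close> kills \<open>\<xi>\<close> and commutes with the rotation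
  \<open>\<phi>\<close> of the horizontal plane \<open>ker \<eta>\<close>, hence acts there as a complex number (\<open>Dxi_formula\<close>).  In
  dimension three \<open>\<nabla>\<phi>\<close> is determined by \<open>\<nabla>\<xi>\<close> (\<open>Dphi_formula\<close>), and the structure is trans-Sasakian of
  type \<open>(\<alpha>, \<beta>)\<close>, with expansion \<open>\<beta>\<close>.  Moreover \<open>d\<eta>\<close> is, up to sign, \<open>\<alpha>\<close> times the area form of the horizontal
  plane.  So the rank is 1 exactly where \<open>\<alpha> = 0\<close>, and under constant rank \<open>\<alpha>\<close> vanishes everywhere or
  nowhere.

  The curvature of a horizontal frame gives \<open>Ric(X, \<xi>) = - X\<beta> - (\<phi>X)\<alpha>\<close> for horizontal \<open>X\<close>
  (\<open>ricci_horizontal_xi\<close>), and an \<open>\<eta>\<close>-Einstein structure therefore satisfies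

    \<open>X\<beta> = - (\<phi>X)\<alpha>\<close> for all horizontal \<open>X\<close>.   (1)

  If \<open>\<alpha> = 0\<close>, the structure is \<open>\<beta>\<close>-Kenmotsu and (1) is \<open>\<partial>\<beta> = 0\<close>.

  Suppose that \<open>\<alpha>\<close> vanishes nowhere.  The Jacobi identity gives \<open>\<xi>\<alpha> = -2 \<alpha> \<beta>\<close> (\<open>dder_al_xi\<close>).  By (1)
  the complex function \<open>F = \<beta> + i \<alpha>\<close> is annihilated by \<open>\<partial>\<close>; so is \<open>\<xi>F + F\<^sup>2\<close>, which is the real function
  \<open>\<psi> = \<xi>\<beta> + \<beta>\<^sup>2 - \<alpha>\<^sup>2\<close>.  All horizontal derivatives of \<open>\<psi>\<close> vanish, and as \<open>\<alpha> \<noteq> 0\<close> makes \<open>\<xi>\<close> a combination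
  of horizontal fields and of a bracket of two of them, \<open>\<psi>\<close> is constant (\<open>dder_psi_zero\<close>).  At a
  critical point of \<open>\<alpha>\<close> one has \<open>\<beta> = 0\<close>, and (1) turns the horizontal Laplacian of \<open>\<alpha>\<close> into
  \<open>2 \<alpha> (\<psi> + \<alpha>\<^sup>2)\<close>, for a frame of unit vectors (\<open>horizontal_laplacian_al\<close>).  So \<open>\<psi> + \<alpha>\<^sup>2 \<le> 0\<close> where \<open>\<alpha>\<^sup>2\<close> is
  maximal and \<open>\<psi> + \<alpha>\<^sup>2 \<ge> 0\<close> where it is minimal.  Both extrema exist by compactness; as \<open>\<psi>\<close> is constant,
  \<open>\<alpha>\<^sup>2 = -\<psi>\<close> everywhere.  Then \<open>\<alpha>\<close> is constant, \<open>\<beta> = 0\<close>, and rescaling the metric by \<open>\<alpha>\<^sup>2\<close> gives a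
  Sasakian structure.

  The local part of this is carried out on the image of one chart, where \<open>\<alpha>\<close> and \<open>\<beta>\<close> are traces built
  from \<open>\<nabla>\<xi>\<close>.  They do not depend on the chart because they can be recovered from \<open>d\<eta>\<close> and from the
  Lie derivative of \<open>g\<close> along \<open>\<xi>\<close>, whose transformation laws need no connection.
\<close>

section \<open>Calculus of smooth functions\<close>

lemma Ck_on_differentiable: "Ck_on (Suc k) S f \<Longrightarrow> u \<in> S \<Longrightarrow> f differentiable (at u)"
  by simp

lemma Ck_on_pred: "Ck_on (Suc k) S f \<Longrightarrow> Ck_on k S f"
proof (induction k arbitrary: f)
  case 0
  then show ?case
    by (auto intro!: continuous_at_imp_continuous_on differentiable_imp_continuous_within)
next
  case (Suc k)
  then show ?case by simp
qed

lemma differentiable_transform_open: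
  assumes "open S" "u \<in> S" "\<And>y. y \<in> S \<Longrightarrow> f y = g y" "f differentiable (at u)"
  shows "g differentiable (at u)"
proof -
  obtain D where "(f has_derivative D) (at u)" using assms(4) unfolding differentiable_def by blast
  then have "(g has_derivative D) (at u)"
    by (rule has_derivative_transform_within_open[OF _ assms(1,2,3)])
  then show ?thesis by (rule differentiableI)
qed

lemma dder_cong:
  assumes "open S" "u \<in> S" "\<And>y. y \<in> S \<Longrightarrow> f y = g y"
  shows "dder f u = dder g u"
proof (cases "f differentiable (at u)")
  case True
  then show ?thesis
    using frechet_derivative_transform_within_open[of f u S g] assms by simp
next
  case False
  have "\<not> g differentiable (at u)"
  proof
    assume "g differentiable (at u)"
    then have "f differentiable (at u)"
      using differentiable_transform_open[OF assms(1,2), of g f] assms(3) by simp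
    with False show False by simp
  qed
  then have "(f has_derivative D) (at u) \<longleftrightarrow> (g has_derivative D) (at u)" for D
    using False differentiableI by blast
  then show ?thesis by (simp add: frechet_derivative_def)
qed

lemma dder_cong_vec:
  assumes "open S" "u \<in> S" "\<And>y. y \<in> S \<Longrightarrow> f y = g y"
  shows "dder f u v = dder g u v"
  using dder_cong[OF assms] by simp

lemma differentiable_cong_open:
  assumes "open S" "u \<in> S" "\<And>y. y \<in> S \<Longrightarrow> f y = g y"
  shows "f differentiable (at u) \<longleftrightarrow> g differentiable (at u)"
proof
  show "g differentiable (at u)" if "f differentiable (at u)"
    by (rule differentiable_transform_open[OF assms(1,2) _ that]) (rule assms(3))
  show "f differentiable (at u)" if "g differentiable (at u)"
    by (rule differentiable_transform_open[OF assms(1,2) _ that]) (simp add: assms(3))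
qed

lemma Ck_on_cong:
  assumes "open S" "\<And>y. y \<in> S \<Longrightarrow> f y = g y" "Ck_on k S f"
  shows "Ck_on k S g"
  using assms(2,3)
proof (induction k arbitrary: f g)
  case 0
  then show ?case by (simp cong: continuous_on_cong)
next
  case (Suc k)
  have "Ck_on k S (\<lambda>u. dder g u v)" for v
  proof (rule Suc.IH)
    show "dder f y v = dder g y v" if "y \<in> S" for y
      using dder_cong[OF assms(1) that Suc.prems(1)] by simp
    show "Ck_on k S (\<lambda>u. dder f u v)" using Suc.prems(2) by simp
  qed
  then show ?case
    using Suc.prems differentiable_cong_open[OF assms(1) _ Suc.prems(1)] by auto
qed

lemma smooth_on_cong:
  assumes "smooth_on S f" "open S" "\<And>y. y \<in> S \<Longrightarrow> f y = g y"
  shows "smooth_on S g"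
  using assms Ck_on_cong unfolding smooth_on_def by metis

lemma Ck_on_subset: "Ck_on k S f \<Longrightarrow> T \<subseteq> S \<Longrightarrow> Ck_on k T f"
  by (induction k arbitrary: f) (auto intro: continuous_on_subset)

lemma smooth_on_subset: "smooth_on S f \<Longrightarrow> T \<subseteq> S \<Longrightarrow> smooth_on T f"
  unfolding smooth_on_def using Ck_on_subset by blast

lemma smooth_on_differentiable: "smooth_on S f \<Longrightarrow> u \<in> S \<Longrightarrow> f differentiable (at u)"
  unfolding smooth_on_def by (metis Ck_on_differentiable)

lemma smooth_on_has_derivative: "smooth_on S f \<Longrightarrow> u \<in> S \<Longrightarrow> (f has_derivative dder f u) (at u)"
  using smooth_on_differentiable frechet_derivative_works by blast

lemma smooth_on_continuous: "smooth_on S f \<Longrightarrow> continuous_on S f"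
  unfolding smooth_on_def by (metis Ck_on.simps(1))

lemma smooth_on_dder_const: "smooth_on S f \<Longrightarrow> smooth_on S (\<lambda>u. dder f u v)"
  unfolding smooth_on_def by (metis Ck_on.simps(2))

lemma linear_dder: "smooth_on S f \<Longrightarrow> u \<in> S \<Longrightarrow> linear (dder f u)"
  using smooth_on_differentiable linear_frechet_derivative by blast

lemma dder_eqI: "(f has_derivative D) (at u) \<Longrightarrow> dder f u v = D v"
  using frechet_derivative_at by metis

lemma Ck_on_const: "Ck_on k S (\<lambda>_. c)"
  by (induction k arbitrary: c) auto

lemma smooth_on_const: "smooth_on S (\<lambda>_. c)"
  by (simp add: smooth_on_def Ck_on_const)

lemma dder_linear_compose:
  assumes "bounded_linear h" "f differentiable (at u)"
  shows "dder (\<lambda>y. h (f y)) u v = h (dder f u v)"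
  using bounded_linear.has_derivative[OF assms(1)] assms(2)
  by (intro dder_eqI) (auto simp: frechet_derivative_works)

lemma Ck_on_linear:
  assumes "bounded_linear h" "open S" "Ck_on k S f"
  shows "Ck_on k S (\<lambda>u. h (f u))"
  using assms(3)
proof (induction k arbitrary: f)
  case 0
  then show ?case by (auto intro: bounded_linear.continuous_on[OF assms(1)])
next
  case (Suc k)
  have "Ck_on k S (\<lambda>u. dder (\<lambda>u. h (f u)) u v)" for v
    by (rule Ck_on_cong[OF assms(2) _ Suc.IH[of "\<lambda>u. dder f u v"]])
       (use Suc.prems in \<open>auto simp: dder_linear_compose[OF assms(1)]\<close>)
  moreover have "(\<lambda>u. h (f u)) differentiable (at u)" if "u \<in> S" for u
    using Suc.prems that bounded_linear.has_derivative[OF assms(1)]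
    unfolding differentiable_def Ck_on.simps by blast
  ultimately show ?case by simp
qed

lemma smooth_on_linear:
  "bounded_linear h \<Longrightarrow> open S \<Longrightarrow> smooth_on S f \<Longrightarrow> smooth_on S (\<lambda>u. h (f u))"
  by (simp add: smooth_on_def Ck_on_linear)

lemma dder_add:
  assumes "f differentiable (at u)" "g differentiable (at u)"
  shows "dder (\<lambda>y. f y + g y) u v = dder f u v + dder g u v"
  using assms by (intro dder_eqI) (auto simp: frechet_derivative_works intro!: derivative_eq_intros)

lemma Ck_on_add:
  assumes "open S" "Ck_on k S f" "Ck_on k S g"
  shows "Ck_on k S (\<lambda>u. f u + g u)"
  using assms(2,3)
proof (induction k arbitrary: f g)
  case 0
  then show ?case by (auto intro: continuous_on_add)
next
  case (Suc k)
  have "Ck_on k S (\<lambda>u. dder (\<lambda>u. f u + g u) u v)" for v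
    by (rule Ck_on_cong[OF assms(1) _ Suc.IH[of "\<lambda>u. dder f u v" "\<lambda>u. dder g u v"]])
       (use Suc.prems in \<open>auto simp: dder_add\<close>)
  then show ?case using Suc.prems by auto
qed

lemma smooth_on_add:
  "open S \<Longrightarrow> smooth_on S f \<Longrightarrow> smooth_on S g \<Longrightarrow> smooth_on S (\<lambda>u. f u + g u)"
  by (simp add: smooth_on_def Ck_on_add)

lemma dder_bilinear:
  assumes "bounded_bilinear h" "f differentiable (at u)" "g differentiable (at u)"
  shows "dder (\<lambda>y. h (f y) (g y)) u v = h (f u) (dder g u v) + h (dder f u v) (g u)"
  using assms(2,3) by (intro dder_eqI) (auto simp: frechet_derivative_works intro!: bounded_bilinear.FDERIV[OF assms(1)])

lemma Ck_on_bilinear: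
  assumes "bounded_bilinear h" "open S" "Ck_on k S f" "Ck_on k S g"
  shows "Ck_on k S (\<lambda>u. h (f u) (g u))"
  using assms(3,4)
proof (induction k arbitrary: f g)
  case 0
  then show ?case by (auto intro: bounded_bilinear.continuous_on[OF assms(1)])
next
  case (Suc k)
  have "Ck_on k S (\<lambda>u. dder (\<lambda>u. h (f u) (g u)) u v)" for v
  proof (rule Ck_on_cong[OF assms(2) _ Ck_on_add[OF assms(2) Suc.IH[of f "\<lambda>u. dder g u v"] Suc.IH[of "\<lambda>u. dder f u v" g]]])
    show "Ck_on k S f" "Ck_on k S g" using Suc.prems[THEN Ck_on_pred] .
    show "Ck_on k S (\<lambda>u. dder f u v)" "Ck_on k S (\<lambda>u. dder g u v)" using Suc.prems by auto
  qed (use Suc.prems in \<open>auto simp: dder_bilinear[OF assms(1)]\<close>)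
  moreover have "(\<lambda>u. h (f u) (g u)) differentiable (at u)" if "u \<in> S" for u
    using Suc.prems that bounded_bilinear.FDERIV[OF assms(1)]
    unfolding differentiable_def Ck_on.simps by blast
  ultimately show ?case by simp
qed

lemma smooth_on_bilinear:
  "bounded_bilinear h \<Longrightarrow> open S \<Longrightarrow> smooth_on S f \<Longrightarrow> smooth_on S g \<Longrightarrow> smooth_on S (\<lambda>u. h (f u) (g u))"
  by (simp add: smooth_on_def Ck_on_bilinear)

lemma bounded_bilinear_matrix_vector_mult:
  "bounded_bilinear ((*v) :: real^'n^'m \<Rightarrow> real^'n \<Rightarrow> real^'m)"
  unfolding bilinear_conv_bounded_bilinear[symmetric] bilinear_def
  by (auto intro!: linearI simp: matrix_vector_mult_add_rdistrib matrix_vector_right_distrib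
      scaleR_matrix_vector_assoc matrix_vector_mult_scaleR)

lemmas smooth_on_scaleR = smooth_on_bilinear[OF bounded_bilinear_scaleR]
lemmas smooth_on_mult = smooth_on_bilinear[OF bounded_bilinear_mult[where 'a=real]]
lemmas smooth_on_inner = smooth_on_bilinear[OF bounded_bilinear_inner]
lemmas smooth_on_mv = smooth_on_bilinear[OF bounded_bilinear_matrix_vector_mult]
lemmas smooth_on_nth = smooth_on_linear[OF bounded_linear_vec_nth]

lemma smooth_on_bform:
  "open S \<Longrightarrow> smooth_on S B \<Longrightarrow> smooth_on S X \<Longrightarrow> smooth_on S Y \<Longrightarrow> smooth_on S (\<lambda>u. bform (B u) (X u) (Y u))"
  unfolding bform_def by (intro smooth_on_inner smooth_on_mv)

lemma smooth_on_minus: "open S \<Longrightarrow> smooth_on S f \<Longrightarrow> smooth_on S (\<lambda>u. - f u)"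
  using smooth_on_linear[of "\<lambda>x. - x"] by (simp add: bounded_linear_minus bounded_linear_ident)

lemma smooth_on_diff:
  assumes "open S" "smooth_on S f" "smooth_on S g"
  shows "smooth_on S (\<lambda>u. f u - g u)"
  using smooth_on_add[OF assms(1,2) smooth_on_minus[OF assms(1,3)]] by simp

lemma smooth_on_sum:
  assumes "open S" "\<And>i. i \<in> I \<Longrightarrow> smooth_on S (f i)"
  shows "smooth_on S (\<lambda>u. \<Sum>i\<in>I. f i u)"
  using assms(2)
  by (induction I rule: infinite_finite_induct) (auto simp: assms(1) smooth_on_const smooth_on_add)

lemma smooth_on_prod:
  fixes f :: "'i \<Rightarrow> real^'n \<Rightarrow> real"
  assumes "open S" "\<And>i. i \<in> I \<Longrightarrow> smooth_on S (f i)"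
  shows "smooth_on S (\<lambda>u. \<Prod>i\<in>I. f i u)"
  using assms(2)
  by (induction I rule: infinite_finite_induct) (auto simp: assms(1) smooth_on_const smooth_on_mult)

lemma smooth_on_vec:
  fixes f :: "real^'n \<Rightarrow> 'm::finite \<Rightarrow> real"
  assumes "open S" "\<And>i. smooth_on S (\<lambda>u. f u i)"
  shows "smooth_on S (\<lambda>u. \<chi> i. f u i)"
proof -
  have "(\<lambda>u. \<chi> i. f u i) = (\<lambda>u. \<Sum>i\<in>UNIV. f u i *\<^sub>R axis i 1)"
    by (auto simp: fun_eq_iff vec_eq_iff sum_component axis_def if_distrib cong: if_cong)
  then show ?thesis using assms by (simp only:) (intro smooth_on_sum smooth_on_scaleR smooth_on_const)
qed

lemma dder_inverse:
  fixes f :: "real^'n \<Rightarrow> real"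
  assumes "f differentiable (at u)" "f u \<noteq> 0"
  shows "dder (\<lambda>y. inverse (f y)) u v = - (inverse (f u) * inverse (f u) * dder f u v)"
  using assms by (intro dder_eqI) (auto simp: frechet_derivative_works intro!: derivative_eq_intros)

lemma Ck_on_inverse:
  fixes f :: "real^'n \<Rightarrow> real"
  assumes "open S" "\<And>u. u \<in> S \<Longrightarrow> f u \<noteq> 0" "smooth_on S f"
  shows "Ck_on k S (\<lambda>u. inverse (f u))"
proof (induction k)
  case 0
  then show ?case using assms smooth_on_continuous by (auto intro!: continuous_on_inverse)
next
  case (Suc k)
  have "Ck_on k S (\<lambda>u. - (inverse (f u) * inverse (f u) * dder f u v))" for v
    using smooth_on_dder_const[OF assms(3), of v] Suc.IH unfolding smooth_on_def
    by (intro Ck_on_linear[OF bounded_linear_minus[OF bounded_linear_ident]] assms(1)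
        Ck_on_bilinear[OF bounded_bilinear_mult]) auto
  then have "Ck_on k S (\<lambda>u. dder (\<lambda>u. inverse (f u)) u v)" for v
    by (rule Ck_on_cong[OF assms(1), rotated])
       (use assms in \<open>auto simp: dder_inverse smooth_on_differentiable\<close>)
  moreover have "(\<lambda>u. inverse (f u)) differentiable (at u)" if "u \<in> S" for u
    using assms that smooth_on_differentiable by (intro differentiable_inverse) auto
  ultimately show ?case by simp
qed

lemma smooth_on_divide:
  fixes f g :: "real^'n \<Rightarrow> real"
  assumes "open S" "smooth_on S f" "smooth_on S g" "\<And>u. u \<in> S \<Longrightarrow> g u \<noteq> 0"
  shows "smooth_on S (\<lambda>u. f u / g u)"
  unfolding divide_inverse
  using assms by (intro smooth_on_mult) (auto simp: smooth_on_def Ck_on_inverse)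

lemma smooth_on_det:
  fixes F :: "real^'n \<Rightarrow> real^'m^'m"
  assumes "open S" "\<And>i j. smooth_on S (\<lambda>u. F u $ i $ j)"
  shows "smooth_on S (\<lambda>u. det (F u))"
  unfolding det_def
  using assms by (intro smooth_on_sum smooth_on_mult smooth_on_prod smooth_on_const)

lemma matrix_inv_inverse:
  assumes "invertible A"
  shows "A ** matrix_inv A = mat 1" "matrix_inv A ** A = mat 1"
  using someI_ex[of "\<lambda>A'. A ** A' = mat 1 \<and> A' ** A = mat 1"] assms
  unfolding matrix_inv_def invertible_def by blast+

text \<open>By Cramer's rule the entries of the inverse matrix are quotients of determinants.\<close>

lemma smooth_on_matrix_inv_mv:
  fixes G :: "real^'n \<Rightarrow> real^'m^'m"
  assumes "open S" "smooth_on S G" "smooth_on S w" "\<And>u. u \<in> S \<Longrightarrow> invertible (G u)"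
  shows "smooth_on S (\<lambda>u. matrix_inv (G u) *v w u)"
proof -
  define R where "R u k = det (\<chi> i j. if j = k then w u $ i else G u $ i $ j) / det (G u)" for u k
  have entry: "smooth_on S (\<lambda>u. G u $ i $ j)" "smooth_on S (\<lambda>u. w u $ i)" for i j
    using assms by (auto intro!: smooth_on_nth)
  have "smooth_on S (\<lambda>u. (\<chi> i j. if j = k then w u $ i else G u $ i $ j) $ i $ j)" for k i j
    using entry by (cases "j = k") auto
  then have "smooth_on S (\<lambda>u. \<chi> k. R u k)"
    unfolding R_def using assms entry
    by (intro smooth_on_vec smooth_on_divide smooth_on_det) (auto simp: invertible_det_nz)
  moreover have "(\<chi> k. R u k) = matrix_inv (G u) *v w u" if "u \<in> S" for u
  proof -
    have "G u *v (matrix_inv (G u) *v w u) = w u"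
      using assms(4)[OF that] by (simp add: matrix_vector_mul_assoc matrix_inv_inverse)
    then show ?thesis
      using cramer[of "G u"] assms(4)[OF that] by (simp add: R_def invertible_det_nz)
  qed
  ultimately show ?thesis by (rule smooth_on_cong[OF _ assms(1)])
qed

lemma dder_axis_sum:
  fixes f :: "real^'n \<Rightarrow> 'b::real_normed_vector"
  assumes "smooth_on S f" "u \<in> S"
  shows "dder f u x = (\<Sum>i\<in>UNIV. x $ i *\<^sub>R dder f u (axis i 1))"
proof -
  interpret linear "dder f u" using linear_dder[OF assms] .
  have "dder f u x = dder f u (\<Sum>i\<in>UNIV. x $ i *\<^sub>R axis i 1)"
    by (simp flip: scalar_mult_eq_scaleR add: basis_expansion)
  then show ?thesis by (simp add: sum scaleR)
qed

text \<open>A derivative along a variable direction is a combination of partial derivatives.\<close>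

lemma smooth_on_dder:
  fixes f :: "real^'n \<Rightarrow> 'b::real_normed_vector"
  assumes "open S" "smooth_on S f" "smooth_on S X"
  shows "smooth_on S (\<lambda>u. dder f u (X u))"
proof (rule smooth_on_cong[OF _ assms(1)])
  show "smooth_on S (\<lambda>u. \<Sum>i\<in>UNIV. X u $ i *\<^sub>R dder f u (axis i 1))"
    by (intro smooth_on_sum smooth_on_scaleR smooth_on_nth smooth_on_dder_const assms)
qed (simp flip: dder_axis_sum[OF assms(2)])

lemmas smooth_on_intros = smooth_on_const smooth_on_add smooth_on_diff smooth_on_minus
  smooth_on_scaleR smooth_on_mult smooth_on_inner smooth_on_mv smooth_on_bform smooth_on_dder

lemma dder_diff:
  assumes "f differentiable (at u)" "g differentiable (at u)"
  shows "dder (\<lambda>y. f y - g y) u v = dder f u v - dder g u v"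
  using assms by (intro dder_eqI) (auto simp: frechet_derivative_works intro!: derivative_eq_intros)

lemma dder_minus:
  assumes "f differentiable (at u)"
  shows "dder (\<lambda>y. - f y) u v = - dder f u v"
  using assms by (intro dder_eqI) (auto simp: frechet_derivative_works intro!: derivative_eq_intros)

lemma dder_mult:
  fixes f g :: "real^'n \<Rightarrow> real"
  assumes "f differentiable (at u)" "g differentiable (at u)"
  shows "dder (\<lambda>y. f y * g y) u v = f u * dder g u v + dder f u v * g u"
  by (rule dder_bilinear[OF bounded_bilinear_mult assms])

lemma dder_nth:
  fixes f :: "real^'n \<Rightarrow> 'b::euclidean_space^'m"
  assumes "f differentiable (at u)"
  shows "dder (\<lambda>y. f y $ i) u v = dder f u v $ i"
  by (rule dder_linear_compose[OF bounded_linear_vec_nth assms])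

lemma dder_mv:
  fixes P :: "real^'n \<Rightarrow> real^'m^'k"
  assumes "P differentiable (at u)" "X differentiable (at u)"
  shows "dder (\<lambda>y. P y *v X y) u v = P u *v dder X u v + dder P u v *v X u"
  by (rule dder_bilinear[OF bounded_bilinear_matrix_vector_mult assms])

lemma differentiable_mv:
  fixes P :: "real^'n \<Rightarrow> real^'m^'k"
  assumes "P differentiable (at u)" "X differentiable (at u)"
  shows "(\<lambda>y. P y *v X y) differentiable (at u)"
  using bounded_bilinear.FDERIV[OF bounded_bilinear_matrix_vector_mult] assms
  unfolding differentiable_def by blast

lemma dder_bform:
  assumes "B differentiable (at u)" "X differentiable (at u)" "Y differentiable (at u)"
  shows "dder (\<lambda>y. bform (B y) (X y) (Y y)) u v =
    bform (dder B u v) (X u) (Y u) + bform (B u) (dder X u v) (Y u) + bform (B u) (X u) (dder Y u v)"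
  unfolding bform_def
  using assms by (simp add: dder_bilinear[OF bounded_bilinear_inner] dder_mv differentiable_mv
      inner_add_right)

lemma smooth_on_has_derivative_line:
  fixes f :: "real^'n \<Rightarrow> 'b::real_normed_vector"
  assumes "smooth_on S f" "a + s *\<^sub>R v \<in> S"
  shows "((\<lambda>s. f (a + s *\<^sub>R v)) has_derivative (\<lambda>r. r *\<^sub>R dder f (a + s *\<^sub>R v) v)) (at s)"
proof -
  have "((\<lambda>s. a + s *\<^sub>R v) has_derivative (\<lambda>r. r *\<^sub>R v)) (at s)"
    by (auto intro!: derivative_eq_intros)
  from diff_chain_at[OF this smooth_on_has_derivative[OF assms]]
  show ?thesis using linear_dder[OF assms] by (simp add: o_def linear_cmul)
qed

text \<open>This is the mean value theorem in each of the two variables.  The second difference is symmetric in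
  \<open>v\<close> and \<open>w\<close>, so that the iterated derivatives in the two orders agree at points near \<open>u\<close>, and in the
  limit at \<open>u\<close>.\<close>

lemma second_difference_mvt:
  fixes f :: "real^'n \<Rightarrow> real"
  assumes S: "smooth_on S f" and h: "0 < h"
    and sub: "\<And>s t. 0 \<le> s \<Longrightarrow> s \<le> h \<Longrightarrow> 0 \<le> t \<Longrightarrow> t \<le> h \<Longrightarrow> u + s *\<^sub>R v + t *\<^sub>R w \<in> S"
  shows "\<exists>s t. 0 < s \<and> s < h \<and> 0 < t \<and> t < h \<and>
    f (u + h *\<^sub>R v + h *\<^sub>R w) - f (u + h *\<^sub>R v) - f (u + h *\<^sub>R w) + f u
      = h * h * dder (\<lambda>y. dder f y v) (u + s *\<^sub>R v + t *\<^sub>R w) w"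
proof -
  have S1: "smooth_on S (\<lambda>y. dder f y v)" using smooth_on_dder_const[OF S] .
  have d1: "((\<lambda>s. f (u + s *\<^sub>R v + t *\<^sub>R w)) has_derivative (\<lambda>r. r * dder f (u + s *\<^sub>R v + t *\<^sub>R w) v)) (at s)"
    if "0 \<le> s" "s \<le> h" "0 \<le> t" "t \<le> h" for s t
    using smooth_on_has_derivative_line[OF S, of "u + t *\<^sub>R w" s v] sub[OF that]
    by (simp add: algebra_simps)
  have d2: "((\<lambda>t. dder f (u + s *\<^sub>R v + t *\<^sub>R w) v) has_derivative
      (\<lambda>r. r * dder (\<lambda>y. dder f y v) (u + s *\<^sub>R v + t *\<^sub>R w) w)) (at t)"
    if "0 \<le> s" "s \<le> h" "0 \<le> t" "t \<le> h" for s t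
    using smooth_on_has_derivative_line[OF S1 sub[OF that]] by simp
  have e1: "((\<lambda>s. f (u + s *\<^sub>R v + h *\<^sub>R w) - f (u + s *\<^sub>R v)) has_derivative
    (\<lambda>r. r * (dder f (u + s *\<^sub>R v + h *\<^sub>R w) v - dder f (u + s *\<^sub>R v) v))) (at s)"
    if "0 \<le> s" "s \<le> h" for s
    using has_derivative_diff[OF d1[of s h] d1[of s 0]] that h by (simp add: algebra_simps)
  obtain s where s: "0 < s" "s < h"
    "f (u + h *\<^sub>R v + h *\<^sub>R w) - f (u + h *\<^sub>R v) - (f (u + h *\<^sub>R w) - f u)
      = h * (dder f (u + s *\<^sub>R v + h *\<^sub>R w) v - dder f (u + s *\<^sub>R v) v)"
    using mvt_simple[OF h has_derivative_at_withinI[OF e1]] by auto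
  obtain t where t: "0 < t" "t < h"
    "dder f (u + s *\<^sub>R v + h *\<^sub>R w) v - dder f (u + s *\<^sub>R v) v
      = h * dder (\<lambda>y. dder f y v) (u + s *\<^sub>R v + t *\<^sub>R w) w"
    using mvt_simple[OF h has_derivative_at_withinI[OF d2[of s]]] s by auto
  show ?thesis using s t by (intro exI[of _ s] exI[of _ t]) (auto simp: algebra_simps)
qed

lemma dder_dder_commute_real:
  fixes f :: "real^'n \<Rightarrow> real"
  assumes "open S" "smooth_on S f" "u \<in> S"
  shows "dder (\<lambda>y. dder f y v) u w = dder (\<lambda>y. dder f y w) u v"
proof (rule ccontr)
  define p where "p y = dder (\<lambda>y. dder f y v) y w" for y
  define q where "q y = dder (\<lambda>y. dder f y w) y v" for y
  assume "\<not> ?thesis"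
  then have ne: "0 < \<bar>p u - q u\<bar> / 2" by (simp add: p_def q_def)
  have cont: "isCont p u" "isCont q u"
    unfolding p_def q_def using assms smooth_on_continuous[OF smooth_on_dder_const[OF smooth_on_dder_const]]
    by (metis continuous_on_eq_continuous_at)+
  have "\<forall>\<^sub>F y in nhds u. y \<in> S \<and> dist (p y) (p u) < \<bar>p u - q u\<bar> / 2 \<and> dist (q y) (q u) < \<bar>p u - q u\<bar> / 2"
    using cont ne assms unfolding continuous_at tendsto_at_iff_tendsto_nhds
    by (intro eventually_conj tendstoD eventually_nhds_in_open) auto
  then obtain d where d: "d > 0" and
    near: "\<And>y. dist y u < d \<Longrightarrow> y \<in> S \<and> dist (p y) (p u) < \<bar>p u - q u\<bar> / 2 \<and> dist (q y) (q u) < \<bar>p u - q u\<bar> / 2"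
    unfolding eventually_nhds_metric by blast
  define h where "h = d / (2 * (norm v + norm w + 1))"
  have pos: "norm v + norm w + 1 > 0" by (smt (verit) norm_ge_zero)
  then have h: "h > 0" using d by (simp add: h_def)
  have close: "dist (u + s *\<^sub>R v + t *\<^sub>R w) u < d" if "0 \<le> s" "s \<le> h" "0 \<le> t" "t \<le> h" for s t
  proof -
    have "dist (u + s *\<^sub>R v + t *\<^sub>R w) u = norm (s *\<^sub>R v + t *\<^sub>R w)" by (simp add: dist_norm algebra_simps)
    also have "\<dots> \<le> s * norm v + t * norm w" using that norm_triangle_ineq[of "s *\<^sub>R v" "t *\<^sub>R w"] by simp
    also have "\<dots> \<le> h * norm v + h * norm w" using that by (intro add_mono mult_right_mono) auto
    also have "\<dots> \<le> h * (norm v + norm w + 1)" using h by (simp add: algebra_simps)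
    also have "\<dots> = d / 2" using pos by (simp add: h_def divide_simps)
    finally show ?thesis using d by simp
  qed
  obtain s t where st: "0 < s" "s < h" "0 < t" "t < h"
    "f (u + h *\<^sub>R v + h *\<^sub>R w) - f (u + h *\<^sub>R v) - f (u + h *\<^sub>R w) + f u = h * h * p (u + s *\<^sub>R v + t *\<^sub>R w)"
    using second_difference_mvt[OF assms(2) h, of u v w] near close unfolding p_def by blast
  have near': "u + s *\<^sub>R w + t *\<^sub>R v \<in> S" if "0 \<le> s" "s \<le> h" "0 \<le> t" "t \<le> h" for s t
    using near[OF close[OF that(3,4,1,2)]] by (simp add: add.commute add.left_commute)
  obtain s' t' where st': "0 < s'" "s' < h" "0 < t'" "t' < h"
    "f (u + h *\<^sub>R w + h *\<^sub>R v) - f (u + h *\<^sub>R w) - f (u + h *\<^sub>R v) + f u = h * h * q (u + s' *\<^sub>R w + t' *\<^sub>R v)"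
    using second_difference_mvt[OF assms(2) h near'] unfolding q_def by blast
  have swap: "u + h *\<^sub>R w + h *\<^sub>R v = u + h *\<^sub>R v + h *\<^sub>R w" by simp
  have "h * h * p (u + s *\<^sub>R v + t *\<^sub>R w) = h * h * q (u + s' *\<^sub>R w + t' *\<^sub>R v)"
    using st(5) st'(5)[unfolded swap] by linarith
  then have "p (u + s *\<^sub>R v + t *\<^sub>R w) = q (u + t' *\<^sub>R v + s' *\<^sub>R w)" using h by (simp add: add.commute add.left_commute)
  moreover have "dist (p (u + s *\<^sub>R v + t *\<^sub>R w)) (p u) < \<bar>p u - q u\<bar> / 2"
    "dist (q (u + t' *\<^sub>R v + s' *\<^sub>R w)) (q u) < \<bar>p u - q u\<bar> / 2"
    using near close st st' by simp_all
  ultimately show False by (auto simp: dist_real_def abs_if split: if_splits)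
qed

lemma dder_dder_commute:
  fixes f :: "real^'n \<Rightarrow> real^'m"
  assumes "open S" "smooth_on S f" "u \<in> S"
  shows "dder (\<lambda>y. dder f y v) u w = dder (\<lambda>y. dder f y w) u v"
proof -
  have eq: "dder (\<lambda>y. dder f y v) u w $ i = dder (\<lambda>y. dder (\<lambda>z. f z $ i) y v) u w" for v w i
  proof -
    have "dder (\<lambda>y. dder f y v) u w $ i = dder (\<lambda>y. dder f y v $ i) u w"
      using assms by (intro dder_nth[symmetric] smooth_on_differentiable[OF smooth_on_dder_const])
    also have "\<dots> = dder (\<lambda>y. dder (\<lambda>z. f z $ i) y v) u w"
      using assms
      by (intro dder_cong_vec[OF assms(1,3)])
        (simp add: dder_nth smooth_on_differentiable)
    finally show ?thesis .
  qed
  show ?thesis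
    unfolding vec_eq_iff eq
    using dder_dder_commute_real[OF assms(1) smooth_on_nth[OF assms(1,2)] assms(3)] by blast
qed

lemma dder_dder:
  fixes f :: "real^'n \<Rightarrow> 'b::real_normed_vector"
  assumes "open S" "smooth_on S f" "smooth_on S X" "u \<in> S"
  shows "dder (\<lambda>y. dder f y (X y)) u w = dder (\<lambda>y. dder f y (X u)) u w + dder f u (dder X u w)"
proof -
  have df: "((\<lambda>y. dder f y (axis i 1)) has_derivative dder (\<lambda>y. dder f y (axis i 1)) u) (at u)" for i
    using smooth_on_has_derivative[OF smooth_on_dder_const[OF assms(2)] assms(4)] .
  have dX: "((\<lambda>y. X y $ i) has_derivative (\<lambda>w. dder X u w $ i)) (at u)" for i
    using bounded_linear.has_derivative[OF bounded_linear_vec_nth smooth_on_has_derivative[OF assms(3,4)]] .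
  have dsum: "((\<lambda>y. \<Sum>i\<in>UNIV. X y $ i *\<^sub>R dder f y (axis i 1)) has_derivative (\<lambda>w. \<Sum>i\<in>UNIV.
      X u $ i *\<^sub>R dder (\<lambda>y. dder f y (axis i 1)) u w + dder X u w $ i *\<^sub>R dder f u (axis i 1))) (at u)"
  proof (rule has_derivative_sum)
    fix i
    show "((\<lambda>y. X y $ i *\<^sub>R dder f y (axis i 1)) has_derivative (\<lambda>w.
      X u $ i *\<^sub>R dder (\<lambda>y. dder f y (axis i 1)) u w + dder X u w $ i *\<^sub>R dder f u (axis i 1))) (at u)"
      using has_derivative_scaleR[OF dX[of i] df[of i]] .
  qed
  have dsum': "((\<lambda>y. \<Sum>i\<in>UNIV. X u $ i *\<^sub>R dder f y (axis i 1)) has_derivative (\<lambda>w. \<Sum>i\<in>UNIV.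
      X u $ i *\<^sub>R dder (\<lambda>y. dder f y (axis i 1)) u w)) (at u)"
  proof (rule has_derivative_sum)
    fix i
    show "((\<lambda>y. X u $ i *\<^sub>R dder f y (axis i 1)) has_derivative
        (\<lambda>w. X u $ i *\<^sub>R dder (\<lambda>y. dder f y (axis i 1)) u w)) (at u)"
      using bounded_linear.has_derivative[OF bounded_linear_scaleR_right df[of i]] .
  qed
  have "dder (\<lambda>y. dder f y (X y)) u w = dder (\<lambda>y. \<Sum>i\<in>UNIV. X y $ i *\<^sub>R dder f y (axis i 1)) u w"
    by (rule dder_cong_vec[OF assms(1,4)], rule dder_axis_sum[OF assms(2)])
  also have "\<dots> = (\<Sum>i\<in>UNIV. X u $ i *\<^sub>R dder (\<lambda>y. dder f y (axis i 1)) u w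
      + dder X u w $ i *\<^sub>R dder f u (axis i 1))"
    by (rule dder_eqI[OF dsum])
  also have "\<dots> = (\<Sum>i\<in>UNIV. X u $ i *\<^sub>R dder (\<lambda>y. dder f y (axis i 1)) u w) + dder f u (dder X u w)"
    using dder_axis_sum[OF assms(2,4), of "dder X u w"] by (simp add: sum.distrib)
  also have "(\<Sum>i\<in>UNIV. X u $ i *\<^sub>R dder (\<lambda>y. dder f y (axis i 1)) u w)
    = dder (\<lambda>y. \<Sum>i\<in>UNIV. X u $ i *\<^sub>R dder f y (axis i 1)) u w"
    by (rule dder_eqI[OF dsum', symmetric])
  also have "\<dots> = dder (\<lambda>y. dder f y (X u)) u w"
    by (rule dder_cong_vec[OF assms(1,4)], rule dder_axis_sum[OF assms(2), symmetric])
  finally show ?thesis .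
qed

lemma second_derivative_nonpos_at_max:
  fixes f :: "real^'n \<Rightarrow> real"
  assumes "open S" "smooth_on S f" "u \<in> S" "\<And>y. y \<in> S \<Longrightarrow> f y \<le> f u"
  shows "dder f u x = 0" and "dder (\<lambda>y. dder f y x) u x \<le> 0"
proof -
  define h where "h t = f (u + t *\<^sub>R x)" for t
  define h' where "h' t = dder f (u + t *\<^sub>R x) x" for t
  have S1: "smooth_on S (\<lambda>y. dder f y x)" using smooth_on_dder_const[OF assms(2)] .
  have "continuous_on UNIV (\<lambda>t. u + t *\<^sub>R x)" by (intro continuous_intros)
  then have "open ((\<lambda>t. u + t *\<^sub>R x) -` S)" by (rule open_vimage[OF assms(1)])
  moreover have "0 \<in> (\<lambda>t. u + t *\<^sub>R x) -` S" using assms(3) by simp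
  ultimately obtain d where "d > 0" "ball 0 d \<subseteq> (\<lambda>t. u + t *\<^sub>R x) -` S"
    by (rule openE)
  then have d: "d > 0" "\<And>t. \<bar>t\<bar> < d \<Longrightarrow> u + t *\<^sub>R x \<in> S"
    by (auto simp: subset_iff)
  have h1: "DERIV h t :> h' t" if "\<bar>t\<bar> < d" for t
    using smooth_on_has_derivative_line[OF assms(2) d(2)[OF that]]
    by (simp add: h_def[abs_def] h'_def has_field_derivative_def mult.commute[of _ "dder _ _ _"])
  have h2: "DERIV h' 0 :> dder (\<lambda>y. dder f y x) u x"
    using smooth_on_has_derivative_line[OF S1, of u 0 x] assms(3)
    by (simp add: h'_def[abs_def] has_field_derivative_def mult.commute[of _ "dder _ _ _"])
  have hmax: "h t \<le> h 0" if "\<bar>t\<bar> < d" for t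
    using assms(4)[OF d(2)[OF that]] by (simp add: h_def)
  have "h' 0 = 0"
    using DERIV_local_max[OF h1[of 0] d(1)] hmax d(1) by simp
  then show "dder f u x = 0" by (simp add: h'_def)
  show "dder (\<lambda>y. dder f y x) u x \<le> 0"
  proof (rule ccontr)
    assume "\<not> ?thesis"
    then obtain e where e: "e > 0" "\<And>t. 0 < t \<Longrightarrow> t < e \<Longrightarrow> h' 0 < h' t"
      using DERIV_pos_inc_right[OF h2] by (auto simp: )
    define t where "t = min d e / 2"
    have t: "0 < t" "t < d" "t < e" using d(1) e(1) by (auto simp: t_def)
    obtain z where "0 < z" "z < t" "h t - h 0 = (t - 0) * h' z"
      using MVT2[of 0 t h h'] h1 t by auto
    then have "h t > h 0" using e(2)[of z] t \<open>h' 0 = 0\<close> by (smt (verit) mult_pos_pos)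
    then show False using hmax[of t] t by simp
  qed
qed

section \<open>The Levi-Civita connection in a chart\<close>

lemma bform_simps:
  "bform B (v + v') w = bform B v w + bform B v' w"
  "bform B v (w + w') = bform B v w + bform B v w'"
  "bform B (v - v') w = bform B v w - bform B v' w"
  "bform B v (w - w') = bform B v w - bform B v w'"
  "bform B (- v) w = - bform B v w"
  "bform B v (- w) = - bform B v w"
  "bform B (c *\<^sub>R v) w = c * bform B v w"
  "bform B v (c *\<^sub>R w) = c * bform B v w"
  "bform B 0 w = 0"
  "bform B v 0 = 0"
  by (simp_all add: bform_def inner_add_left inner_diff_left matrix_vector_right_distrib inner_add_right
      matrix_vector_mult_diff_distrib inner_diff_right matrix_vector_mult_scaleR linear_neg[OF matrix_vector_mul_linear])

lemma bform_scaleR_matrix: "bform (c *\<^sub>R B) v w = c * bform B v w"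
  by (simp add: bform_def scaleR_matrix_vector_assoc[symmetric])

lemma bform_symmetric: "transpose B = B \<Longrightarrow> bform B v w = bform B w v"
  by (metis bform_def dot_lmul_matrix inner_commute transpose_matrix_vector)

lemma bform_sum: "bform B v w = (\<Sum>i\<in>UNIV. \<Sum>j\<in>UNIV. v $ i * B $ i $ j * w $ j)"
  by (simp add: bform_def inner_vec_def matrix_vector_mult_def sum_distrib_left mult.assoc)

lemma bform_axis: "bform B v (axis l 1) = (\<Sum>i\<in>UNIV. v $ i * B $ i $ l)"
  unfolding bform_sum by (simp add: axis_def if_distrib cong: if_cong)

lemma bform_expand_right: "(\<Sum>l\<in>UNIV. z $ l * bform B v (axis l 1)) = bform B v z"
  unfolding bform_sum[of B v z] bform_axis sum_distrib_left
  by (subst sum.swap) (simp add: mult_ac)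

text \<open>The Christoffel symbols as a bilinear map on each tangent space: the difference between \<open>\<nabla>\<close> and the
  coordinate derivative.\<close>

definition christoffel_map :: "(real^'n \<Rightarrow> real^'n^'n) \<Rightarrow> real^'n \<Rightarrow> real^'n::finite \<Rightarrow> real^'n \<Rightarrow> real^'n" where
  "christoffel_map G u v w = (\<chi> k. \<Sum>i\<in>UNIV. \<Sum>j\<in>UNIV. christoffel G u k i j * v $ i * w $ j)"

lemma nabla_christoffel_map: "nabla G X Y u = dder Y u (X u) + christoffel_map G u (X u) (Y u)"
  by (simp add: nabla_def christoffel_map_def)

lemma christoffel_map_simps:
  "christoffel_map G u (v + v') w = christoffel_map G u v w + christoffel_map G u v' w"
  "christoffel_map G u v (w + w') = christoffel_map G u v w + christoffel_map G u v w'"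
  "christoffel_map G u (c *\<^sub>R v) w = c *\<^sub>R christoffel_map G u v w"
  "christoffel_map G u v (c *\<^sub>R w) = c *\<^sub>R christoffel_map G u v w"
  by (auto simp: christoffel_map_def vec_eq_iff sum.distrib[symmetric] sum_distrib_left algebra_simps
      intro!: sum.cong)

lemma christoffel_map_diff:
  "christoffel_map G u (v - v') w = christoffel_map G u v w - christoffel_map G u v' w"
  "christoffel_map G u v (w - w') = christoffel_map G u v w - christoffel_map G u v w'"
  using christoffel_map_simps(1)[of G u "v - v'" v' w] christoffel_map_simps(2)[of G u v "w - w'" w']
  by (simp_all add: algebra_simps)

text \<open>The right-hand side of the Koszul formula for two coordinate-constant fields, as a covector.\<close>

definition koszul_covector ::
    "(real^'n \<Rightarrow> real^'n^'n) \<Rightarrow> real^'n \<Rightarrow> real^'n \<Rightarrow> real^'n::finite \<Rightarrow> real^'n" where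
  "koszul_covector G u v w = (\<chi> l. (1/2) * (bform (dder G u v) w (axis l 1)
     + bform (dder G u w) v (axis l 1) - bform (dder G u (axis l 1)) v w))"

locale metric_chart =
  fixes U :: "(real^'n::finite) set" and G :: "real^'n \<Rightarrow> real^'n^'n"
  assumes open_U: "open U"
    and smooth_G: "smooth_on U G"
    and sym_G: "u \<in> U \<Longrightarrow> transpose (G u) = G u"
    and pos_G: "u \<in> U \<Longrightarrow> v \<noteq> 0 \<Longrightarrow> bform (G u) v v > 0"
begin

lemma g_commute: "u \<in> U \<Longrightarrow> bform (G u) v w = bform (G u) w v"
  using bform_symmetric sym_G by blast

lemma g_ext:
  assumes "u \<in> U" "\<And>z. bform (G u) v z = bform (G u) w z"
  shows "v = w"
proof -
  have "bform (G u) (v - w) (v - w) = 0" using assms(2) by (simp add: bform_simps)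
  then show ?thesis using pos_G[OF assms(1), of "v - w"] by fastforce
qed

lemma invertible_G: "u \<in> U \<Longrightarrow> invertible (G u)"
  unfolding invertible_left_inverse matrix_left_invertible_ker
  using pos_G by (metis bform_def inner_zero_right less_irrefl)

lemma dder_G_nth: "u \<in> U \<Longrightarrow> dder (\<lambda>y. G y $ i $ j) u v = dder G u v $ i $ j"
proof -
  assume u: "u \<in> U"
  have "G differentiable (at u)" using smooth_on_differentiable[OF smooth_G u] .
  then have "(\<lambda>y. G y $ i) differentiable (at u)"
    using bounded_linear.has_derivative[OF bounded_linear_vec_nth] unfolding differentiable_def by blast
  then show ?thesis using \<open>G differentiable (at u)\<close> by (simp add: dder_nth)
qed

lemma dder_G_expand: "u \<in> U \<Longrightarrow> dder G u v $ i $ j = (\<Sum>k\<in>UNIV. v $ k * dder G u (axis k 1) $ i $ j)"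
  using dder_axis_sum[OF smooth_G, of u v] by (simp add: sum_component)

lemma dder_G_commute:
  assumes "u \<in> U"
  shows "bform (dder G u x) v w = bform (dder G u x) w v"
proof -
  have "dder G u x $ i $ j = dder G u x $ j $ i" for i j
    unfolding dder_G_nth[OF assms, symmetric]
  proof (rule dder_cong_vec[OF open_U assms])
    fix y assume "y \<in> U"
    then have "transpose (G y) $ i $ j = G y $ i $ j" by (simp add: sym_G)
    then show "G y $ i $ j = G y $ j $ i" by (simp add: transpose_def)
  qed
  then show ?thesis by (intro bform_symmetric) (simp add: transpose_def vec_eq_iff)
qed

lemma christoffel_map_koszul:
  assumes u: "u \<in> U"
  shows "christoffel_map G u v w = matrix_inv (G u) *v koszul_covector G u v w"
proof -
  define A where "A i = dder G u (axis i 1)" for i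
  have 1: "bform (dder G u v) w (axis l 1) = (\<Sum>i\<in>UNIV. \<Sum>j\<in>UNIV. A i $ j $ l * v $ i * w $ j)" for v w l
    unfolding bform_axis dder_G_expand[OF u, of v] sum_distrib_left
    by (subst sum.swap) (simp add: A_def mult_ac)
  have 2: "bform (dder G u w) v (axis l 1) = (\<Sum>i\<in>UNIV. \<Sum>j\<in>UNIV. A j $ i $ l * v $ i * w $ j)" for l
    unfolding 1[of w v] by (subst sum.swap) (simp add: mult_ac)
  have 3: "bform (dder G u (axis l 1)) v w = (\<Sum>i\<in>UNIV. \<Sum>j\<in>UNIV. A l $ i $ j * v $ i * w $ j)" for l
    unfolding bform_sum by (simp add: A_def mult_ac)
  have K: "koszul_covector G u v w $ l = (\<Sum>i\<in>UNIV. \<Sum>j\<in>UNIV.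
      (1/2) * (A i $ j $ l + A j $ i $ l - A l $ i $ j) * v $ i * w $ j)" for l
    unfolding koszul_covector_def vec_lambda_beta 1[of v w] 2 3
    by (simp add: sum.distrib[symmetric] sum_subtractf[symmetric] sum_distrib_left algebra_simps)
  show ?thesis
  proof (simp add: vec_eq_iff christoffel_map_def christoffel_def dder_G_nth[OF u] matrix_vector_mult_def K
        flip: A_def, intro allI)
    fix k
    have "(\<Sum>l\<in>UNIV. matrix_inv (G u) $ k $ l * (\<Sum>i\<in>UNIV. \<Sum>j\<in>UNIV.
          (A i $ j $ l + A j $ i $ l - A l $ i $ j) * v $ i * w $ j / 2))
      = (\<Sum>i\<in>UNIV. \<Sum>j\<in>UNIV. \<Sum>l\<in>UNIV. matrix_inv (G u) $ k $ l *
          ((A i $ j $ l + A j $ i $ l - A l $ i $ j) * v $ i * w $ j / 2))"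
      unfolding sum_distrib_left by (subst sum.swap, rule sum.cong[OF refl], rule sum.swap)
    then show "(\<Sum>i\<in>UNIV. \<Sum>j\<in>UNIV. (\<Sum>l\<in>UNIV. matrix_inv (G u) $ k $ l *
          (A i $ j $ l + A j $ i $ l - A l $ i $ j)) * v $ i * w $ j / 2)
      = (\<Sum>l\<in>UNIV. matrix_inv (G u) $ k $ l * (\<Sum>i\<in>UNIV. \<Sum>j\<in>UNIV.
          (A i $ j $ l + A j $ i $ l - A l $ i $ j) * v $ i * w $ j / 2))"
      by (simp add: sum_distrib_right sum_distrib_left sum_divide_distrib mult_ac)
  qed
qed

lemma g_christoffel_map:
  assumes u: "u \<in> U"
  shows "bform (G u) (christoffel_map G u v w) z =
    (1/2) * (bform (dder G u v) w z + bform (dder G u w) v z - bform (dder G u z) v w)"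
proof -
  have "bform (G u) (christoffel_map G u v w) z = bform (G u) z (christoffel_map G u v w)"
    by (rule g_commute[OF u])
  also have "\<dots> = z \<bullet> koszul_covector G u v w"
    using invertible_G[OF u]
    by (simp add: christoffel_map_koszul[OF u] bform_def matrix_vector_mul_assoc matrix_inv_inverse)
  also have "\<dots> = (1/2) * ((\<Sum>l\<in>UNIV. z $ l * bform (dder G u v) w (axis l 1))
     + (\<Sum>l\<in>UNIV. z $ l * bform (dder G u w) v (axis l 1))
     - (\<Sum>l\<in>UNIV. z $ l * bform (dder G u (axis l 1)) v w))"
    by (simp add: inner_vec_def koszul_covector_def sum.distrib[symmetric] sum_subtractf[symmetric]
        sum_distrib_left algebra_simps)
  also have "(\<Sum>l\<in>UNIV. z $ l * bform (dder G u (axis l 1)) v w) = bform (dder G u z) v w"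
  proof -
    have "bform (dder G u z) v w = (\<Sum>i\<in>UNIV. \<Sum>j\<in>UNIV. \<Sum>l\<in>UNIV. z $ l * (v $ i * dder G u (axis l 1) $ i $ j * w $ j))"
      unfolding bform_sum dder_G_expand[OF u, of z]
      by (simp add: sum_distrib_left sum_distrib_right mult_ac)
    also have "\<dots> = (\<Sum>i\<in>UNIV. \<Sum>l\<in>UNIV. \<Sum>j\<in>UNIV. z $ l * (v $ i * dder G u (axis l 1) $ i $ j * w $ j))"
      by (rule sum.cong[OF refl], rule sum.swap)
    also have "\<dots> = (\<Sum>l\<in>UNIV. \<Sum>i\<in>UNIV. \<Sum>j\<in>UNIV. z $ l * (v $ i * dder G u (axis l 1) $ i $ j * w $ j))"
      by (rule sum.swap)
    finally show ?thesis by (simp add: bform_sum sum_distrib_left)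
  qed
  finally show ?thesis by (simp add: bform_expand_right)
qed

lemma christoffel_map_commute:
  assumes "u \<in> U"
  shows "christoffel_map G u v w = christoffel_map G u w v"
  by (rule g_ext[OF assms]) (simp add: g_christoffel_map[OF assms] dder_G_commute[OF assms, of _ v w])

lemma smooth_koszul_covector:
  "smooth_on U X \<Longrightarrow> smooth_on U Y \<Longrightarrow> smooth_on U (\<lambda>u. koszul_covector G u (X u) (Y u))"
  unfolding koszul_covector_def
  by (rule smooth_on_vec[OF open_U]) (intro smooth_on_intros open_U smooth_G; assumption)

lemma smooth_christoffel_map:
  assumes "smooth_on U X" "smooth_on U Y"
  shows "smooth_on U (\<lambda>u. christoffel_map G u (X u) (Y u))"
  by (rule smooth_on_cong[OF smooth_on_matrix_inv_mv[OF open_U smooth_G smooth_koszul_covector[OF assms] invertible_G] open_U])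
     (simp_all add: christoffel_map_koszul)

lemma smooth_nabla: "smooth_on U X \<Longrightarrow> smooth_on U Y \<Longrightarrow> smooth_on U (nabla G X Y)"
  unfolding nabla_christoffel_map[abs_def]
  by (intro smooth_on_intros smooth_christoffel_map open_U; assumption)

lemma smooth_lie_bracket: "smooth_on U X \<Longrightarrow> smooth_on U Y \<Longrightarrow> smooth_on U (lie_bracket X Y)"
  unfolding lie_bracket_def[abs_def] by (intro smooth_on_intros open_U; assumption)

lemma torsion_free: "u \<in> U \<Longrightarrow> nabla G X Y u - nabla G Y X u = lie_bracket X Y u"
  by (simp add: nabla_christoffel_map lie_bracket_def christoffel_map_commute[of u "X u"])

lemma metric_compatible:
  assumes "smooth_on U Y" "smooth_on U Z" "u \<in> U"
  shows "dder (\<lambda>y. bform (G y) (Y y) (Z y)) u (X u) =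
    bform (G u) (nabla G X Y u) (Z u) + bform (G u) (Y u) (nabla G X Z u)"
proof -
  have "bform (G u) (christoffel_map G u x y) z + bform (G u) y (christoffel_map G u x z) = bform (dder G u x) y z"
    for x y z
    using g_commute[OF assms(3), of y "christoffel_map G u x z"] g_christoffel_map[OF assms(3), of x y z]
      g_christoffel_map[OF assms(3), of x z y] dder_G_commute[OF assms(3), of x y z]
      dder_G_commute[OF assms(3), of y x z] dder_G_commute[OF assms(3), of z x y]
    by simp
  from this[of "X u" "Y u" "Z u"] show ?thesis
    using assms
    by (subst dder_bform) (auto simp: smooth_on_differentiable[OF smooth_G] smooth_on_differentiable
        nabla_christoffel_map bform_simps)
qed

lemma nabla_cong:
  assumes "u \<in> U" "\<And>y. y \<in> U \<Longrightarrow> Y y = Z y" "X u = X' u"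
  shows "nabla G X Y u = nabla G X' Z u"
  using dder_cong[OF open_U assms(1,2)] assms by (simp add: nabla_christoffel_map)

lemma nabla_add:
  assumes "u \<in> U" "smooth_on U Y" "smooth_on U Z"
  shows "nabla G X (\<lambda>y. Y y + Z y) u = nabla G X Y u + nabla G X Z u"
  using assms by (simp add: nabla_christoffel_map dder_add smooth_on_differentiable christoffel_map_simps)

lemma nabla_scaleR:
  assumes "u \<in> U" "smooth_on U f" "smooth_on U Y"
  shows "nabla G X (\<lambda>y. f y *\<^sub>R Y y) u = f u *\<^sub>R nabla G X Y u + dder f u (X u) *\<^sub>R Y u"
  using assms by (simp add: nabla_christoffel_map dder_bilinear[OF bounded_bilinear_scaleR]
    smooth_on_differentiable christoffel_map_simps scaleR_add_right)

lemma nabla_direction_linear: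
  assumes "u \<in> U" "smooth_on U Y"
  shows "linear (\<lambda>z. nabla G (\<lambda>_. z) Y u)"
  using linear_dder[OF assms(2,1)]
  by (intro linearI) (simp_all add: nabla_christoffel_map christoffel_map_simps linear_add linear_scale scaleR_add_right)

lemma christoffel_map_axis_sum:
  "christoffel_map G u v w = (\<Sum>i\<in>UNIV. \<Sum>j\<in>UNIV. (v $ i * w $ j) *\<^sub>R christoffel_map G u (axis i 1) (axis j 1))"
proof -
  have "christoffel_map G u (axis i 1) (axis j 1) $ k = christoffel G u k i j" for i j k
  proof -
    have "(\<Sum>j'\<in>UNIV. christoffel G u k i' j' * axis i 1 $ i' * axis j 1 $ j') = christoffel G u k i' j * axis i 1 $ i'" for i'
      by (simp add: axis_def if_distrib[of "\<lambda>x. _ * x"] cong: if_cong)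
    then show ?thesis
      by (simp add: christoffel_map_def axis_def if_distrib[of "\<lambda>x. _ * x"] cong: if_cong)
  qed
  then show ?thesis by (simp add: vec_eq_iff christoffel_map_def sum_component mult_ac)
qed

lemma dder_christoffel_map:
  assumes "smooth_on U Y" "smooth_on U Z" "u \<in> U"
  shows "dder (\<lambda>p. christoffel_map G p (Y p) (Z p)) u x =
    dder (\<lambda>p. christoffel_map G p (Y u) (Z u)) u x
     + christoffel_map G u (dder Y u x) (Z u) + christoffel_map G u (Y u) (dder Z u x)"
proof -
  define E where "E i j p = christoffel_map G p (axis i 1) (axis j 1)" for i j p
  have E: "(E i j has_derivative dder (E i j) u) (at u)" for i j
    unfolding E_def by (intro smooth_on_has_derivative[OF _ assms(3)] smooth_christoffel_map smooth_on_const)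
  have Y: "((\<lambda>y. Y y $ i) has_derivative (\<lambda>w. dder Y u w $ i)) (at u)" for i
    using bounded_linear.has_derivative[OF bounded_linear_vec_nth smooth_on_has_derivative[OF assms(1,3)]] .
  have Z: "((\<lambda>y. Z y $ i) has_derivative (\<lambda>w. dder Z u w $ i)) (at u)" for i
    using bounded_linear.has_derivative[OF bounded_linear_vec_nth smooth_on_has_derivative[OF assms(2,3)]] .
  have 1: "((\<lambda>p. \<Sum>i\<in>UNIV. \<Sum>j\<in>UNIV. (Y p $ i * Z p $ j) *\<^sub>R E i j p) has_derivative
      (\<lambda>x. \<Sum>i\<in>UNIV. \<Sum>j\<in>UNIV. (Y u $ i * Z u $ j) *\<^sub>R dder (E i j) u x +
        (Y u $ i * dder Z u x $ j + dder Y u x $ i * Z u $ j) *\<^sub>R E i j u)) (at u)"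
  proof (rule has_derivative_sum, rule has_derivative_sum)
    fix i j
    show "((\<lambda>p. (Y p $ i * Z p $ j) *\<^sub>R E i j p) has_derivative (\<lambda>x. (Y u $ i * Z u $ j) *\<^sub>R dder (E i j) u x +
        (Y u $ i * dder Z u x $ j + dder Y u x $ i * Z u $ j) *\<^sub>R E i j u)) (at u)"
      using has_derivative_scaleR[OF has_derivative_mult[OF Y Z] E] .
  qed
  have 2: "((\<lambda>p. \<Sum>i\<in>UNIV. \<Sum>j\<in>UNIV. (Y u $ i * Z u $ j) *\<^sub>R E i j p) has_derivative
      (\<lambda>x. \<Sum>i\<in>UNIV. \<Sum>j\<in>UNIV. (Y u $ i * Z u $ j) *\<^sub>R dder (E i j) u x)) (at u)"
  proof (rule has_derivative_sum, rule has_derivative_sum)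
    fix i j
    show "((\<lambda>p. (Y u $ i * Z u $ j) *\<^sub>R E i j p) has_derivative
        (\<lambda>x. (Y u $ i * Z u $ j) *\<^sub>R dder (E i j) u x)) (at u)"
      using bounded_linear.has_derivative[OF bounded_linear_scaleR_right E] .
  qed
  have "dder (\<lambda>p. christoffel_map G p (Y p) (Z p)) u x = (\<Sum>i\<in>UNIV. \<Sum>j\<in>UNIV.
      (Y u $ i * Z u $ j) *\<^sub>R dder (E i j) u x +
        (Y u $ i * dder Z u x $ j + dder Y u x $ i * Z u $ j) *\<^sub>R E i j u)"
    unfolding christoffel_map_axis_sum[of _ "Y _"] E_def[symmetric] by (rule dder_eqI[OF 1])
  also have "\<dots> = (\<Sum>i\<in>UNIV. \<Sum>j\<in>UNIV. (Y u $ i * Z u $ j) *\<^sub>R dder (E i j) u x)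
      + ((\<Sum>i\<in>UNIV. \<Sum>j\<in>UNIV. (dder Y u x $ i * Z u $ j) *\<^sub>R E i j u)
      + (\<Sum>i\<in>UNIV. \<Sum>j\<in>UNIV. (Y u $ i * dder Z u x $ j) *\<^sub>R E i j u))"
    by (simp add: sum.distrib[symmetric] scaleR_add_left add_ac)
  also have "(\<Sum>i\<in>UNIV. \<Sum>j\<in>UNIV. (Y u $ i * Z u $ j) *\<^sub>R dder (E i j) u x)
      = dder (\<lambda>p. christoffel_map G p (Y u) (Z u)) u x"
    unfolding christoffel_map_axis_sum[of _ "Y _"] E_def[symmetric] by (rule dder_eqI[OF 2, symmetric])
  finally show ?thesis
    unfolding E_def christoffel_map_axis_sum[symmetric] by (simp add: add_ac)
qed

text \<open>All derivatives of the three vector fields cancel, so that the value of the curvature at a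
  point depends only on their values there.\<close>

lemma curvature_christoffel_map:
  assumes "smooth_on U X" "smooth_on U Y" "smooth_on U Z" "u \<in> U"
  shows "curvature G X Y Z u =
    dder (\<lambda>p. christoffel_map G p (Y u) (Z u)) u (X u) - dder (\<lambda>p. christoffel_map G p (X u) (Z u)) u (Y u)
    + christoffel_map G u (X u) (christoffel_map G u (Y u) (Z u))
    - christoffel_map G u (Y u) (christoffel_map G u (X u) (Z u))"
proof -
  have second: "nabla G X (nabla G Y Z) u =
     dder (\<lambda>y. dder Z y (Y u)) u (X u) + dder Z u (dder Y u (X u))
     + (dder (\<lambda>p. christoffel_map G p (Y u) (Z u)) u (X u)
       + christoffel_map G u (dder Y u (X u)) (Z u) + christoffel_map G u (Y u) (dder Z u (X u)))
     + christoffel_map G u (X u) (dder Z u (Y u))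
     + christoffel_map G u (X u) (christoffel_map G u (Y u) (Z u))"
    if "smooth_on U X" "smooth_on U Y" for X Y
  proof -
    have eq: "nabla G Y Z = (\<lambda>y. dder Z y (Y y) + christoffel_map G y (Y y) (Z y))"
      by (simp add: fun_eq_iff nabla_christoffel_map)
    have "dder (nabla G Y Z) u (X u) = dder (\<lambda>y. dder Z y (Y y)) u (X u)
        + dder (\<lambda>y. christoffel_map G y (Y y) (Z y)) u (X u)"
      unfolding eq
      by (intro dder_add smooth_on_differentiable[OF _ assms(4)] smooth_on_dder smooth_christoffel_map
          open_U that assms)
    then show ?thesis
      unfolding nabla_christoffel_map[of G X]
        dder_dder[OF open_U assms(3) that(2) assms(4)] dder_christoffel_map[OF that(2) assms(3,4)]
      by (simp add: nabla_christoffel_map christoffel_map_simps algebra_simps)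
  qed
  have "dder (\<lambda>y. dder Z y (Y u)) u (X u) = dder (\<lambda>y. dder Z y (X u)) u (Y u)"
    by (rule dder_dder_commute[OF open_U assms(3,4)])
  moreover have "nabla G (lie_bracket X Y) Z u = dder Z u (dder Y u (X u)) - dder Z u (dder X u (Y u))
    + christoffel_map G u (dder Y u (X u)) (Z u) - christoffel_map G u (dder X u (Y u)) (Z u)"
    using linear_dder[OF assms(3,4)]
    by (simp add: nabla_christoffel_map lie_bracket_def linear_diff christoffel_map_diff)
  ultimately show ?thesis
    unfolding curvature_def second[OF assms(1,2)] second[OF assms(2,1)] by simp
qed

lemma curvature_tensorial:
  assumes "smooth_on U X" "smooth_on U Y" "smooth_on U Z" "u \<in> U"
  shows "curvature G (\<lambda>_. X u) (\<lambda>_. Y u) (\<lambda>_. Z u) u = curvature G X Y Z u"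
  using assms by (simp add: curvature_christoffel_map smooth_on_const)

lemma linear_curvature:
  assumes "u \<in> U"
  shows "linear (\<lambda>x. curvature G (\<lambda>_. x) (\<lambda>_. v) (\<lambda>_. w) u)"
proof -
  have smooth: "smooth_on U (\<lambda>p. christoffel_map G p x w)" for x w
    by (intro smooth_christoffel_map smooth_on_const)
  have lin: "linear (dder (\<lambda>p. christoffel_map G p x w) u)" for x w
    using linear_dder[OF smooth assms] .
  have add: "dder (\<lambda>p. christoffel_map G p x w + christoffel_map G p x' w) u v =
    dder (\<lambda>p. christoffel_map G p x w) u v + dder (\<lambda>p. christoffel_map G p x' w) u v" for x x'
    by (intro dder_add smooth_on_differentiable[OF smooth assms])
  have scale: "dder (\<lambda>p. c *\<^sub>R christoffel_map G p x w) u v = c *\<^sub>R dder (\<lambda>p. christoffel_map G p x w) u v" for c x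
    by (intro dder_linear_compose bounded_linear_scaleR_right smooth_on_differentiable[OF smooth assms])
  show ?thesis
    unfolding curvature_christoffel_map[OF smooth_on_const smooth_on_const smooth_on_const assms]
    by (intro linearI) (simp_all add: linear_add[OF lin] linear_scale[OF lin] christoffel_map_simps add scale algebra_simps)
qed

end

lemma dder_lie_bracket:
  fixes f :: "real^'n \<Rightarrow> real"
  assumes "open U" "smooth_on U f" "smooth_on U X" "smooth_on U Y" "u \<in> U"
  shows "dder f u (lie_bracket X Y u) =
    dder (\<lambda>y. dder f y (Y y)) u (X u) - dder (\<lambda>y. dder f y (X y)) u (Y u)"
  using linear_dder[OF assms(2,5)] dder_dder_commute_real[OF assms(1,2,5), of "X u" "Y u"]
  by (simp add: dder_dder[OF assms(1,2,4,5)] dder_dder[OF assms(1,2,3,5)] lie_bracket_def linear_diff)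

text \<open>The second derivatives of the three fields cancel by their symmetry, the products of first
  derivatives cancel identically.\<close>

lemma lie_bracket_jacobi:
  fixes X Y Z :: "real^'n \<Rightarrow> real^'n"
  assumes "open U" "smooth_on U X" "smooth_on U Y" "smooth_on U Z" "u \<in> U"
  shows "lie_bracket X (lie_bracket Y Z) u =
    lie_bracket (lie_bracket X Y) Z u + lie_bracket Y (lie_bracket X Z) u"
proof -
  have br: "lie_bracket V W y = dder W y (V y) - dder V y (W y)" for V W :: "real^'n \<Rightarrow> real^'n" and y
    by (simp add: lie_bracket_def)
  have d: "dder (lie_bracket V W) u a = dder (\<lambda>y. dder W y (V u)) u a + dder W u (dder V u a)
      - (dder (\<lambda>y. dder V y (W u)) u a + dder V u (dder W u a))"
    if "smooth_on U V" "smooth_on U W" for V W a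
    unfolding br[abs_def]
    using assms(1,5) that
    by (subst dder_diff) (auto simp: dder_dder[of U] intro!: smooth_on_differentiable[of U] smooth_on_dder)
  have c: "dder (\<lambda>y. dder V y a) u b = dder (\<lambda>y. dder V y b) u a" if "smooth_on U V" for V :: "real^'n \<Rightarrow> real^'n" and a b
    by (rule dder_dder_commute[OF assms(1) that assms(5)])
  note lin = linear_diff[OF linear_dder[OF assms(2,5)]] linear_diff[OF linear_dder[OF assms(3,5)]]
    linear_diff[OF linear_dder[OF assms(4,5)]]
  show ?thesis
    unfolding br[of X "lie_bracket _ _"] br[of Y "lie_bracket _ _"] br[of "lie_bracket _ _" Z]
    unfolding d[OF assms(2,3)] d[OF assms(2,4)] d[OF assms(3,4)] br lin
    using c[OF assms(2), of "Y u" "Z u"] c[OF assms(3), of "X u" "Z u"] c[OF assms(4), of "X u" "Y u"]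
    by (simp add: algebra_simps)
qed

section \<open>Almost contact metric structures in a chart\<close>

locale acm_chart = metric_chart U G
  for U :: "(real^3) set" and G :: "real^3 \<Rightarrow> real^3^3" +
  fixes P :: "real^3 \<Rightarrow> real^3^3" and xi eta :: "real^3 \<Rightarrow> real^3"
  assumes smooth_P: "smooth_on U P"
    and smooth_xi: "smooth_on U xi"
    and smooth_eta: "smooth_on U eta"
    and eta_g: "u \<in> U \<Longrightarrow> eta u \<bullet> v = bform (G u) (xi u) v"
    and phi_phi: "u \<in> U \<Longrightarrow> P u *v (P u *v v) = - v + (eta u \<bullet> v) *\<^sub>R xi u"
    and eta_xi: "u \<in> U \<Longrightarrow> eta u \<bullet> xi u = 1"
    and phi_xi: "u \<in> U \<Longrightarrow> P u *v xi u = 0"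
    and g_phi_phi: "u \<in> U \<Longrightarrow> bform (G u) (P u *v v) (P u *v w) =
      bform (G u) v w - (eta u \<bullet> v) * (eta u \<bullet> w)"
begin

lemma phi_simps:
  "P u *v (v + w) = P u *v v + P u *v w"
  "P u *v (v - w) = P u *v v - P u *v w"
  "P u *v (- v) = - (P u *v v)"
  "P u *v (c *\<^sub>R v) = c *\<^sub>R (P u *v v)"
  "P u *v 0 = 0"
  by (simp_all add: matrix_vector_right_distrib matrix_vector_mult_diff_distrib
      matrix_vector_mult_scaleR linear_neg[OF matrix_vector_mul_linear])

lemma g_xi_xi: "u \<in> U \<Longrightarrow> bform (G u) (xi u) (xi u) = 1"
  using eta_g eta_xi by metis

lemma eta_phi: "u \<in> U \<Longrightarrow> eta u \<bullet> (P u *v v) = 0"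
proof -
  assume u: "u \<in> U"
  have "P u *v (P u *v (P u *v v)) = - (P u *v v)"
    by (simp add: phi_phi[OF u, of v] phi_simps phi_xi[OF u])
  then have "(eta u \<bullet> (P u *v v)) *\<^sub>R xi u = 0" using phi_phi[OF u, of "P u *v v"] by simp
  then have "eta u \<bullet> (P u *v v) * (eta u \<bullet> xi u) = 0" by (metis inner_scaleR_right inner_zero_right)
  then show ?thesis by (simp add: eta_xi[OF u])
qed

lemma g_xi_phi: "u \<in> U \<Longrightarrow> bform (G u) (xi u) (P u *v v) = 0"
  using eta_phi eta_g by metis

lemma phi_skew:
  assumes u: "u \<in> U"
  shows "bform (G u) (P u *v v) w = - bform (G u) v (P u *v w)"
proof -
  have "bform (G u) (P u *v v) (P u *v (P u *v w)) = bform (G u) v (P u *v w)"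
    using g_phi_phi[OF u, of v "P u *v w"] by (simp add: eta_phi[OF u])
  moreover have "bform (G u) (P u *v v) (xi u) = 0"
    using g_xi_phi[OF u, of v] g_commute[OF u, of "xi u" "P u *v v"] by simp
  ultimately show ?thesis by (simp add: phi_phi[OF u, of w] bform_simps)
qed

lemma g_phi_self: "u \<in> U \<Longrightarrow> bform (G u) (P u *v v) v = 0"
  using phi_skew[of u v v] g_commute[of u v "P u *v v"] by simp

lemma phi_phi_horizontal: "u \<in> U \<Longrightarrow> eta u \<bullet> v = 0 \<Longrightarrow> P u *v (P u *v v) = - v"
  by (simp add: phi_phi)

text \<open>Three vectors that are non-zero and pairwise orthogonal span the tangent space, because it
  has dimension three.\<close>

lemma frame_expansion:
  assumes u: "u \<in> U" and x: "eta u \<bullet> x = 0" "x \<noteq> 0"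
  shows "z = (eta u \<bullet> z) *\<^sub>R xi u + (bform (G u) z x / bform (G u) x x) *\<^sub>R x
    + (bform (G u) z (P u *v x) / bform (G u) x x) *\<^sub>R (P u *v x)"
proof -
  let ?g = "bform (G u)" and ?y = "P u *v x"
  define T where "T a = (a $ 1) *\<^sub>R xi u + (a $ 2) *\<^sub>R x + (a $ 3) *\<^sub>R ?y" for a :: "real^3"
  have N: "?g x x > 0" using pos_G[OF u x(2)] .
  have prods: "?g (xi u) (xi u) = 1" "?g (xi u) x = 0" "?g x (xi u) = 0" "?g (xi u) ?y = 0" "?g ?y (xi u) = 0"
    "?g x ?y = 0" "?g ?y x = 0" "?g ?y ?y = ?g x x"
    using g_xi_xi[OF u] eta_g[OF u, of x] x g_commute[OF u, of x "xi u"] g_xi_phi[OF u, of x]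
      g_commute[OF u, of ?y "xi u"] g_phi_self[OF u, of x] g_commute[OF u, of x ?y] g_phi_phi[OF u, of x x]
    by simp_all
  have T: "?g (T a) (xi u) = a $ 1" "?g (T a) x = a $ 2 * ?g x x" "?g (T a) ?y = a $ 3 * ?g x x" for a
    by (simp_all add: T_def bform_simps prods)
  have lin: "linear T"
    by (rule linearI) (simp_all add: T_def algebra_simps)
  have "inj T"
    unfolding linear_injective_0[OF lin]
  proof (intro allI impI)
    fix a assume "T a = 0"
    then have "a $ 1 = 0" "a $ 2 = 0" "a $ 3 = 0" using T[of a] N by (simp_all add: bform_simps)
    then show "a = 0" by (simp add: vec_eq_iff forall_3)
  qed
  then obtain a where z: "z = T a"
    using linear_injective_imp_surjective[OF lin] by (metis surjD)
  have "eta u \<bullet> z = a $ 1" using T(1)[of a] eta_g[OF u, of z] g_commute[OF u, of z "xi u"] z by simp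
  moreover have "?g z x / ?g x x = a $ 2" "?g z ?y / ?g x x = a $ 3" using T z N by simp_all
  ultimately show ?thesis using z by (simp add: T_def)
qed

lemma trace_in_frame:
  assumes u: "u \<in> U" and x: "eta u \<bullet> x = 0" "x \<noteq> 0" and L: "linear L"
  shows "(\<Sum>k\<in>UNIV. L (axis k 1) $ k) = bform (G u) (L (xi u)) (xi u)
    + (bform (G u) (L x) x + bform (G u) (L (P u *v x)) (P u *v x)) / bform (G u) x x"
proof -
  let ?g = "bform (G u)" and ?N = "bform (G u) x x" and ?y = "P u *v x"
  have "L (axis k 1) $ k = eta u $ k * L (xi u) $ k
    + L x $ k * ?g x (axis k 1) / ?N + L ?y $ k * ?g ?y (axis k 1) / ?N" for k
  proof -
    have "L (axis k 1) = (eta u \<bullet> axis k 1) *\<^sub>R L (xi u) + (?g (axis k 1) x / ?N) *\<^sub>R L x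
       + (?g (axis k 1) ?y / ?N) *\<^sub>R L ?y"
      by (subst frame_expansion[OF u x, of "axis k 1"])
        (simp add: linear_add[OF L] linear_cmul[OF L])
    then show ?thesis
      using g_commute[OF u, of x "axis k 1"] g_commute[OF u, of ?y "axis k 1"]
      by (simp add: inner_axis mult_ac)
  qed
  then have "(\<Sum>k\<in>UNIV. L (axis k 1) $ k) = (\<Sum>k\<in>UNIV. eta u $ k * L (xi u) $ k)
    + (\<Sum>k\<in>UNIV. L x $ k * ?g x (axis k 1)) / ?N + (\<Sum>k\<in>UNIV. L ?y $ k * ?g ?y (axis k 1)) / ?N"
    by (simp add: sum.distrib sum_divide_distrib)
  also have "(\<Sum>k\<in>UNIV. eta u $ k * L (xi u) $ k) = ?g (L (xi u)) (xi u)"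
    using eta_g[OF u, of "L (xi u)"] g_commute[OF u, of "xi u" "L (xi u)"] by (simp add: inner_vec_def)
  finally show ?thesis
    using g_commute[OF u, of x "L x"] g_commute[OF u, of ?y "L ?y"]
    by (simp add: bform_expand_right add_divide_distrib)
qed

lemma phi_nonzero:
  assumes u: "u \<in> U"
  obtains v where "P u *v v \<noteq> 0"
proof -
  have False if z: "\<And>v. P u *v v = 0"
  proof -
    have "v = (eta u \<bullet> v) *\<^sub>R xi u" for v using phi_phi[OF u, of v] z by (simp add: phi_simps)
    then have e: "axis i 1 $ j = eta u $ i * xi u $ j" for i j
      by (metis inner_axis inner_real_def mult.right_neutral vector_scaleR_component real_scaleR_def)
    show False using e[of 1 1] e[of 1 2] e[of 2 2] e[of 2 1] by (auto simp: axis_def)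
  qed
  then show ?thesis using that by blast
qed

abbreviation Dxi :: "real^3 \<Rightarrow> real^3 \<Rightarrow> real^3" where
  "Dxi u v \<equiv> nabla G (\<lambda>_. v) xi u"

lemma nabla_xi: "nabla G X xi u = Dxi u (X u)"
  by (simp add: nabla_christoffel_map)

lemma linear_Dxi: "u \<in> U \<Longrightarrow> linear (Dxi u)"
  by (rule nabla_direction_linear[OF _ smooth_xi])

lemma smooth_Dxi: "smooth_on U X \<Longrightarrow> smooth_on U (\<lambda>u. Dxi u (X u))"
  using smooth_nabla[OF _ smooth_xi, of X] by (simp add: nabla_xi[abs_def, of X])

lemma smooth_phi: "smooth_on U X \<Longrightarrow> smooth_on U (\<lambda>u. P u *v X u)"
  by (rule smooth_on_mv[OF open_U smooth_P])

lemma dder_zero_on: "u \<in> U \<Longrightarrow> (\<And>y. y \<in> U \<Longrightarrow> f y = c) \<Longrightarrow> dder f u v = 0"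
  using dder_cong_vec[OF open_U, of u f "\<lambda>_. c" v] by simp

lemma g_Dxi_xi: "u \<in> U \<Longrightarrow> bform (G u) (Dxi u v) (xi u) = 0"
proof -
  assume u: "u \<in> U"
  have "dder (\<lambda>y. bform (G y) (xi y) (xi y)) u v = 0"
    by (rule dder_zero_on[OF u]) (rule g_xi_xi)
  then show ?thesis
    using metric_compatible[OF smooth_xi smooth_xi u, of "\<lambda>_. v"] g_commute[OF u, of "xi u" "Dxi u v"] by simp
qed

lemma eta_Dxi: "u \<in> U \<Longrightarrow> eta u \<bullet> Dxi u v = 0"
  using g_Dxi_xi[of u v] eta_g[of u "Dxi u v"] g_commute[of u "xi u" "Dxi u v"] by simp

lemma dder_eta:
  assumes "u \<in> U" "smooth_on U Y"
  shows "dder (\<lambda>y. eta y \<bullet> Y y) u (X u) = bform (G u) (Dxi u (X u)) (Y u) + eta u \<bullet> nabla G X Y u"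
proof -
  have "dder (\<lambda>y. eta y \<bullet> Y y) u (X u) = dder (\<lambda>y. bform (G y) (xi y) (Y y)) u (X u)"
    by (rule dder_cong_vec[OF open_U assms(1)]) (rule eta_g)
  also have "\<dots> = bform (G u) (Dxi u (X u)) (Y u) + eta u \<bullet> nabla G X Y u"
    using metric_compatible[OF smooth_xi assms(2,1), of X] eta_g[OF assms(1), of "nabla G X Y u"]
    by (simp add: nabla_xi[of X])
  finally show ?thesis .
qed

text \<open>The covariant derivative of the structure endomorphism in the direction \<open>v\<close>, as an
  endomorphism of the tangent space.\<close>

definition Dphi :: "real^3 \<Rightarrow> real^3 \<Rightarrow> real^3 \<Rightarrow> real^3" where
  "Dphi u v w = dder P u v *v w + christoffel_map G u v (P u *v w) - P u *v christoffel_map G u v w"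

lemma nabla_phi:
  assumes "u \<in> U" "smooth_on U Y"
  shows "nabla G X (\<lambda>y. P y *v Y y) u = Dphi u (X u) (Y u) + P u *v nabla G X Y u"
  using dder_mv[OF smooth_on_differentiable[OF smooth_P assms(1)] smooth_on_differentiable[OF assms(2,1)]]
  by (simp add: nabla_christoffel_map Dphi_def phi_simps)

lemma nabla_endo_Dphi:
  assumes "u \<in> U" "smooth_on U Y"
  shows "nabla_endo G P X Y u = Dphi u (X u) (Y u)"
  by (simp add: nabla_endo_def nabla_phi[OF assms])

lemma Dphi_linear:
  "Dphi u v (w + w') = Dphi u v w + Dphi u v w'"
  "Dphi u v (c *\<^sub>R w) = c *\<^sub>R Dphi u v w"
  by (simp_all add: Dphi_def phi_simps christoffel_map_simps matrix_vector_right_distrib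
      matrix_vector_mult_scaleR algebra_simps)

lemma Dphi_skew:
  assumes u: "u \<in> U"
  shows "bform (G u) (Dphi u v w) z = - bform (G u) w (Dphi u v z)"
proof -
  let ?g = "bform (G u)" and ?n = "\<lambda>Y. nabla G (\<lambda>_. v) Y u"
  have sm: "smooth_on U (\<lambda>y. P y *v a)" for a by (intro smooth_phi smooth_on_const)
  have "dder (\<lambda>y. bform (G y) (P y *v w) z) u v = dder (\<lambda>y. - bform (G y) w (P y *v z)) u v"
    by (rule dder_cong_vec[OF open_U u]) (rule phi_skew)
  also have "\<dots> = - dder (\<lambda>y. bform (G y) w (P y *v z)) u v"
    by (intro dder_minus smooth_on_differentiable[OF _ u] smooth_on_bform open_U smooth_G smooth_on_const sm)
  finally have "?g (Dphi u v w + P u *v ?n (\<lambda>_. w)) z + ?g (P u *v w) (?n (\<lambda>_. z)) =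
    - (?g (?n (\<lambda>_. w)) (P u *v z) + ?g w (Dphi u v z + P u *v ?n (\<lambda>_. z)))"
    using metric_compatible[OF sm[of w] smooth_on_const[of _ z] u, of "\<lambda>_. v"]
      metric_compatible[OF smooth_on_const[of _ w] sm[of z] u, of "\<lambda>_. v"]
    by (simp add: nabla_phi[OF u smooth_on_const])
  then show ?thesis
    using phi_skew[OF u, of "?n (\<lambda>_. w)" z] phi_skew[OF u, of w "?n (\<lambda>_. z)"] by (simp add: bform_simps)
qed

lemma Dphi_xi:
  assumes u: "u \<in> U"
  shows "Dphi u v (xi u) = - (P u *v Dxi u v)"
proof -
  have "nabla G (\<lambda>_. v) (\<lambda>y. P y *v xi y) u = nabla G (\<lambda>_. v) (\<lambda>y. 0) u"
    by (rule nabla_cong[OF u]) (simp_all add: phi_xi)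
  then show ?thesis
    using nabla_phi[OF u smooth_xi, of "\<lambda>_. v"] christoffel_map_simps(4)[of G u v 0]
    by (simp add: nabla_christoffel_map[of G _ "\<lambda>_. 0"] add_eq_0_iff)
qed

text \<open>The covariant derivative of \<open>phi\<^sup>2 = - I + eta \<otimes> xi\<close>.\<close>

lemma Dphi_phi:
  assumes u: "u \<in> U"
  shows "Dphi u v (P u *v w) + P u *v Dphi u v w =
    bform (G u) (Dxi u v) w *\<^sub>R xi u + (eta u \<bullet> w) *\<^sub>R Dxi u v"
proof -
  let ?W = "\<lambda>_. w" and ?V = "\<lambda>_. v"
  have sw: "smooth_on U ?W" "smooth_on U (\<lambda>y. eta y \<bullet> w)" "smooth_on U (\<lambda>y. (eta y \<bullet> w) *\<^sub>R xi y)"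
    "smooth_on U (\<lambda>y. (-1) *\<^sub>R w)"
    by (intro smooth_on_intros open_U smooth_eta smooth_xi)+
  have "nabla G ?V (\<lambda>y. P y *v (P y *v w)) u = nabla G ?V (\<lambda>y. (-1) *\<^sub>R w + (eta y \<bullet> w) *\<^sub>R xi y) u"
    by (rule nabla_cong[OF u]) (simp_all add: phi_phi)
  also have "\<dots> = - nabla G ?V ?W u + ((eta u \<bullet> w) *\<^sub>R Dxi u v + dder (\<lambda>y. eta y \<bullet> w) u v *\<^sub>R xi u)"
    unfolding nabla_add[OF u sw(4,3)] nabla_scaleR[OF u sw(2) smooth_xi] nabla_scaleR[OF u smooth_on_const sw(1)]
    by simp
  also have "nabla G ?V (\<lambda>y. P y *v (P y *v w)) u =
    Dphi u v (P u *v w) + P u *v (Dphi u v w + P u *v nabla G ?V ?W u)"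
    by (simp add: nabla_phi[OF u smooth_phi[OF sw(1)]] nabla_phi[OF u sw(1)])
  finally show ?thesis
    using dder_eta[OF u sw(1), of ?V] by (simp add: phi_simps phi_phi[OF u, of "nabla G ?V ?W u"] algebra_simps)
qed

text \<open>In dimension three the skew endomorphism \<open>Dphi u v\<close> is determined by its value at \<open>xi\<close>: on
  the horizontal plane a skew endomorphism is a multiple of \<open>P u\<close>, and \<open>Dphi_phi\<close> shows that
  this multiple vanishes.\<close>

lemma Dphi_formula:
  assumes u: "u \<in> U"
  shows "Dphi u v w = bform (G u) (P u *v Dxi u v) w *\<^sub>R xi u - (eta u \<bullet> w) *\<^sub>R (P u *v Dxi u v)"
proof -
  let ?g = "bform (G u)"
  define h where "h = w - (eta u \<bullet> w) *\<^sub>R xi u"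
  have h: "eta u \<bullet> h = 0" by (simp add: h_def inner_diff_right eta_xi[OF u])
  have w: "w = h + (eta u \<bullet> w) *\<^sub>R xi u" by (simp add: h_def)
  have "Dphi u v h = ?g (P u *v Dxi u v) h *\<^sub>R xi u"
  proof (cases "h = 0")
    case True
    then show ?thesis using Dphi_linear(2)[of u v 0 0] by (simp add: bform_simps)
  next
    case False
    have "?g (Dphi u v h) h = 0"
      using Dphi_skew[OF u, of v h h] g_commute[OF u, of "Dphi u v h" h] by simp
    moreover have "?g (Dphi u v h) (P u *v h) = 0"
    proof -
      have "?g (Dphi u v (P u *v h) + P u *v Dphi u v h) h = 0"
        unfolding Dphi_phi[OF u] using h eta_g[OF u, of h] by (simp add: bform_simps)
      moreover have "?g (Dphi u v (P u *v h)) h = - ?g (Dphi u v h) (P u *v h)"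
        using Dphi_skew[OF u, of v "P u *v h" h] g_commute[OF u, of "P u *v h" "Dphi u v h"] by simp
      ultimately show ?thesis
        using phi_skew[OF u, of "Dphi u v h" h] by (simp add: bform_simps)
    qed
    moreover have "eta u \<bullet> Dphi u v h = ?g (P u *v Dxi u v) h"
      using eta_g[OF u, of "Dphi u v h"] Dphi_skew[OF u, of v "xi u" h] Dphi_xi[OF u, of v]
      by (simp add: bform_simps)
    ultimately show ?thesis
      using frame_expansion[OF u h False, of "Dphi u v h"] by simp
  qed
  moreover have "Dphi u v w = Dphi u v h + (eta u \<bullet> w) *\<^sub>R Dphi u v (xi u)"
    using Dphi_linear(1)[of u v h "(eta u \<bullet> w) *\<^sub>R xi u"] w by (simp add: Dphi_linear(2))
  moreover have "?g (P u *v Dxi u v) (xi u) = 0"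
    using g_xi_phi[OF u, of "Dxi u v"] g_commute[OF u, of "xi u"] by simp
  moreover have "?g (P u *v Dxi u v) w = ?g (P u *v Dxi u v) h + (eta u \<bullet> w) * ?g (P u *v Dxi u v) (xi u)"
    by (subst w) (simp only: bform_simps)
  ultimately show ?thesis by (simp add: Dphi_xi[OF u])
qed

end

text \<open>The two coefficients of \<open>\<nabla>\<xi>\<close>, which is \<open>-\<alpha> \<phi> + \<beta> (I - \<eta> \<otimes> \<xi>)\<close> on a normal structure, read
  off as traces.\<close>

definition sasaki_coeff :: "(real^3 \<Rightarrow> real^3^3) \<Rightarrow> (real^3 \<Rightarrow> real^3^3) \<Rightarrow> (real^3 \<Rightarrow> real^3) \<Rightarrow> real^3 \<Rightarrow> real" where
  "sasaki_coeff G P xi u = (1/2) * (\<Sum>k\<in>UNIV. (P u *v nabla G (\<lambda>_. axis k 1) xi u) $ k)"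

definition kenmotsu_coeff :: "(real^3 \<Rightarrow> real^3^3) \<Rightarrow> (real^3 \<Rightarrow> real^3) \<Rightarrow> real^3 \<Rightarrow> real" where
  "kenmotsu_coeff G xi u = (1/2) * (\<Sum>k\<in>UNIV. nabla G (\<lambda>_. axis k 1) xi u $ k)"

locale normal_chart = acm_chart +
  assumes normal: "smooth_on U X \<Longrightarrow> smooth_on U Y \<Longrightarrow> u \<in> U \<Longrightarrow>
    nijenhuis P X Y u + (2 * ext_deriv eta X Y u) *\<^sub>R xi u = 0"
begin

abbreviation "al \<equiv> sasaki_coeff G P xi"
abbreviation "be \<equiv> kenmotsu_coeff G xi"

lemma smooth_al: "smooth_on U al"
  unfolding sasaki_coeff_def[abs_def]
  by (intro smooth_on_mult smooth_on_sum smooth_on_nth smooth_on_const smooth_phi smooth_Dxi open_U)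

lemma smooth_be: "smooth_on U be"
  unfolding kenmotsu_coeff_def[abs_def]
  by (intro smooth_on_mult smooth_on_sum smooth_on_nth smooth_on_const smooth_Dxi open_U)

lemma lie_bracket_cong:
  assumes "u \<in> U" "\<And>y. y \<in> U \<Longrightarrow> X y = X' y" "\<And>y. y \<in> U \<Longrightarrow> Y y = Y' y"
  shows "lie_bracket X Y u = lie_bracket X' Y' u"
  using dder_cong[OF open_U assms(1,2)] dder_cong[OF open_U assms(1,3)] assms by (simp add: lie_bracket_def)

text \<open>Normality is evaluated on \<open>xi\<close> and \<open>Y\<close>.  As \<open>phi xi = 0\<close>, its component along \<open>xi\<close> says that the flow
  of \<open>xi\<close> preserves \<open>eta\<close>, and its horizontal part that it preserves \<open>phi\<close>.\<close>

lemma normal_xi: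
  assumes u: "u \<in> U" and Y: "smooth_on U Y"
  shows "eta u \<bullet> lie_bracket xi Y u = dder (\<lambda>y. eta y \<bullet> Y y) u (xi u)"
    and "lie_bracket xi (\<lambda>y. P y *v Y y) u = P u *v lie_bracket xi Y u"
proof -
  have zero: "lie_bracket (\<lambda>y. P y *v xi y) Z u = 0" if "smooth_on U Z" for Z
    using lie_bracket_cong[OF u, of "\<lambda>y. P y *v xi y" "\<lambda>_. 0" Z Z] linear_0[OF linear_dder[OF that u]]
    by (simp add: phi_xi lie_bracket_def)
  have main: "P u *v (P u *v lie_bracket xi Y u - lie_bracket xi (\<lambda>y. P y *v Y y) u)
      + (2 * ext_deriv eta xi Y u) *\<^sub>R xi u = 0" if Y: "smooth_on U Y" for Y
    using normal[OF smooth_xi Y u] zero[OF Y] zero[OF smooth_phi[OF Y]]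
    by (simp add: nijenhuis_def phi_simps)
  have e: "ext_deriv eta xi Y u = 0" if Y: "smooth_on U Y" for Y
    using arg_cong[OF main[OF Y], of "\<lambda>z. eta u \<bullet> z"] by (simp add: inner_add_right eta_phi[OF u] eta_xi[OF u])
  have 1: "eta u \<bullet> lie_bracket xi Y u = dder (\<lambda>y. eta y \<bullet> Y y) u (xi u)" if Y: "smooth_on U Y" for Y
  proof -
    have "dder (\<lambda>y. eta y \<bullet> xi y) u (Y u) = 0" by (rule dder_zero_on[OF u]) (rule eta_xi)
    then show ?thesis using e[OF Y] by (simp add: ext_deriv_def)
  qed
  show "eta u \<bullet> lie_bracket xi Y u = dder (\<lambda>y. eta y \<bullet> Y y) u (xi u)" by (rule 1[OF Y])
  let ?d = "P u *v lie_bracket xi Y u - lie_bracket xi (\<lambda>y. P y *v Y y) u"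
  have "dder (\<lambda>y. eta y \<bullet> (P y *v Y y)) u (xi u) = 0" by (rule dder_zero_on[OF u]) (rule eta_phi)
  then have "eta u \<bullet> ?d = 0" using 1[OF smooth_phi[OF Y]] by (simp add: inner_diff_right eta_phi[OF u])
  moreover have "P u *v ?d = 0" using main[OF Y] e[OF Y] by simp
  ultimately have "?d = 0" using phi_phi[OF u, of ?d] phi_simps(5)[of u] by simp
  then show "lie_bracket xi (\<lambda>y. P y *v Y y) u = P u *v lie_bracket xi Y u" by simp
qed

lemma Dxi_along_xi:
  assumes u: "u \<in> U"
  shows "Dxi u (xi u) = 0"
proof (rule g_ext[OF u])
  fix z
  have "lie_bracket xi (\<lambda>_. z) u = nabla G xi (\<lambda>_. z) u - Dxi u z"
    using torsion_free[OF u, of xi "\<lambda>_. z"] by simp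
  then show "bform (G u) (Dxi u (xi u)) z = bform (G u) 0 z"
    using normal_xi(1)[OF u smooth_on_const[of _ z]] dder_eta[OF u smooth_on_const[of _ z], of xi]
    by (simp add: inner_diff_right eta_Dxi[OF u] bform_simps)
qed

lemma Dxi_phi:
  assumes u: "u \<in> U"
  shows "Dxi u (P u *v v) = P u *v Dxi u v"
proof -
  have "nabla G xi (\<lambda>y. P y *v v) u = P u *v nabla G xi (\<lambda>_. v) u"
    using nabla_phi[OF u smooth_on_const[of _ v], of xi] Dphi_formula[OF u, of "xi u" v]
    by (simp add: Dxi_along_xi[OF u] phi_simps bform_simps)
  moreover have "nabla G xi (\<lambda>y. P y *v v) u - Dxi u (P u *v v) = P u *v (nabla G xi (\<lambda>_. v) u - Dxi u v)"
    using normal_xi(2)[OF u smooth_on_const[of _ v]] torsion_free[OF u, of xi "\<lambda>_. v"]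
      torsion_free[OF u, of xi "\<lambda>y. P y *v v"] nabla_xi[of "\<lambda>y. P y *v v" u] by simp
  ultimately show ?thesis by (simp add: phi_simps)
qed

text \<open>An endomorphism of the horizontal plane that commutes with the rotation \<open>P u\<close> is a complex
  number \<open>a + b i\<close>; the two traces evaluate to \<open>be u = a\<close> and \<open>al u = - b\<close>.\<close>

lemma Dxi_formula:
  assumes u: "u \<in> U"
  shows "Dxi u v = - al u *\<^sub>R (P u *v v) + be u *\<^sub>R (v - (eta u \<bullet> v) *\<^sub>R xi u)"
proof -
  let ?g = "bform (G u)"
  obtain V where V: "P u *v V \<noteq> 0" using phi_nonzero[OF u] .
  define x y where "x = P u *v V" and "y = P u *v x"
  have x: "eta u \<bullet> x = 0" "x \<noteq> 0" using V eta_phi[OF u] by (auto simp: x_def)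
  have N: "?g x x > 0" using pos_G[OF u x(2)] .
  have phi_y: "P u *v y = - x" using phi_phi_horizontal[OF u x(1)] by (simp add: y_def)
  have gs: "?g x y = 0" "?g y x = 0" "?g y y = ?g x x" "?g 0 (xi u) = 0"
    using g_phi_self[OF u, of x] g_commute[OF u, of x y] g_phi_phi[OF u, of x x] x
    by (simp_all add: y_def bform_simps)
  define a b where "a = ?g (Dxi u x) x / ?g x x" and "b = ?g (Dxi u x) y / ?g x x"
  have Dx: "Dxi u x = a *\<^sub>R x + b *\<^sub>R y"
    using frame_expansion[OF u x, of "Dxi u x"] by (simp add: eta_Dxi[OF u] a_def b_def y_def)
  have Dy: "Dxi u y = a *\<^sub>R y - b *\<^sub>R x"
    unfolding y_def Dxi_phi[OF u, of x] Dx by (simp add: phi_simps phi_y flip: y_def)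
  have lin: "linear (Dxi u)" by (rule linear_Dxi[OF u])
  have lin': "linear (\<lambda>v. P u *v Dxi u v)"
    using linear_compose[OF lin matrix_vector_mul_linear[of "P u"]] by (simp add: o_def)
  have be: "be u = a"
    unfolding kenmotsu_coeff_def trace_in_frame[OF u x lin] using N
    by (simp add: Dxi_along_xi[OF u] gs Dx Dy bform_simps flip: y_def)
  have al: "al u = - b"
    unfolding sasaki_coeff_def trace_in_frame[OF u x lin'] using N
    by (simp add: Dxi_along_xi[OF u] gs Dx Dy phi_simps phi_y bform_simps flip: y_def)
  obtain c d where v: "v = (eta u \<bullet> v) *\<^sub>R xi u + c *\<^sub>R x + d *\<^sub>R y"
    using frame_expansion[OF u x, of v] unfolding y_def by blast
  have "Dxi u v = c *\<^sub>R (a *\<^sub>R x + b *\<^sub>R y) + d *\<^sub>R (a *\<^sub>R y - b *\<^sub>R x)"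
    by (subst v) (simp add: linear_add[OF lin] linear_cmul[OF lin] Dxi_along_xi[OF u] Dx Dy)
  moreover have "P u *v v = c *\<^sub>R y - d *\<^sub>R x"
    by (subst v) (simp add: phi_simps phi_xi[OF u] phi_y flip: y_def)
  moreover have "v - (eta u \<bullet> v) *\<^sub>R xi u = c *\<^sub>R x + d *\<^sub>R y" using v by (simp add: algebra_simps)
  ultimately show ?thesis by (simp only: al be) (simp add: algebra_simps)
qed

lemma Dxi_horizontal:
  "u \<in> U \<Longrightarrow> eta u \<bullet> v = 0 \<Longrightarrow> Dxi u v = be u *\<^sub>R v + (- al u) *\<^sub>R (P u *v v)"
  by (simp add: Dxi_formula)

lemma nabla_endo_trans_sasakian:
  assumes u: "u \<in> U" and Y: "smooth_on U Y"
  shows "nabla_endo G P X Y u =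
    al u *\<^sub>R (bform (G u) (X u) (Y u) *\<^sub>R xi u - (eta u \<bullet> Y u) *\<^sub>R X u) +
    be u *\<^sub>R (bform (G u) (P u *v X u) (Y u) *\<^sub>R xi u - (eta u \<bullet> Y u) *\<^sub>R (P u *v X u))"
  unfolding nabla_endo_Dphi[OF u Y] Dphi_formula[OF u] Dxi_formula[OF u, of "X u"]
  by (simp add: phi_simps phi_phi[OF u] phi_xi[OF u] bform_simps eta_g[OF u, symmetric] algebra_simps)

lemma ext_deriv_at_eta:
  assumes u: "u \<in> U"
  shows "ext_deriv_at eta u v w = - al u * bform (G u) (P u *v v) w"
proof -
  have "lie_bracket (\<lambda>_. v) (\<lambda>_. w) u = 0" by (simp add: lie_bracket_def)
  then have "ext_deriv_at eta u v w = (1/2) * (bform (G u) (Dxi u v) w - bform (G u) (Dxi u w) v)"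
    using dder_eta[OF u smooth_on_const[of _ w], of "\<lambda>_. v"] dder_eta[OF u smooth_on_const[of _ v], of "\<lambda>_. w"]
      torsion_free[OF u, of "\<lambda>_. v" "\<lambda>_. w"]
    by (simp add: ext_deriv_at_def ext_deriv_def)
  then show ?thesis
    using phi_skew[OF u, of w v] g_commute[OF u, of w "P u *v v"] g_commute[OF u, of w v]
    by (simp add: Dxi_formula[OF u] bform_simps eta_g[OF u, symmetric] algebra_simps)
qed

text \<open>By \<open>ext_deriv_at_eta\<close> the two-form \<open>d eta\<close> is \<open>al\<close> times one that does not vanish on a
  horizontal pair \<open>x, phi x\<close>.\<close>

lemma rank_at_eq_1_iff:
  assumes u: "u \<in> U"
  shows "rank_at eta u = 1 \<longleftrightarrow> al u = 0"
proof
  assume "rank_at eta u = 1"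
  then have *: "ext_deriv_at eta u v w = 0" for v w by (auto simp: rank_at_def split: if_splits)
  obtain V where V: "P u *v V \<noteq> 0" using phi_nonzero[OF u] .
  show "al u = 0" using *[of V "P u *v V"] pos_G[OF u V] by (simp add: ext_deriv_at_eta[OF u])
qed (simp add: rank_at_def ext_deriv_at_eta[OF u])

lemma eta_lie_bracket:
  assumes u: "u \<in> U" and X: "smooth_on U X" "\<And>y. y \<in> U \<Longrightarrow> eta y \<bullet> X y = 0"
    and Y: "smooth_on U Y" "\<And>y. y \<in> U \<Longrightarrow> eta y \<bullet> Y y = 0"
  shows "eta u \<bullet> lie_bracket X Y u = 2 * al u * bform (G u) (P u *v X u) (Y u)"
proof -
  have "dder (\<lambda>y. eta y \<bullet> Y y) u (X u) = 0" "dder (\<lambda>y. eta y \<bullet> X y) u (Y u) = 0"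
    by (rule dder_zero_on[OF u]; fact)+
  then have "eta u \<bullet> lie_bracket X Y u = bform (G u) (Dxi u (Y u)) (X u) - bform (G u) (Dxi u (X u)) (Y u)"
    using dder_eta[OF u X(1), of Y] dder_eta[OF u Y(1), of X]
    by (simp add: torsion_free[OF u, symmetric] inner_diff_right)
  then show ?thesis
    using phi_skew[OF u, of "Y u" "X u"] g_commute[OF u, of "Y u" "P u *v X u"] g_commute[OF u, of "X u" "Y u"]
    by (simp add: Dxi_horizontal[OF u X(2)[OF u]] Dxi_horizontal[OF u Y(2)[OF u]] bform_simps algebra_simps)
qed

end

section \<open>The Ricci tensor and the derivatives of the coefficients\<close>

context normal_chart
begin

lemma horizontal_extension:
  assumes u: "u \<in> U" and z: "eta u \<bullet> z = 0"
  obtains X where "smooth_on U X" "\<And>y. y \<in> U \<Longrightarrow> eta y \<bullet> X y = 0" "X u = z"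
proof
  show "smooth_on U (\<lambda>y. P y *v (- (P u *v z)))" by (intro smooth_phi smooth_on_const)
  show "eta y \<bullet> (P y *v (- (P u *v z))) = 0" if "y \<in> U" for y by (rule eta_phi[OF that])
  show "P u *v (- (P u *v z)) = z" using phi_phi_horizontal[OF u z] by (simp add: phi_simps)
qed

text \<open>On the frame \<open>X\<close>, \<open>Y = phi X\<close> the map \<open>\<nabla>xi\<close> is \<open>X \<mapsto> be X - al Y\<close>, \<open>Y \<mapsto> be Y + al X\<close>.  In the
  component along \<open>Y\<close> the undifferentiated coefficients cancel, because \<open>X\<close> and \<open>Y\<close> are orthogonal and
  of equal length.\<close>

lemma curvature_horizontal_xi:
  assumes u: "u \<in> U" and X: "smooth_on U X" "\<And>y. y \<in> U \<Longrightarrow> eta y \<bullet> X y = 0"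
  defines "Y \<equiv> \<lambda>y. P y *v X y"
  shows "bform (G u) (curvature G Y X xi u) (Y u) =
    - (dder be u (X u) + dder al u (Y u)) * bform (G u) (X u) (X u)"
proof -
  let ?g = "bform (G u)"
  let ?W = "lie_bracket Y X u"
  have Y: "smooth_on U Y" "\<And>y. y \<in> U \<Longrightarrow> eta y \<bullet> Y y = 0"
    unfolding Y_def using smooth_phi[OF X(1)] eta_phi by auto
  have phi_Y: "P y *v Y y = - X y" if "y \<in> U" for y
    unfolding Y_def by (rule phi_phi_horizontal[OF that X(2)[OF that]])
  have nX: "nabla G X xi y = be y *\<^sub>R X y + (- al y) *\<^sub>R Y y" if "y \<in> U" for y
    unfolding nabla_xi[of X] Y_def by (rule Dxi_horizontal[OF that X(2)[OF that]])
  have nY: "nabla G Y xi y = be y *\<^sub>R Y y + al y *\<^sub>R X y" if "y \<in> U" for y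
    unfolding nabla_xi[of Y] using Dxi_horizontal[OF that Y(2)[OF that]] phi_Y[OF that] by simp
  have smooth: "smooth_on U (\<lambda>y. be y *\<^sub>R X y)" "smooth_on U (\<lambda>y. (- al y) *\<^sub>R Y y)"
    "smooth_on U (\<lambda>y. be y *\<^sub>R Y y)" "smooth_on U (\<lambda>y. al y *\<^sub>R X y)" "smooth_on U (\<lambda>y. - al y)"
    by (intro smooth_on_scaleR smooth_on_minus open_U smooth_al smooth_be X(1) Y(1))+
  have dal: "dder (\<lambda>y. - al y) u v = - dder al u v" for v
    by (rule dder_minus[OF smooth_on_differentiable[OF smooth_al u]])
  have nnX: "nabla G Y (nabla G X xi) u = nabla G Y (\<lambda>y. be y *\<^sub>R X y + (- al y) *\<^sub>R Y y) u"
    by (rule nabla_cong[OF u nX refl])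
  have nnY: "nabla G X (nabla G Y xi) u = nabla G X (\<lambda>y. be y *\<^sub>R Y y + al y *\<^sub>R X y) u"
    by (rule nabla_cong[OF u nY refl])
  have e1: "nabla G Y (nabla G X xi) u = be u *\<^sub>R nabla G Y X u + dder be u (Y u) *\<^sub>R X u
      + (- al u *\<^sub>R nabla G Y Y u - dder al u (Y u) *\<^sub>R Y u)"
    unfolding nnX nabla_add[OF u smooth(1,2)]
      nabla_scaleR[OF u smooth_be X(1)] nabla_scaleR[OF u smooth(5) Y(1)] dal by simp
  have e2: "nabla G X (nabla G Y xi) u = be u *\<^sub>R nabla G X Y u + dder be u (X u) *\<^sub>R Y u
      + (al u *\<^sub>R nabla G X X u + dder al u (X u) *\<^sub>R X u)"
    unfolding nnY nabla_add[OF u smooth(3,4)]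
      nabla_scaleR[OF u smooth_be Y(1)] nabla_scaleR[OF u smooth_al X(1)] by simp
  have e3: "nabla G (lie_bracket Y X) xi u = - al u *\<^sub>R (P u *v ?W) + be u *\<^sub>R (?W - (eta u \<bullet> ?W) *\<^sub>R xi u)"
    unfolding nabla_xi[of "lie_bracket Y X"] by (rule Dxi_formula[OF u])
  have "?g ?W z = ?g (nabla G Y X u) z - ?g (nabla G X Y u) z" for z
    using bform_simps(3) torsion_free[OF u, of Y X] by metis
  moreover have "?g (X u) (Y u) = 0" "?g (xi u) (Y u) = 0" "?g (Y u) (Y u) = ?g (X u) (X u)"
    "?g (P u *v ?W) (Y u) = ?g ?W (X u)"
    unfolding Y_def using g_phi_self[OF u, of "X u"] g_commute[OF u, of "X u" "P u *v X u"]
      g_xi_phi[OF u, of "X u"] g_phi_phi[OF u] X(2)[OF u] by simp_all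
  moreover have "?g (nabla G Y Y u) (Y u) = ?g (nabla G Y X u) (X u)"
  proof -
    have "dder (\<lambda>y. bform (G y) (Y y) (Y y)) u (Y u) = dder (\<lambda>y. bform (G y) (X y) (X y)) u (Y u)"
      by (rule dder_cong_vec[OF open_U u]) (simp add: Y_def g_phi_phi X(2))
    then show ?thesis
      using metric_compatible[OF Y(1) Y(1) u, of Y] metric_compatible[OF X(1) X(1) u, of Y]
        g_commute[OF u, of "Y u" "nabla G Y Y u"] g_commute[OF u, of "X u" "nabla G Y X u"] by simp
  qed
  moreover have "?g (nabla G X X u) (Y u) = - ?g (nabla G X Y u) (X u)"
  proof -
    have "dder (\<lambda>y. bform (G y) (X y) (Y y)) u (X u) = 0"
      by (rule dder_zero_on[OF u]) (simp add: Y_def g_phi_self g_commute[of _ "X _" "P _ *v X _"])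
    then show ?thesis
      using metric_compatible[OF X(1) Y(1) u, of X] g_commute[OF u, of "X u" "nabla G X Y u"] by simp
  qed
  ultimately show ?thesis
    unfolding curvature_def e1 e2 e3 by (simp add: bform_simps) (simp add: algebra_simps)
qed

lemma curvature_xi_xi:
  assumes u: "u \<in> U" and X: "smooth_on U X"
  shows "bform (G u) (curvature G xi X xi u) (xi u) = 0"
proof -
  let ?H = "nabla G X xi"
  have H: "smooth_on U ?H" by (rule smooth_nabla[OF X smooth_xi])
  have "dder (\<lambda>y. bform (G y) (?H y) (xi y)) u (xi u) = 0"
    by (rule dder_zero_on[OF u]) (simp add: nabla_xi[of X] g_Dxi_xi)
  then have "bform (G u) (nabla G xi ?H u) (xi u) = 0"
    using metric_compatible[OF H smooth_xi u, of xi] by (simp add: nabla_xi[of xi] Dxi_along_xi[OF u] bform_simps)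
  moreover have "nabla G X (nabla G xi xi) u = nabla G X (\<lambda>_. 0) u"
    by (rule nabla_cong[OF u]) (simp_all add: nabla_xi[of xi] Dxi_along_xi)
  moreover have "nabla G X (\<lambda>_. 0) u = 0"
    using christoffel_map_simps(4)[of G u "X u" 0 0] by (simp add: nabla_christoffel_map)
  ultimately show ?thesis
    by (simp add: curvature_def bform_simps nabla_xi[of "lie_bracket xi X"] g_Dxi_xi[OF u])
qed

text \<open>In the trace over the frame \<open>xi\<close>, \<open>z\<close>, \<open>phi z\<close> the first term vanishes by \<open>curvature_xi_xi\<close> and the
  second by antisymmetry.\<close>

lemma ricci_horizontal_xi:
  assumes u: "u \<in> U" and z: "eta u \<bullet> z = 0" "z \<noteq> 0"
  shows "ricci G u z (xi u) = - dder be u z - dder al u (P u *v z)"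
proof -
  obtain X where X: "smooth_on U X" "\<And>y. y \<in> U \<Longrightarrow> eta y \<bullet> X y = 0" "X u = z"
    using horizontal_extension[OF u z(1)] by blast
  let ?Y = "\<lambda>y. P y *v X y"
  let ?L = "\<lambda>x. curvature G (\<lambda>_. x) (\<lambda>_. z) (\<lambda>_. xi u) u"
  have tens: "?L (Z u) = curvature G Z X xi u" if "smooth_on U Z" for Z
    using curvature_tensorial[OF that X(1) smooth_xi u] X(3) by simp
  have "curvature G X X xi u = 0"
  proof -
    have "lie_bracket X X u = 0" by (simp add: lie_bracket_def)
    then show ?thesis using christoffel_map_simps(3)[of G u 0 0] linear_0[OF linear_dder[OF smooth_xi u]]
      by (simp add: curvature_def nabla_christoffel_map[of G "lie_bracket X X"])
  qed
  then have "?L z = 0" using tens[OF X(1)] X(3) by simp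
  moreover have "bform (G u) (?L (P u *v z)) (P u *v z) = - (dder be u z + dder al u (P u *v z)) * bform (G u) z z"
    using tens[OF smooth_phi[OF X(1)]] curvature_horizontal_xi[OF u X(1,2)] X(3) by simp
  moreover have "bform (G u) (?L (xi u)) (xi u) = 0"
    using tens[OF smooth_xi] curvature_xi_xi[OF u X(1)] by simp
  ultimately show ?thesis
    unfolding ricci_def trace_in_frame[OF u z linear_curvature[OF u]]
    using pos_G[OF u z(2)] by (simp add: bform_simps)
qed

text \<open>The bracket accounts for the change of \<open>X\<close> along the flow of \<open>xi\<close>; the rest is the Lie derivative of
  the metric, which is \<open>2 * be\<close> times the metric on horizontal vectors.\<close>

lemma dder_norm_along_xi:
  assumes u: "u \<in> U" and X: "smooth_on U X" "\<And>y. y \<in> U \<Longrightarrow> eta y \<bullet> X y = 0"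
  shows "dder (\<lambda>y. bform (G y) (X y) (X y)) u (xi u) =
    2 * bform (G u) (lie_bracket xi X u) (X u) + 2 * be u * bform (G u) (X u) (X u)"
proof -
  have "nabla G xi X u = lie_bracket xi X u + Dxi u (X u)"
    using torsion_free[OF u, of xi X] nabla_xi[of X u] by (simp add: algebra_simps)
  then show ?thesis
    using metric_compatible[OF X(1) X(1) u, of xi] g_commute[OF u, of "X u" "nabla G xi X u"]
    by (simp add: Dxi_horizontal[OF u X(2)[OF u]] bform_simps g_phi_self[OF u])
qed

lemma lie_bracket_xi_horizontal:
  assumes u: "u \<in> U" and X: "smooth_on U X" "\<And>y. y \<in> U \<Longrightarrow> eta y \<bullet> X y = 0"
  shows "eta u \<bullet> lie_bracket xi X u = 0"
  using normal_xi(1)[OF u X(1)] dder_zero_on[OF u, of "\<lambda>y. eta y \<bullet> X y" 0] X(2) by simp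

text \<open>The flow of \<open>xi\<close> preserves \<open>eta\<close>, hence \<open>d eta\<close>, and scales the horizontal metric at the rate
  \<open>2 * be\<close>; since up to sign \<open>d eta\<close> is \<open>al\<close> times the horizontal area form, \<open>al\<close> must decay at the same rate.
  The invariance of \<open>d eta\<close> enters as the Jacobi identity for \<open>xi\<close> and a horizontal frame.\<close>

lemma dder_al_xi:
  assumes u: "u \<in> U"
  shows "dder al u (xi u) = - 2 * al u * be u"
proof -
  let ?g = "bform (G u)"
  obtain V where V: "P u *v V \<noteq> 0" using phi_nonzero[OF u] .
  define X Y Z N where "X = (\<lambda>y. P y *v V)" and "Y = (\<lambda>y. P y *v X y)" and "Z = lie_bracket xi X"
    and "N = (\<lambda>y. bform (G y) (X y) (X y))"
  have X: "smooth_on U X" "\<And>y. y \<in> U \<Longrightarrow> eta y \<bullet> X y = 0"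
    unfolding X_def using smooth_phi[OF smooth_on_const] eta_phi by auto
  have Y: "smooth_on U Y" "\<And>y. y \<in> U \<Longrightarrow> eta y \<bullet> Y y = 0"
    unfolding Y_def using smooth_phi[OF X(1)] eta_phi by auto
  have Z: "smooth_on U Z" "\<And>y. y \<in> U \<Longrightarrow> eta y \<bullet> Z y = 0"
    unfolding Z_def using smooth_lie_bracket[OF smooth_xi X(1)] lie_bracket_xi_horizontal[OF _ X] by auto
  have PZ: "smooth_on U (\<lambda>y. P y *v Z y)" "\<And>y. y \<in> U \<Longrightarrow> eta y \<bullet> (P y *v Z y) = 0"
    using smooth_phi[OF Z(1)] eta_phi by auto
  have N: "smooth_on U N" unfolding N_def by (intro smooth_on_bform open_U smooth_G X(1))
  have "N u > 0" using pos_G[OF u V] by (simp add: N_def X_def)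
  have br: "eta y \<bullet> lie_bracket X Y y = 2 * (al y * N y)" if "y \<in> U" for y
    using eta_lie_bracket[OF that X Y] g_phi_phi[OF that, of "X y" "X y"] X(2)[OF that] by (simp add: Y_def N_def)
  have "lie_bracket xi (lie_bracket X Y) u = lie_bracket Z Y u + lie_bracket X (lie_bracket xi Y) u"
    unfolding Z_def by (rule lie_bracket_jacobi[OF open_U smooth_xi X(1) Y(1) u])
  also have "lie_bracket X (lie_bracket xi Y) u = lie_bracket X (\<lambda>y. P y *v Z y) u"
    unfolding Y_def Z_def by (rule lie_bracket_cong[OF u refl]) (rule normal_xi(2)[OF _ X(1)])
  finally have "eta u \<bullet> lie_bracket xi (lie_bracket X Y) u =
    2 * al u * ?g (P u *v Z u) (P u *v X u) + 2 * al u * ?g (P u *v X u) (P u *v Z u)"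
    using eta_lie_bracket[OF u Z Y] eta_lie_bracket[OF u X PZ] by (simp add: inner_add_right Y_def)
  also have "\<dots> = 4 * al u * ?g (Z u) (X u)"
    using g_commute[OF u, of "X u" "Z u"] by (simp add: g_phi_phi[OF u] X(2)[OF u])
  also have "eta u \<bullet> lie_bracket xi (lie_bracket X Y) u = dder (\<lambda>y. 2 * (al y * N y)) u (xi u)"
    unfolding normal_xi(1)[OF u smooth_lie_bracket[OF X(1) Y(1)]]
    by (rule dder_cong_vec[OF open_U u]) (rule br)
  also have "\<dots> = 2 * (al u * dder N u (xi u) + dder al u (xi u) * N u)"
    using dder_linear_compose[OF bounded_linear_mult_right, of "\<lambda>y. al y * N y" u 2]
      smooth_on_differentiable[OF smooth_on_mult[OF open_U smooth_al N] u]
      dder_mult[OF smooth_on_differentiable[OF smooth_al u] smooth_on_differentiable[OF N u]] by simp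
  also have "dder N u (xi u) = 2 * ?g (Z u) (X u) + 2 * be u * N u"
    unfolding N_def Z_def by (rule dder_norm_along_xi[OF u X])
  finally have "(dder al u (xi u) + 2 * al u * be u) * N u = 0" by (simp add: algebra_simps)
  then show ?thesis using \<open>N u > 0\<close> by simp
qed

text \<open>The real part of \<open>xi F + F\<^sup>2\<close> for the complex function \<open>F = be + i al\<close>; the imaginary part vanishes
  by \<open>dder_al_xi\<close>.\<close>

definition psi :: "real^3 \<Rightarrow> real" where
  "psi u = dder be u (xi u) + (be u)\<^sup>2 - (al u)\<^sup>2"

lemma smooth_psi: "smooth_on U psi"
  unfolding psi_def[abs_def] power2_eq_square
  by (intro smooth_on_intros open_U smooth_be smooth_al smooth_xi)

lemma dder_psi:
  assumes u: "u \<in> U"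
  shows "dder psi u v = dder (\<lambda>y. dder be y (xi y)) u v + 2 * be u * dder be u v - 2 * al u * dder al u v"
proof -
  have d: "(\<lambda>y. dder be y (xi y)) differentiable (at u)" "be differentiable (at u)" "al differentiable (at u)"
    using smooth_on_differentiable[OF _ u] smooth_on_dder[OF open_U smooth_be smooth_xi] smooth_be smooth_al
    by auto
  have d': "(\<lambda>y. be y * be y) differentiable (at u)" "(\<lambda>y. al y * al y) differentiable (at u)"
    "(\<lambda>y. dder be y (xi y) + be y * be y) differentiable (at u)"
    using d by (auto intro: differentiable_mult differentiable_add)
  show ?thesis
    unfolding psi_def[abs_def] power2_eq_square
    by (simp add: dder_diff[OF d'(3,2)] dder_add[OF d(1) d'(1)] dder_mult[OF d(2,2)] dder_mult[OF d(3,3)])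
qed

text \<open>On an adapted basis both \<open>v\<close> and \<open>w\<close> are horizontal unit vectors, so that the skew part of
  \<open>\<nabla>\<xi>\<close> does not contribute.\<close>

lemma expansion_in_adapted_basis:
  assumes u: "u \<in> U" and ad: "adapted_basis (G u) (P u) (xi u) v w"
  shows "Re (cbform (G u) (clinear_ext (\<lambda>z. nabla G (\<lambda>_. z) xi u) (conj_vec (del v w))) (del v w)) = be u"
proof -
  let ?g = "bform (G u)" and ?c = "1 / sqrt 2 :: real"
  have re: "re_vec (del v w) = ?c *\<^sub>R v" "im_vec (del v w) = ?c *\<^sub>R (- w)"
    "re_vec (conj_vec (del v w)) = ?c *\<^sub>R v" "im_vec (conj_vec (del v w)) = ?c *\<^sub>R w"
    by (simp_all add: vec_eq_iff re_vec_def im_vec_def conj_vec_def del_def complexify_def)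
  have ext: "re_vec (clinear_ext L z) = L (re_vec z)" "im_vec (clinear_ext L z) = L (im_vec z)" for L z
    by (simp_all add: vec_eq_iff re_vec_def im_vec_def clinear_ext_def complexify_def)
  have eta: "eta u \<bullet> v = 0" "eta u \<bullet> w = 0" using ad by (simp_all add: adapted_basis_def eta_g[OF u])
  have "Re (cbform (G u) (clinear_ext (Dxi u) (conj_vec (del v w))) (del v w))
      = ?c * ?c * (?g (Dxi u v) v + ?g (Dxi u w) w)"
    by (simp add: cbform_def re ext linear_cmul[OF linear_Dxi[OF u]] bform_simps algebra_simps)
  also have "\<dots> = be u"
    using ad eta by (simp add: adapted_basis_def Dxi_horizontal[OF u] bform_simps g_phi_self[OF u])
  finally show ?thesis .
qed

lemma adapted_basis_exists:
  assumes u: "u \<in> U"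
  obtains v w where "adapted_basis (G u) (P u) (xi u) v w"
proof -
  obtain V where V: "P u *v V \<noteq> 0" using phi_nonzero[OF u] .
  let ?g = "bform (G u)"
  define c where "c = 1 / sqrt (?g (P u *v V) (P u *v V))"
  define v where "v = c *\<^sub>R (P u *v V)"
  define w where "w = P u *v v"
  have "?g (P u *v V) (P u *v V) > 0" by (rule pos_G[OF u V])
  then have vv: "?g v v = 1" by (simp add: v_def c_def bform_simps)
  have v: "eta u \<bullet> v = 0" by (simp add: v_def eta_phi[OF u])
  have "clinear_ext ((*v) (P u)) (del v w) = \<i> *s del v w"
  proof -
    have re: "re_vec (del v w) = (1 / sqrt 2) *\<^sub>R v" "im_vec (del v w) = - (1 / sqrt 2) *\<^sub>R w"
      by (simp_all add: vec_eq_iff re_vec_def im_vec_def del_def complexify_def)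
    have "P u *v w = - v" unfolding w_def by (rule phi_phi_horizontal[OF u v])
    then have "P u *v re_vec (del v w) = (1 / sqrt 2) *\<^sub>R w" "P u *v im_vec (del v w) = (1 / sqrt 2) *\<^sub>R v"
      unfolding re phi_simps by (simp_all add: w_def)
    then show ?thesis
      by (simp add: clinear_ext_def complexify_def vec_eq_iff del_def complex_eq_iff)
  qed
  then have "adapted_basis (G u) (P u) (xi u) v w"
    unfolding adapted_basis_def
    using vv v g_xi_xi[OF u] eta_g[OF u, of v] g_phi_phi[OF u, of v v] g_xi_phi[OF u, of v]
      g_phi_self[OF u, of v] g_commute[OF u, of v w] by (simp add: w_def)
  then show ?thesis by (rule that)
qed

end

text \<open>An \<open>eta\<close>-Einstein Ricci tensor has no component that pairs \<open>xi\<close> with a horizontal vector.\<close>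

locale einstein_chart = normal_chart +
  assumes ricci_xi: "u \<in> U \<Longrightarrow> eta u \<bullet> z = 0 \<Longrightarrow> ricci G u z (xi u) = 0"
begin

lemma dder_be_horizontal:
  assumes u: "u \<in> U" and z: "eta u \<bullet> z = 0"
  shows "dder be u z = - dder al u (P u *v z)"
proof (cases "z = 0")
  case True
  then show ?thesis
    using linear_0[OF linear_dder[OF smooth_be u]] linear_0[OF linear_dder[OF smooth_al u]] by (simp add: phi_simps)
next
  case False
  then show ?thesis using ricci_horizontal_xi[OF u z] ricci_xi[OF u z] by simp
qed

text \<open>In terms of \<open>F = be + i al\<close> and \<open>\<partial> = X - i phi X\<close>, \<open>dder_be_horizontal\<close> says that \<open>\<partial> F = 0\<close>.  The
  flow of \<open>xi\<close> preserves \<open>phi\<close> and the horizontal planes, so that also \<open>\<partial> (xi F + F\<^sup>2) = 0\<close>; and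
  \<open>xi F + F\<^sup>2\<close> is the real function \<open>psi\<close>.  The proof is the real form of this computation.\<close>

lemma dder_psi_horizontal:
  assumes u: "u \<in> U" and z: "eta u \<bullet> z = 0"
  shows "dder psi u z = 0"
proof -
  obtain X where X: "smooth_on U X" "\<And>y. y \<in> U \<Longrightarrow> eta y \<bullet> X y = 0" "X u = z"
    using horizontal_extension[OF u z] by blast
  define Y where "Y = (\<lambda>y. P y *v X y)"
  have Y: "smooth_on U Y" "\<And>y. y \<in> U \<Longrightarrow> eta y \<bullet> Y y = 0"
    unfolding Y_def using smooth_phi[OF X(1)] eta_phi by auto
  have phi_Y: "P u *v Y u = - X u"
    unfolding Y_def by (rule phi_phi_horizontal[OF u X(2)[OF u]])
  let ?Z = "lie_bracket xi X u"
  have Z: "eta u \<bullet> ?Z = 0" by (rule lie_bracket_xi_horizontal[OF u X(1,2)])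
  have ZY: "lie_bracket xi Y u = P u *v ?Z" unfolding Y_def by (rule normal_xi(2)[OF u X(1)])
  have lin: "linear (dder al u)" by (rule linear_dder[OF smooth_al u])
  have be_Y: "dder be u (Y u) = dder al u (X u)"
    using dder_be_horizontal[OF u Y(2)[OF u]] phi_Y by (simp add: linear_neg[OF lin])
  have be_X: "dder be u (X u) = - dder al u (Y u)"
    unfolding Y_def by (rule dder_be_horizontal[OF u X(2)[OF u]])
  have "dder (\<lambda>y. dder be y (xi y)) u (X u) = dder (\<lambda>y. dder be y (X y)) u (xi u) - dder be u ?Z"
    using dder_lie_bracket[OF open_U smooth_be smooth_xi X(1) u] by simp
  also have "dder (\<lambda>y. dder be y (X y)) u (xi u) = dder (\<lambda>y. - dder al y (Y y)) u (xi u)"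
    by (rule dder_cong_vec[OF open_U u]) (simp add: Y_def dder_be_horizontal X(2))
  also have "\<dots> = - dder (\<lambda>y. dder al y (Y y)) u (xi u)"
    by (intro dder_minus smooth_on_differentiable[OF smooth_on_dder[OF open_U smooth_al Y(1)] u])
  also have "dder (\<lambda>y. dder al y (Y y)) u (xi u) = dder (\<lambda>y. dder al y (xi y)) u (Y u) + dder al u (P u *v ?Z)"
    using dder_lie_bracket[OF open_U smooth_al smooth_xi Y(1) u] ZY by simp
  also have "dder (\<lambda>y. dder al y (xi y)) u (Y u) = dder (\<lambda>y. - 2 * (al y * be y)) u (Y u)"
    by (rule dder_cong_vec[OF open_U u]) (simp add: dder_al_xi)
  also have "\<dots> = - 2 * (al u * dder be u (Y u) + dder al u (Y u) * be u)"
    using dder_linear_compose[OF bounded_linear_mult_right, of "\<lambda>y. al y * be y" u "- 2"]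
      smooth_on_differentiable[OF smooth_on_mult[OF open_U smooth_al smooth_be] u]
      dder_mult[OF smooth_on_differentiable[OF smooth_al u] smooth_on_differentiable[OF smooth_be u]] by simp
  finally have "dder (\<lambda>y. dder be y (xi y)) u (X u) = 2 * al u * dder al u (X u) + 2 * be u * dder al u (Y u)"
    using dder_be_horizontal[OF u Z] be_Y by (simp add: algebra_simps)
  then show ?thesis using dder_psi[OF u, of "X u"] be_X X(3) by simp
qed

text \<open>Since \<open>psi\<close> is constant along horizontal fields, it is constant along their brackets, and one of
  these has a component along \<open>xi\<close> when \<open>al\<close> does not vanish.\<close>

lemma dder_psi_zero:
  assumes u: "u \<in> U" and al: "al u \<noteq> 0"
  shows "dder psi u v = 0"
proof -
  obtain V where V: "P u *v V \<noteq> 0" using phi_nonzero[OF u] .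
  define X Y where "X = (\<lambda>y. P y *v V)" and "Y = (\<lambda>y. P y *v X y)"
  have X: "smooth_on U X" "\<And>y. y \<in> U \<Longrightarrow> eta y \<bullet> X y = 0"
    unfolding X_def using smooth_phi[OF smooth_on_const] eta_phi by auto
  have Y: "smooth_on U Y" "\<And>y. y \<in> U \<Longrightarrow> eta y \<bullet> Y y = 0"
    unfolding Y_def using smooth_phi[OF X(1)] eta_phi by auto
  let ?W = "lie_bracket X Y u"
  have lin: "linear (dder psi u)" by (rule linear_dder[OF smooth_psi u])
  have split: "dder psi u v = (eta u \<bullet> v) * dder psi u (xi u)" for v
  proof -
    have "dder psi u v = dder psi u ((eta u \<bullet> v) *\<^sub>R xi u + (v - (eta u \<bullet> v) *\<^sub>R xi u))" by simp
    also have "\<dots> = (eta u \<bullet> v) * dder psi u (xi u) + dder psi u (v - (eta u \<bullet> v) *\<^sub>R xi u)"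
      by (simp only: linear_add[OF lin] linear_cmul[OF lin] real_scaleR_def)
    also have "dder psi u (v - (eta u \<bullet> v) *\<^sub>R xi u) = 0"
      by (rule dder_psi_horizontal[OF u]) (simp add: inner_diff_right eta_xi[OF u])
    finally show ?thesis by simp
  qed
  have "dder (\<lambda>y. dder psi y (Y y)) u (X u) = 0" "dder (\<lambda>y. dder psi y (X y)) u (Y u) = 0"
    by (rule dder_zero_on[OF u]; rule dder_psi_horizontal; simp add: X(2) Y(2))+
  then have "(eta u \<bullet> ?W) * dder psi u (xi u) = 0"
    using dder_lie_bracket[OF open_U smooth_psi X(1) Y(1) u] split[of ?W] by simp
  moreover have "eta u \<bullet> ?W \<noteq> 0"
    using eta_lie_bracket[OF u X Y] g_phi_phi[OF u, of "X u" "X u"] X(2)[OF u] al pos_G[OF u V]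
    by (simp add: Y_def X_def)
  ultimately show ?thesis using split[of v] by simp
qed

text \<open>Where \<open>al\<close> is critical and non-zero, \<open>be\<close> vanishes, and the horizontal Laplacian of \<open>al\<close> is the
  derivative of \<open>be\<close> along a bracket of horizontal fields, in which only the component along \<open>xi\<close> counts.\<close>

lemma horizontal_laplacian_al:
  assumes u: "u \<in> U" and al: "al u \<noteq> 0" and crit: "\<And>v. dder al u v = 0"
    and X: "smooth_on U X" "\<And>y. y \<in> U \<Longrightarrow> eta y \<bullet> X y = 0"
  defines "Y \<equiv> \<lambda>y. P y *v X y"
  shows "dder (\<lambda>y. dder al y (X u)) u (X u) + dder (\<lambda>y. dder al y (Y u)) u (Y u) =
    2 * al u * bform (G u) (X u) (X u) * (psi u + (al u)\<^sup>2)"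
proof -
  have Y: "smooth_on U Y" "\<And>y. y \<in> U \<Longrightarrow> eta y \<bullet> Y y = 0"
    unfolding Y_def using smooth_phi[OF X(1)] eta_phi by auto
  let ?W = "lie_bracket X Y u"
  have be: "be u = 0" using dder_al_xi[OF u] crit[of "xi u"] al by simp
  have be_Y: "dder be y (Y y) = dder al y (X y)" if "y \<in> U" for y
    using dder_be_horizontal[OF that Y(2)[OF that]] phi_phi_horizontal[OF that X(2)[OF that]]
    by (simp add: Y_def linear_neg[OF linear_dder[OF smooth_al that]])
  have be_X: "dder be y (X y) = - dder al y (Y y)" if "y \<in> U" for y
    unfolding Y_def by (rule dder_be_horizontal[OF that X(2)[OF that]])
  have "dder (\<lambda>y. dder al y (X u)) u (X u) + dder (\<lambda>y. dder al y (Y u)) u (Y u)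
    = dder (\<lambda>y. dder al y (X y)) u (X u) + dder (\<lambda>y. dder al y (Y y)) u (Y u)"
    by (simp add: dder_dder[OF open_U smooth_al X(1) u] dder_dder[OF open_U smooth_al Y(1) u] crit)
  also have "dder (\<lambda>y. dder al y (X y)) u (X u) = dder (\<lambda>y. dder be y (Y y)) u (X u)"
    by (rule dder_cong_vec[OF open_U u]) (simp add: be_Y)
  also have "dder (\<lambda>y. dder al y (Y y)) u (Y u) = - dder (\<lambda>y. dder be y (X y)) u (Y u)"
    unfolding dder_minus[OF smooth_on_differentiable[OF smooth_on_dder[OF open_U smooth_be X(1)] u], symmetric]
    by (rule dder_cong_vec[OF open_U u]) (simp add: be_X)
  also have "dder (\<lambda>y. dder be y (Y y)) u (X u) + - dder (\<lambda>y. dder be y (X y)) u (Y u) = dder be u ?W"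
    using dder_lie_bracket[OF open_U smooth_be X(1) Y(1) u] by simp
  also have "\<dots> = dder be u ((eta u \<bullet> ?W) *\<^sub>R xi u + (?W - (eta u \<bullet> ?W) *\<^sub>R xi u))" by simp
  also have "\<dots> = (eta u \<bullet> ?W) * dder be u (xi u) + dder be u (?W - (eta u \<bullet> ?W) *\<^sub>R xi u)"
    by (simp only: linear_add[OF linear_dder[OF smooth_be u]] linear_cmul[OF linear_dder[OF smooth_be u]] real_scaleR_def)
  also have "dder be u (?W - (eta u \<bullet> ?W) *\<^sub>R xi u) = 0"
    using dder_be_horizontal[OF u, of "?W - (eta u \<bullet> ?W) *\<^sub>R xi u"] crit
    by (simp add: inner_diff_right eta_xi[OF u])
  finally show ?thesis
    using eta_lie_bracket[OF u X Y] g_phi_phi[OF u, of "X u" "X u"] X(2)[OF u]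
    by (simp add: Y_def psi_def be algebra_simps)
qed

text \<open>The sign of \<open>s\<close> decides whether \<open>u\<close> is a maximum or a minimum of \<open>al\<^sup>2\<close>.  In either case \<open>u\<close> is a
  critical point of \<open>al\<close>, and the second derivative test bounds the horizontal Laplacian.\<close>

lemma psi_at_extremum:
  assumes u: "u \<in> U" and al: "al u \<noteq> 0" and s: "s \<noteq> 0"
    and ext: "\<And>y. y \<in> U \<Longrightarrow> s * (al y)\<^sup>2 \<le> s * (al u)\<^sup>2"
  shows "s * (psi u + (al u)\<^sup>2) \<le> 0"
proof -
  define f where "f y = s * (al y * al y)" for y
  have d: "al differentiable (at y)" if "y \<in> U" for y by (rule smooth_on_differentiable[OF smooth_al that])
  have f: "smooth_on U f"
    unfolding f_def by (intro smooth_on_mult smooth_on_const smooth_al open_U)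
  have sq: "smooth_on U (\<lambda>y. al y * al y)" by (intro smooth_on_mult smooth_al open_U)
  have df: "dder f y v = (2 * s) * (al y * dder al y v)" if "y \<in> U" for y v
    using dder_linear_compose[OF bounded_linear_mult_right, of "\<lambda>y. al y * al y" y s v]
      smooth_on_differentiable[OF sq that] dder_mult[OF d[OF that] d[OF that], of v]
    by (simp add: f_def[abs_def])
  have max: "f y \<le> f u" if "y \<in> U" for y using ext[OF that] by (simp add: f_def power2_eq_square)
  have crit: "dder al u v = 0" for v
    using second_derivative_nonpos_at_max(1)[OF open_U f u max, of v] df[OF u, of v] s al by simp
  have second: "s * (al u * dder (\<lambda>y. dder al y v) u v) \<le> 0" for v
  proof -
    have sm: "smooth_on U (\<lambda>y. dder al y v)" by (rule smooth_on_dder_const[OF smooth_al])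
    have "dder (\<lambda>y. dder f y v) u v = dder (\<lambda>y. (2 * s) * (al y * dder al y v)) u v"
      by (rule dder_cong_vec[OF open_U u]) (rule df)
    also have "\<dots> = (2 * s) * dder (\<lambda>y. al y * dder al y v) u v"
      by (rule dder_linear_compose[OF bounded_linear_mult_right])
        (rule smooth_on_differentiable[OF smooth_on_mult[OF open_U smooth_al sm] u])
    also have "dder (\<lambda>y. al y * dder al y v) u v = al u * dder (\<lambda>y. dder al y v) u v"
      using dder_mult[OF d[OF u] smooth_on_differentiable[OF sm u], of v] crit by simp
    finally show ?thesis using second_derivative_nonpos_at_max(2)[OF open_U f u max, of v] by simp
  qed
  obtain V where V: "P u *v V \<noteq> 0" using phi_nonzero[OF u] .
  have "s * (al u * (dder (\<lambda>y. dder al y (P u *v V)) u (P u *v V)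
      + dder (\<lambda>y. dder al y (P u *v (P u *v V))) u (P u *v (P u *v V)))) \<le> 0"
    using second[of "P u *v V"] second[of "P u *v (P u *v V)"] by (simp add: distrib_left)
  then have "s * (al u * (2 * al u * bform (G u) (P u *v V) (P u *v V) * (psi u + (al u)\<^sup>2))) \<le> 0"
    using horizontal_laplacian_al[OF u al crit smooth_phi[OF smooth_on_const[of _ V]] eta_phi] by simp
  then have "(2 * (al u * al u) * bform (G u) (P u *v V) (P u *v V)) * (s * (psi u + (al u)\<^sup>2)) \<le> 0"
    by (simp add: algebra_simps)
  moreover have "2 * (al u * al u) * bform (G u) (P u *v V) (P u *v V) > 0"
    using pos_G[OF u V] al by (auto simp: zero_less_mult_iff)
  ultimately show ?thesis by (metis linorder_not_le mult_pos_pos)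
qed

end

section \<open>Changes of charts\<close>

lemma dder_compose:
  assumes "f differentiable (at (T u))" "T differentiable (at u)"
  shows "dder (\<lambda>y. f (T y)) u v = dder f (T u) (dder T u v)"
  using frechet_derivative_compose[OF assms(2,1)] by (simp add: o_def)

lemma differentiable_compose:
  assumes "f differentiable (at (T u))" "T differentiable (at u)"
  shows "(\<lambda>y. f (T y)) differentiable (at u)"
  using differentiable_chain_at[OF assms(2,1)] by (simp add: o_def)

text \<open>Neither the exterior derivative of a one-form nor the Lie derivative of a metric sees the
  second derivatives of a coordinate change \<open>T\<close>: they cancel by symmetry.\<close>

lemma ext_deriv_at_pullback:
  fixes eta eta' :: "real^'n \<Rightarrow> real^'n" and T :: "real^'n \<Rightarrow> real^'n"
  assumes "open S" "smooth_on S T" "u \<in> S" "smooth_on S eta" "eta' differentiable (at (T u))"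
    and pull: "\<And>y w. y \<in> S \<Longrightarrow> eta y \<bullet> w = eta' (T y) \<bullet> dder T y w"
  shows "ext_deriv_at eta u v w = ext_deriv_at eta' (T u) (dder T u v) (dder T u w)"
proof -
  have dT: "T differentiable (at u)" by (rule smooth_on_differentiable[OF assms(2,3)])
  have "dder (\<lambda>y. eta y \<bullet> w) u v = eta' (T u) \<bullet> dder (\<lambda>y. dder T y w) u v
      + dder eta' (T u) (dder T u v) \<bullet> dder T u w" for v w
  proof -
    have "dder (\<lambda>y. eta y \<bullet> w) u v = dder (\<lambda>y. eta' (T y) \<bullet> dder T y w) u v"
      by (rule dder_cong_vec[OF assms(1,3)]) (rule pull)
    also have "\<dots> = eta' (T u) \<bullet> dder (\<lambda>y. dder T y w) u v + dder (\<lambda>y. eta' (T y)) u v \<bullet> dder T u w"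
      by (rule dder_bilinear[OF bounded_bilinear_inner differentiable_compose[OF assms(5) dT]])
        (rule smooth_on_differentiable[OF smooth_on_dder_const[OF assms(2)] assms(3)])
    finally show ?thesis by (simp add: dder_compose[OF assms(5) dT])
  qed
  moreover have "dder (\<lambda>y. eta' y \<bullet> b) (T u) a = dder eta' (T u) a \<bullet> b" for a b
    using dder_bilinear[OF bounded_bilinear_inner assms(5), of "\<lambda>_. b" a] by simp
  ultimately show ?thesis
    using dder_dder_commute[OF assms(1,2,3), of v w]
    by (simp add: ext_deriv_at_def ext_deriv_def lie_bracket_def)
qed

definition lie_deriv_metric ::
    "(real^'n \<Rightarrow> real^'n^'n) \<Rightarrow> (real^'n \<Rightarrow> real^'n) \<Rightarrow> real^'n \<Rightarrow> real^'n \<Rightarrow> real^'n \<Rightarrow> real" where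
  "lie_deriv_metric G xi u v w = bform (dder G u (xi u)) v w
     + bform (G u) (dder xi u v) w + bform (G u) v (dder xi u w)"

lemma lie_deriv_metric_pullback:
  fixes G G' :: "real^'n \<Rightarrow> real^'n^'n" and T xi xi' :: "real^'n \<Rightarrow> real^'n"
  assumes "open S" "smooth_on S T" "u \<in> S" "smooth_on S G" "smooth_on S xi"
    and d: "G' differentiable (at (T u))" "xi' differentiable (at (T u))"
    and pull: "\<And>y v w. y \<in> S \<Longrightarrow> bform (G y) v w = bform (G' (T y)) (dder T y v) (dder T y w)"
    and push: "\<And>y. y \<in> S \<Longrightarrow> xi' (T y) = dder T y (xi y)"
  shows "lie_deriv_metric G xi u v w = lie_deriv_metric G' xi' (T u) (dder T u v) (dder T u w)"
proof -
  have dT: "T differentiable (at u)" by (rule smooth_on_differentiable[OF assms(2,3)])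
  have dTv: "(\<lambda>y. dder T y a) differentiable (at u)" for a
    by (rule smooth_on_differentiable[OF smooth_on_dder_const[OF assms(2)] assms(3)])
  define D2 where "D2 a b = dder (\<lambda>y. dder T y a) u b" for a b
  have D2: "D2 a b = D2 b a" for a b unfolding D2_def by (rule dder_dder_commute[OF assms(1,2,3)])
  have xi': "dder xi' (T u) (dder T u a) = D2 (xi u) a + dder T u (dder xi u a)" for a
  proof -
    have "dder (\<lambda>y. xi' (T y)) u a = dder (\<lambda>y. dder T y (xi y)) u a"
      by (rule dder_cong_vec[OF assms(1,3)]) (rule push)
    then show ?thesis
      unfolding dder_compose[OF d(2) dT] dder_dder[OF assms(1,2,5,3)] D2_def .
  qed
  have "dder (\<lambda>y. bform (G y) v w) u (xi u) = dder (\<lambda>y. bform (G' (T y)) (dder T y v) (dder T y w)) u (xi u)"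
    by (rule dder_cong_vec[OF assms(1,3)]) (rule pull)
  also have "\<dots> = bform (dder (\<lambda>y. G' (T y)) u (xi u)) (dder T u v) (dder T u w)
      + bform (G' (T u)) (D2 v (xi u)) (dder T u w) + bform (G' (T u)) (dder T u v) (D2 w (xi u))"
    unfolding D2_def by (rule dder_bform[OF differentiable_compose[OF d(1) dT] dTv dTv])
  also have "dder (\<lambda>y. G' (T y)) u (xi u) = dder G' (T u) (xi' (T u))"
    by (simp add: dder_compose[OF d(1) dT] push[OF assms(3)])
  also have "dder (\<lambda>y. bform (G y) v w) u (xi u) = bform (dder G u (xi u)) v w"
    using dder_bform[OF smooth_on_differentiable[OF assms(4,3)], of "\<lambda>_. v" "\<lambda>_. w" "xi u"]
    by (simp add: bform_simps)
  finally show ?thesis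
    unfolding lie_deriv_metric_def pull[OF assms(3)] xi'
    by (simp add: bform_simps D2[of "xi u"])
qed

lemma (in metric_chart) lie_deriv_metric_nabla:
  assumes u: "u \<in> U"
  shows "lie_deriv_metric G X u v w =
    bform (G u) (nabla G (\<lambda>_. v) X u) w + bform (G u) v (nabla G (\<lambda>_. w) X u)"
proof -
  have "bform (G u) (christoffel_map G u v (X u)) w + bform (G u) v (christoffel_map G u w (X u))
      = bform (dder G u (X u)) v w"
    using g_christoffel_map[OF u, of v "X u" w] g_christoffel_map[OF u, of w "X u" v]
      g_commute[OF u, of v "christoffel_map G u w (X u)"]
      dder_G_commute[OF u, of "X u" v w] dder_G_commute[OF u, of v "X u" w] dder_G_commute[OF u, of w "X u" v]
    by simp
  then show ?thesis by (simp add: lie_deriv_metric_def nabla_christoffel_map bform_simps)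
qed

lemma (in normal_chart) lie_deriv_metric_horizontal:
  assumes "u \<in> U" "eta u \<bullet> x = 0"
  shows "lie_deriv_metric G xi u x x = 2 * be u * bform (G u) x x"
  using g_commute[OF assms(1), of x "Dxi u x"]
  by (simp add: lie_deriv_metric_nabla[OF assms(1)] Dxi_horizontal[OF assms] bform_simps g_phi_self[OF assms(1)])

lemma param_coord: "is_chart c \<Longrightarrow> p \<in> chart_dom c \<Longrightarrow> param c (coord c p) = p"
  by (simp add: is_chart_def homeomorphism_def)

lemma coord_param: "is_chart c \<Longrightarrow> u \<in> chart_img c \<Longrightarrow> coord c (param c u) = u"
  by (simp add: is_chart_def homeomorphism_def)

lemma coord_in_img: "p \<in> chart_dom c \<Longrightarrow> coord c p \<in> chart_img c"
  by (simp add: chart_img_def)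

lemma param_in_dom: "is_chart c \<Longrightarrow> u \<in> chart_img c \<Longrightarrow> param c u \<in> chart_dom c"
  by (auto simp: is_chart_def homeomorphism_def)

lemma continuous_open_preimage_local:
  assumes "continuous_on S f" "open S" "open B"
  shows "open (S \<inter> f -` B)"
  using assms continuous_on_open_vimage[of S f] by (metis inf_commute)

lemma open_overlap:
  assumes "is_chart c" "is_chart c'"
  shows "open (overlap c c')"
proof -
  have "overlap c c' = chart_img c \<inter> param c -` chart_dom c'"
    using param_coord[OF assms(1)] param_in_dom[OF assms(1)] coord_param[OF assms(1)]
    by (force simp: overlap_def chart_img_def)
  moreover have "continuous_on (chart_img c) (param c)" "open (chart_img c)" "open (chart_dom c')"
    using assms by (auto simp: is_chart_def homeomorphism_def)
  ultimately show ?thesis by (simp add: continuous_open_preimage_local)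
qed

lemma locally_constant_on_charts:
  assumes atlas: "smooth_atlas A" and conn: "connected (UNIV :: 'a::{t2_space,second_countable_topology} set)"
    and zero: "\<And>c u. c \<in> A \<Longrightarrow> u \<in> chart_img c \<Longrightarrow> ((f \<circ> param c) has_derivative (\<lambda>_. 0)) (at u)"
  shows "\<exists>C. \<forall>p::'a. f p = (C::real)"
proof -
  have "f constant_on UNIV"
  proof (rule locally_constant_imp_constant[OF conn])
    fix p :: 'a
    obtain c where c: "c \<in> A" "p \<in> chart_dom c" using atlas unfolding smooth_atlas_def by blast
    have ch: "is_chart c" using atlas c(1) by (simp add: smooth_atlas_def)
    then obtain e where e: "e > 0" "ball (coord c p) e \<subseteq> chart_img c"
      using coord_in_img[OF c(2)] openE[of "chart_img c" "coord c p"] unfolding is_chart_def by blast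
    define T where "T = chart_dom c \<inter> coord c -` ball (coord c p) e"
    have "open T"
      using ch unfolding T_def is_chart_def homeomorphism_def
      by (intro continuous_open_preimage_local) auto
    moreover have "p \<in> T" using c(2) e(1) by (simp add: T_def)
    moreover have "f q = f p" if "q \<in> T" for q
    proof -
      have "((f \<circ> param c) has_derivative (\<lambda>_. 0)) (at x within ball (coord c p) e)"
        if "x \<in> ball (coord c p) e" for x
        using has_derivative_at_withinI[OF zero[OF c(1)]] that e(2) by blast
      from has_derivative_zero_constant[OF convex_ball this]
      obtain k where k: "\<forall>x\<in>ball (coord c p) e. (f \<circ> param c) x = k" by auto
      have "(f \<circ> param c) (coord c q) = (f \<circ> param c) (coord c p)"
        using k that e(1) by (simp add: T_def)
      then show ?thesis using that c(2) by (simp add: T_def param_coord[OF ch])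
    qed
    moreover have "openin (top_of_set UNIV) T" using \<open>open T\<close> by (simp add: openin_open_eq)
    ultimately show "\<exists>T. openin (top_of_set UNIV) T \<and> p \<in> T \<and> (\<forall>x\<in>T. f x = f p)"
      by (intro exI[of _ T]) blast
  qed
  then show ?thesis by (auto simp: constant_on_def)
qed

section \<open>Normal structures on a manifold\<close>

locale acm_manifold =
  fixes A :: "('a::{t2_space,second_countable_topology}, 3) chart set"
    and \<phi> g :: "('a, 3) mat_field" and \<xi> \<eta> :: "('a, 3) vec_field"
  assumes atlas: "smooth_atlas A" and acm: "acm_structure A \<phi> \<xi> \<eta> g"
begin

lemma is_chart: "c \<in> A \<Longrightarrow> is_chart c"
  using atlas by (simp add: smooth_atlas_def)

lemma open_chart_img: "c \<in> A \<Longrightarrow> open (chart_img c)"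
  using is_chart by (simp add: is_chart_def)

lemma chart_around:
  obtains c where "c \<in> A" "p \<in> chart_dom c"
  using atlas unfolding smooth_atlas_def by blast

lemma acm_chart_at:
  assumes c: "c \<in> A"
  shows "acm_chart (chart_img c) (g c) (\<phi> c) (\<xi> c) (\<eta> c)"
proof -
  have "smooth_on (coord c ` (chart_dom c \<inter> UNIV)) (\<xi> c)"
    using acm c unfolding acm_structure_def vector_field_on_def by blast
  then have xi: "smooth_on (chart_img c) (\<xi> c)" by (simp add: chart_img_def)
  have gm: "smooth_on (chart_img c) (g c)" "\<forall>u\<in>chart_img c. transpose (g c u) = g c u \<and> (\<forall>v. v \<noteq> 0 \<longrightarrow> bform (g c u) v v > 0)"
    using acm c unfolding acm_structure_def riemannian_metric_def by simp_all
  have sm: "smooth_on (chart_img c) (\<phi> c)" "smooth_on (chart_img c) (\<eta> c)"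
    using acm c unfolding acm_structure_def endo_field_def one_form_def by simp_all
  have pt: "\<forall>u\<in>chart_img c.
        (\<forall>v. \<eta> c u \<bullet> v = bform (g c u) (\<xi> c u) v) \<and>
        (\<forall>v. \<phi> c u *v (\<phi> c u *v v) = - v + (\<eta> c u \<bullet> v) *\<^sub>R \<xi> c u) \<and>
        \<eta> c u \<bullet> \<xi> c u = 1 \<and>
        \<phi> c u *v \<xi> c u = 0 \<and>
        (\<forall>v w. bform (g c u) (\<phi> c u *v v) (\<phi> c u *v w) =
               bform (g c u) v w - (\<eta> c u \<bullet> v) * (\<eta> c u \<bullet> w))"
    using acm c unfolding acm_structure_def by (elim conjE bspec)
  show ?thesis
    by unfold_locales (use xi gm sm pt open_chart_img[OF c] in \<open>blast+\<close>)
qed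

text \<open>The tensor transformation laws, with the Jacobian matrix read as a derivative.\<close>

lemma transition_laws:
  assumes c: "c \<in> A" "c' \<in> A"
  defines "T \<equiv> transition c c'"
  shows "open (overlap c c')" "smooth_on (overlap c c') T" "overlap c c' \<subseteq> chart_img c"
    and "u \<in> overlap c c' \<Longrightarrow> T u \<in> chart_img c'"
    and "u \<in> overlap c c' \<Longrightarrow> \<xi> c' (T u) = dder T u (\<xi> c u)"
    and "u \<in> overlap c c' \<Longrightarrow> \<eta> c u \<bullet> v = \<eta> c' (T u) \<bullet> dder T u v"
    and "u \<in> overlap c c' \<Longrightarrow> \<phi> c' (T u) *v dder T u v = dder T u (\<phi> c u *v v)"
    and "u \<in> overlap c c' \<Longrightarrow> bform (g c u) v w = bform (g c' (T u)) (dder T u v) (dder T u w)"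
proof -
  show "open (overlap c c')" by (rule open_overlap[OF c[THEN is_chart]])
  show sm: "smooth_on (overlap c c') T" using atlas c by (simp add: smooth_atlas_def T_def)
  show "overlap c c' \<subseteq> chart_img c" by (auto simp: overlap_def chart_img_def)
  show "T u \<in> chart_img c'" if "u \<in> overlap c c'"
    using that param_coord[OF is_chart[OF c(1)]] by (auto simp: T_def transition_def overlap_def chart_img_def)
  have J: "jacobian_mat c c' u *v v = dder T u v" if "u \<in> overlap c c'" for u v
    unfolding jacobian_mat_def T_def[symmetric] using linear_dder[OF sm that] by (simp add: matrix_works)
  show "\<xi> c' (T u) = dder T u (\<xi> c u)" if u: "u \<in> overlap c c'"
  proof -
    have "u \<in> coord c ` (chart_dom c \<inter> chart_dom c' \<inter> UNIV)" using u by (simp add: overlap_def)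
    then have "\<xi> c' (transition c c' u) = jacobian_mat c c' u *v \<xi> c u"
      using acm c unfolding acm_structure_def vector_field_on_def by blast
    then show ?thesis by (simp add: J[OF u] T_def)
  qed
  show "\<eta> c u \<bullet> v = \<eta> c' (T u) \<bullet> dder T u v" if u: "u \<in> overlap c c'"
  proof -
    have "\<eta> c u = transpose (jacobian_mat c c' u) *v \<eta> c' (T u)"
      using acm c u unfolding acm_structure_def one_form_def T_def by simp
    then show ?thesis by (simp add: J[OF u, symmetric] dot_lmul_matrix)
  qed
  show "\<phi> c' (T u) *v dder T u v = dder T u (\<phi> c u *v v)" if u: "u \<in> overlap c c'"
  proof -
    have "\<phi> c' (T u) ** jacobian_mat c c' u = jacobian_mat c c' u ** \<phi> c u"
      using acm c u unfolding acm_structure_def endo_field_def T_def by simp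
    then show ?thesis by (simp add: J[OF u, symmetric] matrix_vector_mul_assoc)
  qed
  show "bform (g c u) v w = bform (g c' (T u)) (dder T u v) (dder T u w)" if u: "u \<in> overlap c c'"
  proof -
    have "g c u = transpose (jacobian_mat c c' u) ** g c' (T u) ** jacobian_mat c c' u"
      using acm c u unfolding acm_structure_def riemannian_metric_def T_def by simp
    then have "bform (g c u) v w = v \<bullet> (transpose (jacobian_mat c c' u) *v (g c' (T u) *v (jacobian_mat c c' u *v w)))"
      by (simp add: bform_def matrix_vector_mul_assoc matrix_mul_assoc)
    then show ?thesis
      by (simp add: J[OF u, symmetric] bform_def dot_lmul_matrix inner_commute[of v])
         (simp add: inner_commute)
  qed
qed

end

locale normal_manifold = acm_manifold +
  assumes normal: "normal_structure A \<phi> \<xi> \<eta>"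
begin

lemma normal_chart_at: "c \<in> A \<Longrightarrow> normal_chart (chart_img c) (g c) (\<phi> c) (\<xi> c) (\<eta> c)"
  using acm_chart_at normal unfolding normal_chart_def normal_chart_axioms_def normal_structure_def by blast

abbreviation "al c \<equiv> sasaki_coeff (g c) (\<phi> c) (\<xi> c)"
abbreviation "be c \<equiv> kenmotsu_coeff (g c) (\<xi> c)"

text \<open>On a horizontal vector \<open>x\<close> the coefficient \<open>al\<close> is read off from \<open>d \<eta> (x, \<phi> x)\<close> and \<open>be\<close> from the Lie
  derivative of \<open>g\<close> along \<open>\<xi>\<close>.\<close>

lemma coefficients_invariant:
  assumes c: "c \<in> A" "c' \<in> A" and u: "u \<in> overlap c c'"
  shows "al c u = al c' (transition c c' u)" and "be c u = be c' (transition c c' u)"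
proof -
  let ?T = "transition c c'"
  interpret C: normal_chart "chart_img c" "g c" "\<phi> c" "\<xi> c" "\<eta> c" by (rule normal_chart_at[OF c(1)])
  interpret C': normal_chart "chart_img c'" "g c'" "\<phi> c'" "\<xi> c'" "\<eta> c'" by (rule normal_chart_at[OF c(2)])
  note T = transition_laws[OF c]
  have uc: "u \<in> chart_img c" using T(3) u by blast
  have uc': "?T u \<in> chart_img c'" by (rule T(4)[OF u])
  obtain V where V: "\<phi> c u *v V \<noteq> 0" using C.phi_nonzero[OF uc] .
  define x where "x = \<phi> c u *v V"
  have x: "\<eta> c u \<bullet> x = 0" using C.eta_phi[OF uc] by (simp add: x_def)
  have N: "bform (g c u) x x > 0" using C.pos_G[OF uc V] by (simp add: x_def)
  let ?x = "dder ?T u x"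
  have x': "\<eta> c' (?T u) \<bullet> ?x = 0" using T(6)[OF u, of x] x by simp
  have N': "bform (g c' (?T u)) ?x ?x = bform (g c u) x x" using T(8)[OF u, of x x] by simp
  have sm: "smooth_on (overlap c c') (\<eta> c)" "smooth_on (overlap c c') (g c)" "smooth_on (overlap c c') (\<xi> c)"
    using C.smooth_eta C.smooth_G C.smooth_xi T(3) smooth_on_subset by blast+
  have d: "\<eta> c' differentiable (at (?T u))" "g c' differentiable (at (?T u))" "\<xi> c' differentiable (at (?T u))"
    using C'.smooth_eta C'.smooth_G C'.smooth_xi uc' smooth_on_differentiable by blast+
  have "ext_deriv_at (\<eta> c) u x (\<phi> c u *v x) = ext_deriv_at (\<eta> c') (?T u) ?x (\<phi> c' (?T u) *v ?x)"
    unfolding T(7)[OF u] by (rule ext_deriv_at_pullback[OF T(1,2) u sm(1) d(1) T(6)])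
  then have "al c u * bform (g c u) x x = al c' (?T u) * bform (g c' (?T u)) ?x ?x"
    using x x' by (simp add: C.ext_deriv_at_eta[OF uc] C'.ext_deriv_at_eta[OF uc'] C.g_phi_phi[OF uc] C'.g_phi_phi[OF uc'])
  then show "al c u = al c' (?T u)" using N N' by simp
  have "lie_deriv_metric (g c) (\<xi> c) u x x = lie_deriv_metric (g c') (\<xi> c') (?T u) ?x ?x"
    by (rule lie_deriv_metric_pullback[OF T(1,2) u sm(2,3) d(2,3) T(8,5)])
  then have "be c u * bform (g c u) x x = be c' (?T u) * bform (g c' (?T u)) ?x ?x"
    by (simp add: C.lie_deriv_metric_horizontal[OF uc x] C'.lie_deriv_metric_horizontal[OF uc' x'])
  then show "be c u = be c' (?T u)" using N N' by simp
qed

lemma psi_invariant: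
  assumes c: "c \<in> A" "c' \<in> A" and u: "u \<in> overlap c c'"
  shows "normal_chart.psi (g c) (\<phi> c) (\<xi> c) u = normal_chart.psi (g c') (\<phi> c') (\<xi> c') (transition c c' u)"
proof -
  let ?T = "transition c c'"
  interpret C: normal_chart "chart_img c" "g c" "\<phi> c" "\<xi> c" "\<eta> c" by (rule normal_chart_at[OF c(1)])
  interpret C': normal_chart "chart_img c'" "g c'" "\<phi> c'" "\<xi> c'" "\<eta> c'" by (rule normal_chart_at[OF c(2)])
  note T = transition_laws[OF c]
  have "dder (be c) u v = dder (\<lambda>y. be c' (?T y)) u v" for v
    by (rule dder_cong_vec[OF T(1) u]) (rule coefficients_invariant(2)[OF c])
  also have "dder (\<lambda>y. be c' (?T y)) u v = dder (be c') (?T u) (dder ?T u v)" for v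
    by (rule dder_compose[OF smooth_on_differentiable[OF C'.smooth_be T(4)[OF u]] smooth_on_differentiable[OF T(2) u]])
  finally show ?thesis
    by (simp add: C.psi_def C'.psi_def T(5)[OF u] coefficients_invariant[OF c u])
qed

text \<open>A function on the manifold from its expressions in the charts.  The chart is chosen arbitrarily at
  each point, which does not matter for expressions that agree on overlaps.\<close>

definition glue :: "(('a, 3) chart \<Rightarrow> real^3 \<Rightarrow> real) \<Rightarrow> 'a \<Rightarrow> real" where
  "glue F p = (let c = (SOME c. c \<in> A \<and> p \<in> chart_dom c) in F c (coord c p))"

lemma glue_chart:
  assumes inv: "\<And>c c' u. c \<in> A \<Longrightarrow> c' \<in> A \<Longrightarrow> u \<in> overlap c c' \<Longrightarrow> F c u = F c' (transition c c' u)"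
    and c: "c \<in> A" "p \<in> chart_dom c"
  shows "glue F p = F c (coord c p)"
proof -
  define c' where "c' = (SOME c. c \<in> A \<and> p \<in> chart_dom c)"
  have c': "c' \<in> A" "p \<in> chart_dom c'"
    using someI[of "\<lambda>c. c \<in> A \<and> p \<in> chart_dom c" c] c by (simp_all add: c'_def)
  have "coord c' p \<in> overlap c' c" using c c' by (simp add: overlap_def)
  from inv[OF c'(1) c(1) this] show ?thesis
    using param_coord[OF is_chart[OF c'(1)] c'(2)]
    by (simp add: glue_def Let_def transition_def flip: c'_def)
qed

definition "alpha = glue al"
definition "beta = glue be"
definition "Psi = glue (\<lambda>c. normal_chart.psi (g c) (\<phi> c) (\<xi> c))"

lemma coefficients_coord:
  assumes "c \<in> A" "p \<in> chart_dom c"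
  shows alpha_coord: "alpha p = al c (coord c p)"
    and beta_coord: "beta p = be c (coord c p)"
    and Psi_coord: "Psi p = normal_chart.psi (g c) (\<phi> c) (\<xi> c) (coord c p)"
  unfolding alpha_def beta_def Psi_def
  by (rule glue_chart[OF _ assms]; rule coefficients_invariant psi_invariant; assumption)+

lemma coefficients_param:
  assumes "c \<in> A" "u \<in> chart_img c"
  shows "alpha (param c u) = al c u" "beta (param c u) = be c u"
    "Psi (param c u) = normal_chart.psi (g c) (\<phi> c) (\<xi> c) u"
  using alpha_coord[OF assms(1)] beta_coord[OF assms(1)] Psi_coord[OF assms(1)]
    param_in_dom[OF is_chart assms(2)] coord_param[OF is_chart assms(2)] assms(1) by simp_all

lemma smooth_fun_coefficients: "smooth_fun A alpha" "smooth_fun A beta"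
proof -
  have "smooth_on (chart_img c) (alpha \<circ> param c) \<and> smooth_on (chart_img c) (beta \<circ> param c)" if c: "c \<in> A" for c
  proof -
    interpret C: normal_chart "chart_img c" "g c" "\<phi> c" "\<xi> c" "\<eta> c" by (rule normal_chart_at[OF c])
    show ?thesis
      by (intro conjI smooth_on_cong[OF C.smooth_al C.open_U] smooth_on_cong[OF C.smooth_be C.open_U])
        (simp_all add: coefficients_param[OF c])
  qed
  then show "smooth_fun A alpha" "smooth_fun A beta" by (auto simp: smooth_fun_def)
qed

lemma trans_sasakian_coefficients: "trans_sasakian A \<phi> \<xi> \<eta> g alpha beta"
  unfolding trans_sasakian_def
proof (intro conjI acm smooth_fun_coefficients ballI allI impI)
  fix c u and X Y :: "real^3 \<Rightarrow> real^3" assume c: "c \<in> A" and sm: "smooth_on (chart_img c) Y" and u: "u \<in> chart_img c"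
  interpret C: normal_chart "chart_img c" "g c" "\<phi> c" "\<xi> c" "\<eta> c" by (rule normal_chart_at[OF c])
  show "nabla_endo (g c) (\<phi> c) X Y u =
     alpha (param c u) *\<^sub>R (bform (g c u) (X u) (Y u) *\<^sub>R \<xi> c u - (\<eta> c u \<bullet> Y u) *\<^sub>R X u) +
     beta (param c u) *\<^sub>R (bform (g c u) (\<phi> c u *v X u) (Y u) *\<^sub>R \<xi> c u - (\<eta> c u \<bullet> Y u) *\<^sub>R (\<phi> c u *v X u))"
    unfolding coefficients_param[OF c u] by (rule C.nabla_endo_trans_sasakian[OF u sm])
qed

lemma expansion_eq_beta: "expansion A \<phi> \<xi> g = beta"
proof
  fix p
  have val: "Re (cbform (g c (coord c p)) (clinear_ext (\<lambda>z. nabla (g c) (\<lambda>_. z) (\<xi> c) (coord c p))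
      (conj_vec (del v w))) (del v w)) = beta p"
    if "c \<in> A" "p \<in> chart_dom c" "adapted_basis (g c (coord c p)) (\<phi> c (coord c p)) (\<xi> c (coord c p)) v w" for c v w
  proof -
    interpret C: normal_chart "chart_img c" "g c" "\<phi> c" "\<xi> c" "\<eta> c" by (rule normal_chart_at[OF that(1)])
    show ?thesis
      using C.expansion_in_adapted_basis[OF coord_in_img[OF that(2)] that(3)] beta_coord[OF that(1,2)] by simp
  qed
  show "expansion A \<phi> \<xi> g p = beta p"
    unfolding expansion_def Let_def
  proof (rule the_equality)
    show "\<forall>c\<in>A. p \<in> chart_dom c \<longrightarrow> (\<forall>v w. adapted_basis (g c (coord c p)) (\<phi> c (coord c p)) (\<xi> c (coord c p)) v w \<longrightarrow>
      beta p = Re (cbform (g c (coord c p)) (clinear_ext (\<lambda>z. nabla (g c) (\<lambda>_. z) (\<xi> c) (coord c p))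
      (conj_vec (del v w))) (del v w)))"
      using val by metis
    fix t
    assume t: "\<forall>c\<in>A. p \<in> chart_dom c \<longrightarrow> (\<forall>v w. adapted_basis (g c (coord c p)) (\<phi> c (coord c p)) (\<xi> c (coord c p)) v w \<longrightarrow>
      t = Re (cbform (g c (coord c p)) (clinear_ext (\<lambda>z. nabla (g c) (\<lambda>_. z) (\<xi> c) (coord c p))
      (conj_vec (del v w))) (del v w)))"
    obtain c where c: "c \<in> A" "p \<in> chart_dom c" using chart_around .
    interpret C: normal_chart "chart_img c" "g c" "\<phi> c" "\<xi> c" "\<eta> c" by (rule normal_chart_at[OF c(1)])
    obtain v w where "adapted_basis (g c (coord c p)) (\<phi> c (coord c p)) (\<xi> c (coord c p)) v w"
      using C.adapted_basis_exists[OF coord_in_img[OF c(2)]] .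
    then show "t = beta p" using t c val by metis
  qed
qed

lemma continuous_alpha: "continuous_on UNIV alpha"
proof -
  have "continuous_on (chart_dom c) alpha" if c: "c \<in> A" for c
  proof -
    interpret C: normal_chart "chart_img c" "g c" "\<phi> c" "\<xi> c" "\<eta> c" by (rule normal_chart_at[OF c])
    have "continuous_on (chart_dom c) (coord c)" "coord c ` chart_dom c = chart_img c"
      using is_chart[OF c] by (simp_all add: is_chart_def homeomorphism_def)
    then have "continuous_on (chart_dom c) (\<lambda>p. al c (coord c p))"
      using continuous_on_compose2[OF smooth_on_continuous[OF C.smooth_al]] by blast
    then show ?thesis by (simp add: alpha_coord[OF c] cong: continuous_on_cong)
  qed
  then have "continuous_on (\<Union>c\<in>A. chart_dom c) alpha"
    using is_chart by (intro continuous_on_open_UN) (auto simp: is_chart_def)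
  then show ?thesis using atlas by (simp add: smooth_atlas_def)
qed

lemma alpha_dichotomy:
  assumes "constant_rank A \<eta>"
  shows "(\<forall>p. alpha p = 0) \<or> (\<forall>p. alpha p \<noteq> 0)"
proof -
  obtain r where r: "\<And>c u. c \<in> A \<Longrightarrow> u \<in> chart_img c \<Longrightarrow> rank_at (\<eta> c) u = r"
    using assms unfolding constant_rank_def by blast
  have "alpha p = 0 \<longleftrightarrow> r = 1" for p
  proof -
    obtain c where c: "c \<in> A" "p \<in> chart_dom c" using chart_around .
    interpret C: normal_chart "chart_img c" "g c" "\<phi> c" "\<xi> c" "\<eta> c" by (rule normal_chart_at[OF c(1)])
    show ?thesis
      using C.rank_at_eq_1_iff[OF coord_in_img[OF c(2)]] r[OF c(1) coord_in_img[OF c(2)]] alpha_coord[OF c] by simp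
  qed
  then show ?thesis by blast
qed

end

section \<open>Homothety\<close>

text \<open>Both sides of the Koszul formula are linear in the metric.\<close>

lemma (in metric_chart) christoffel_map_scaled_metric:
  assumes k: "k > 0" and u: "u \<in> U"
  shows "christoffel_map (\<lambda>y. k *\<^sub>R G y) u v w = christoffel_map G u v w"
proof -
  interpret S: metric_chart U "\<lambda>y. k *\<^sub>R G y"
    using open_U smooth_G sym_G pos_G k
    by unfold_locales (auto intro: smooth_on_scaleR smooth_on_const simp: bform_scaleR_matrix transpose_scalar)
  have d: "dder (\<lambda>y. k *\<^sub>R G y) u a = k *\<^sub>R dder G u a" for a
    by (rule dder_linear_compose[OF bounded_linear_scaleR_right smooth_on_differentiable[OF smooth_G u]])
  show ?thesis
  proof (rule g_ext[OF u])
    fix z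
    have "k * bform (G u) (christoffel_map (\<lambda>y. k *\<^sub>R G y) u v w) z =
      (1/2) * (k * bform (dder G u v) w z + k * bform (dder G u w) v z - k * bform (dder G u z) v w)"
      using S.g_christoffel_map[OF u, of v w z] unfolding d bform_scaleR_matrix .
    also have "\<dots> = k * bform (G u) (christoffel_map G u v w) z"
      unfolding g_christoffel_map[OF u] by (simp add: algebra_simps)
    finally have "k * bform (G u) (christoffel_map (\<lambda>y. k *\<^sub>R G y) u v w) z = k * bform (G u) (christoffel_map G u v w) z" .
    then show "bform (G u) (christoffel_map (\<lambda>y. k *\<^sub>R G y) u v w) z = bform (G u) (christoffel_map G u v w) z"
      using k by simp
  qed
qed

context acm_manifold
begin

lemma acm_structure_homothety:
  assumes s: "s \<in> {1, -1}" and k: "k > 0"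
  shows "acm_structure A \<phi> (\<lambda>c u. (s * inverse k) *\<^sub>R \<xi> c u) (\<lambda>c u. (s * k) *\<^sub>R \<eta> c u) (\<lambda>c u. k\<^sup>2 *\<^sub>R g c u)"
proof -
  have ss: "s * s = 1" using s by auto
  have "riemannian_metric A (\<lambda>c u. k\<^sup>2 *\<^sub>R g c u)"
    using acm open_chart_img k unfolding acm_structure_def riemannian_metric_def
    by (auto intro!: smooth_on_scaleR smooth_on_const simp: bform_scaleR_matrix transpose_scalar
        matrix_scalar_ac scalar_matrix_assoc)
  moreover have "vector_field_on A UNIV (\<lambda>c u. (s * inverse k) *\<^sub>R \<xi> c u)"
    using acm open_chart_img unfolding acm_structure_def vector_field_on_def chart_img_def
    by (auto intro!: smooth_on_scaleR smooth_on_const simp: matrix_vector_mult_scaleR)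
  moreover have "one_form A (\<lambda>c u. (s * k) *\<^sub>R \<eta> c u)"
    using acm open_chart_img unfolding acm_structure_def one_form_def
    by (auto intro!: smooth_on_scaleR smooth_on_const simp: matrix_vector_mult_scaleR)
  moreover have "endo_field A \<phi>" using acm unfolding acm_structure_def by blast
  moreover have "((s * k) *\<^sub>R \<eta> c u) \<bullet> v = bform (k\<^sup>2 *\<^sub>R g c u) ((s * inverse k) *\<^sub>R \<xi> c u) v"
      "\<phi> c u *v (\<phi> c u *v v) = - v + (((s * k) *\<^sub>R \<eta> c u) \<bullet> v) *\<^sub>R ((s * inverse k) *\<^sub>R \<xi> c u)"
      "((s * k) *\<^sub>R \<eta> c u) \<bullet> ((s * inverse k) *\<^sub>R \<xi> c u) = 1"
      "\<phi> c u *v ((s * inverse k) *\<^sub>R \<xi> c u) = 0"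
      "bform (k\<^sup>2 *\<^sub>R g c u) (\<phi> c u *v v) (\<phi> c u *v w) =
        bform (k\<^sup>2 *\<^sub>R g c u) v w - (((s * k) *\<^sub>R \<eta> c u) \<bullet> v) * (((s * k) *\<^sub>R \<eta> c u) \<bullet> w)"
    if c: "c \<in> A" and u: "u \<in> chart_img c" for c u v w
  proof -
    interpret C: acm_chart "chart_img c" "g c" "\<phi> c" "\<xi> c" "\<eta> c" by (rule acm_chart_at[OF c])
    have sq: "s * k * (s * inverse k) = 1" "s * k * (s * k) = k\<^sup>2" "k\<^sup>2 * (s * inverse k) = s * k"
      using ss k by (simp_all add: power2_eq_square field_simps)
    show "((s * k) *\<^sub>R \<eta> c u) \<bullet> v = bform (k\<^sup>2 *\<^sub>R g c u) ((s * inverse k) *\<^sub>R \<xi> c u) v"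
    proof -
      have "s * inverse k * (k\<^sup>2 * e) = s * k * e" for e using k by (simp add: power2_eq_square field_simps)
      then show ?thesis
        by (simp only: bform_scaleR_matrix bform_simps C.eta_g[OF u, symmetric] inner_scaleR_left)
    qed
    show "\<phi> c u *v (\<phi> c u *v v) = - v + (((s * k) *\<^sub>R \<eta> c u) \<bullet> v) *\<^sub>R ((s * inverse k) *\<^sub>R \<xi> c u)"
    proof -
      have "(((s * k) *\<^sub>R \<eta> c u) \<bullet> v) *\<^sub>R ((s * inverse k) *\<^sub>R \<xi> c u) = (s * k * (s * inverse k)) *\<^sub>R ((\<eta> c u \<bullet> v) *\<^sub>R \<xi> c u)"
        by (simp add: mult_ac)
      then show ?thesis unfolding sq using C.phi_phi[OF u, of v] by simp
    qed
    show "((s * k) *\<^sub>R \<eta> c u) \<bullet> ((s * inverse k) *\<^sub>R \<xi> c u) = 1"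
      using sq(1) by (simp add: C.eta_xi[OF u] mult_ac)
    show "\<phi> c u *v ((s * inverse k) *\<^sub>R \<xi> c u) = 0" by (simp add: C.phi_simps C.phi_xi[OF u])
    have "((s * k) *\<^sub>R \<eta> c u \<bullet> v) * ((s * k) *\<^sub>R \<eta> c u \<bullet> w) = (s * k * (s * k)) * ((\<eta> c u \<bullet> v) * (\<eta> c u \<bullet> w))"
      by (simp only: inner_scaleR_left mult_ac)
    then show "bform (k\<^sup>2 *\<^sub>R g c u) (\<phi> c u *v v) (\<phi> c u *v w) =
        bform (k\<^sup>2 *\<^sub>R g c u) v w - (((s * k) *\<^sub>R \<eta> c u) \<bullet> v) * (((s * k) *\<^sub>R \<eta> c u) \<bullet> w)"
      unfolding sq bform_scaleR_matrix C.g_phi_phi[OF u] right_diff_distrib by (simp only:)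
  qed
  ultimately show ?thesis unfolding acm_structure_def by blast
qed

text \<open>Rescaling the metric by the constant \<open>k\<^sup>2\<close> does not change the connection and, together with the
  rescaling of \<open>\<xi>\<close> and \<open>\<eta>\<close>, divides \<open>\<alpha>\<close> by \<open>s k\<close>; so \<open>s\<close> and \<open>k\<close> are the sign and the absolute value of \<open>a\<close>.\<close>

lemma homothetic_to_sasakian_of_constant:
  assumes ts: "trans_sasakian A \<phi> \<xi> \<eta> g (\<lambda>_. a) (\<lambda>_. 0)" and a: "a \<noteq> 0"
  shows "homothetic_to_sasakian A \<phi> \<xi> \<eta> g"
proof -
  define s k where "s = sgn a" and "k = \<bar>a\<bar>"
  have s: "s \<in> {1, -1}" and k: "k > 0" using a by (auto simp: s_def k_def sgn_if)
  have sk: "s * k = a" by (simp add: s_def k_def sgn_mult_abs)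
  have "sasakian A \<phi> (\<lambda>c u. (s * inverse k) *\<^sub>R \<xi> c u) (\<lambda>c u. (s * k) *\<^sub>R \<eta> c u) (\<lambda>c u. k\<^sup>2 *\<^sub>R g c u)"
    unfolding sasakian_def trans_sasakian_def
  proof (intro conjI acm_structure_homothety[OF s k] ballI allI impI)
    show "smooth_fun A (\<lambda>_. 1)" "smooth_fun A (\<lambda>_. 0)" by (simp_all add: smooth_fun_def o_def smooth_on_const)
    fix c u and X Y :: "real^3 \<Rightarrow> real^3"
    assume c: "c \<in> A" and sm: "smooth_on (chart_img c) X" "smooth_on (chart_img c) Y" and u: "u \<in> chart_img c"
    interpret C: acm_chart "chart_img c" "g c" "\<phi> c" "\<xi> c" "\<eta> c" by (rule acm_chart_at[OF c])
    have "nabla_endo (\<lambda>u. k\<^sup>2 *\<^sub>R g c u) (\<phi> c) X Y u = nabla_endo (g c) (\<phi> c) X Y u"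
      using C.christoffel_map_scaled_metric[of "k\<^sup>2", OF _ u] k
      by (simp add: nabla_endo_def nabla_christoffel_map)
    also have "\<dots> = a *\<^sub>R (bform (g c u) (X u) (Y u) *\<^sub>R \<xi> c u - (\<eta> c u \<bullet> Y u) *\<^sub>R X u)"
      using ts c sm u unfolding trans_sasakian_def by simp
    also have "\<dots> = bform (k\<^sup>2 *\<^sub>R g c u) (X u) (Y u) *\<^sub>R (s * inverse k) *\<^sub>R \<xi> c u - ((s * k) *\<^sub>R \<eta> c u \<bullet> Y u) *\<^sub>R X u"
    proof -
      have "k\<^sup>2 * (s * inverse k) = a" using k sk by (simp add: power2_eq_square field_simps)
      then show ?thesis
        by (simp add: bform_scaleR_matrix sk scaleR_diff_right)
    qed
    finally show "nabla_endo (\<lambda>u. k\<^sup>2 *\<^sub>R g c u) (\<phi> c) X Y u =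
      1 *\<^sub>R (bform (k\<^sup>2 *\<^sub>R g c u) (X u) (Y u) *\<^sub>R (s * inverse k) *\<^sub>R \<xi> c u - ((s * k) *\<^sub>R \<eta> c u \<bullet> Y u) *\<^sub>R X u) +
      0 *\<^sub>R (bform (k\<^sup>2 *\<^sub>R g c u) (\<phi> c u *v X u) (Y u) *\<^sub>R (s * inverse k) *\<^sub>R \<xi> c u -
        ((s * k) *\<^sub>R \<eta> c u \<bullet> Y u) *\<^sub>R (\<phi> c u *v X u))" by simp
  qed
  then show ?thesis using s k unfolding homothetic_to_sasakian_def by blast
qed

end

section \<open>The classification\<close>

locale einstein_manifold = normal_manifold +
  assumes einstein: "eta_einstein A \<eta> g"
begin

lemma einstein_chart_at:
  assumes c: "c \<in> A"
  shows "einstein_chart (chart_img c) (g c) (\<phi> c) (\<xi> c) (\<eta> c)"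
proof -
  interpret C: normal_chart "chart_img c" "g c" "\<phi> c" "\<xi> c" "\<eta> c" by (rule normal_chart_at[OF c])
  obtain a b where ab: "\<And>c u v w. c \<in> A \<Longrightarrow> u \<in> chart_img c \<Longrightarrow> ricci (g c) u v w =
      a (param c u) * bform (g c u) v w + b (param c u) * (\<eta> c u \<bullet> v) * (\<eta> c u \<bullet> w)"
    using einstein unfolding eta_einstein_def by blast
  show ?thesis
  proof unfold_locales
    fix u z assume u: "u \<in> chart_img c" and z: "\<eta> c u \<bullet> z = 0"
    show "ricci (g c) u z (\<xi> c u) = 0"
      using ab[OF c u, of z "\<xi> c u"] z C.eta_g[OF u, of z] C.g_commute[OF u, of z "\<xi> c u"] by simp
  qed
qed

text \<open>The vectors of an adapted frame are horizontal, and \<open>dder_be_horizontal\<close> makes the horizontal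
  derivatives of \<open>beta\<close> vanish together with \<open>alpha\<close>.\<close>

lemma kenmotsu_case:
  assumes al0: "\<And>p. alpha p = 0"
  shows "beta_kenmotsu A \<phi> \<xi> \<eta> g beta"
    and "adapted_frame A \<phi> \<xi> g V e2 e3 \<Longrightarrow> c \<in> A \<Longrightarrow> p \<in> chart_dom c \<inter> V \<Longrightarrow> del_deriv c e2 e3 beta p = 0"
proof -
  have "alpha = (\<lambda>_. 0)" using al0 by auto
  then show "beta_kenmotsu A \<phi> \<xi> \<eta> g beta"
    using trans_sasakian_coefficients by (simp add: beta_kenmotsu_def)
  assume fr: "adapted_frame A \<phi> \<xi> g V e2 e3" and c: "c \<in> A" and p: "p \<in> chart_dom c \<inter> V"
  interpret C: einstein_chart "chart_img c" "g c" "\<phi> c" "\<xi> c" "\<eta> c" by (rule einstein_chart_at[OF c])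
  let ?u = "coord c p"
  have u: "?u \<in> chart_img c" using p coord_in_img[of p c] by simp
  have ad: "adapted_basis (g c ?u) (\<phi> c ?u) (\<xi> c ?u) (e2 c ?u) (e3 c ?u)"
    using fr c p unfolding adapted_frame_def by blast
  have d: "dder (beta \<circ> param c) ?u v = dder (be c) ?u v" for v
    by (rule dder_cong_vec[OF C.open_U u]) (simp add: coefficients_param[OF c])
  have "dder (al c) ?u v = 0" for v
    by (rule C.dder_zero_on[OF u, of _ 0]) (simp add: coefficients_param(1)[OF c, symmetric] al0)
  then have hor: "dder (be c) ?u v = 0" if "\<eta> c ?u \<bullet> v = 0" for v
    using C.dder_be_horizontal[OF u that] by simp
  have re: "re_vec (del v w) = (1 / sqrt 2) *\<^sub>R v" "im_vec (del v w) = - (1 / sqrt 2) *\<^sub>R w" for v w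
    by (simp_all add: vec_eq_iff re_vec_def im_vec_def del_def complexify_def)
  have "\<eta> c ?u \<bullet> e2 c ?u = 0" "\<eta> c ?u \<bullet> e3 c ?u = 0"
    using ad C.eta_g[OF u] by (simp_all add: adapted_basis_def)
  then have "dder (be c) ?u (re_vec (del (e2 c ?u) (e3 c ?u))) = 0" "dder (be c) ?u (im_vec (del (e2 c ?u) (e3 c ?u))) = 0"
    by (auto intro!: hor simp: re)
  then show "del_deriv c e2 e3 beta p = 0"
    by (simp add: del_deriv_def cfunctional_def d complex_eq_iff)
qed

text \<open>\<open>Psi\<close> is constant, and by \<open>psi_at_extremum\<close> the maximum of \<open>alpha\<^sup>2\<close> is at most, and its minimum at
  least, the constant \<open>- Psi\<close>.\<close>

lemma sasaki_case:
  assumes nz: "\<And>p. alpha p \<noteq> 0" and conn: "connected (UNIV :: 'a set)" and comp: "compact (UNIV :: 'a set)"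
  obtains a where "a \<noteq> 0" "alpha = (\<lambda>_. a)" "beta = (\<lambda>_. 0)"
proof -
  have "\<exists>C. \<forall>p. Psi p = C"
  proof (rule locally_constant_on_charts[OF atlas conn])
    fix c u assume c: "c \<in> A" and u: "u \<in> chart_img c"
    interpret C: einstein_chart "chart_img c" "g c" "\<phi> c" "\<xi> c" "\<eta> c" by (rule einstein_chart_at[OF c])
    have "(C.psi has_derivative (\<lambda>_. 0)) (at u)"
      using smooth_on_has_derivative[OF C.smooth_psi u] C.dder_psi_zero[OF u] nz coefficients_param(1)[OF c u]
      by (metis (no_types, lifting) ext)
    then show "((Psi \<circ> param c) has_derivative (\<lambda>_. 0)) (at u)"
      by (rule has_derivative_transform_within_open[OF _ C.open_U u]) (simp add: coefficients_param[OF c])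
  qed
  then obtain K where K: "\<And>p. Psi p = K" by blast
  have extremum: "s * (K + (alpha p)\<^sup>2) \<le> 0" if s: "s \<noteq> 0" and ext: "\<And>q. s * (alpha q)\<^sup>2 \<le> s * (alpha p)\<^sup>2" for s p
  proof -
    obtain c where c: "c \<in> A" "p \<in> chart_dom c" using chart_around .
    interpret C: einstein_chart "chart_img c" "g c" "\<phi> c" "\<xi> c" "\<eta> c" by (rule einstein_chart_at[OF c(1)])
    have "s * (C.psi (coord c p) + (al c (coord c p))\<^sup>2) \<le> 0"
    proof (rule C.psi_at_extremum[OF coord_in_img[OF c(2)] _ s])
      show "al c (coord c p) \<noteq> 0" using nz[of p] alpha_coord[OF c] by simp
      show "s * (al c y)\<^sup>2 \<le> s * (al c (coord c p))\<^sup>2" if "y \<in> chart_img c" for y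
        using ext[of "param c y"] coefficients_param(1)[OF c(1) that] alpha_coord[OF c] by simp
    qed
    then show ?thesis using K[of p] Psi_coord[OF c] alpha_coord[OF c] by simp
  qed
  have cont: "continuous_on UNIV (\<lambda>p. (alpha p)\<^sup>2)" by (intro continuous_on_power continuous_alpha)
  obtain p where p: "\<And>q. (alpha q)\<^sup>2 \<le> (alpha p)\<^sup>2"
    using continuous_attains_sup[OF comp _ cont] by auto
  obtain p' where p': "\<And>q. (alpha p')\<^sup>2 \<le> (alpha q)\<^sup>2"
    using continuous_attains_inf[OF comp _ cont] by auto
  have sq: "(alpha q)\<^sup>2 = - K" for q
    using extremum[of 1 p] extremum[of "-1" p'] p[of q] p'[of q] p p' by fastforce
  have dal: "dder (al c) u v = 0" if c: "c \<in> A" and u: "u \<in> chart_img c" for c u v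
  proof -
    interpret C: einstein_chart "chart_img c" "g c" "\<phi> c" "\<xi> c" "\<eta> c" by (rule einstein_chart_at[OF c])
    have "dder (\<lambda>y. al c y * al c y) u v = 0"
      by (rule C.dder_zero_on[OF u, of _ "- K"]) (metis sq coefficients_param(1)[OF c] power2_eq_square)
    then show ?thesis
      using dder_mult[OF smooth_on_differentiable[OF C.smooth_al u] smooth_on_differentiable[OF C.smooth_al u], of v]
        nz[of "param c u"] coefficients_param(1)[OF c u] by simp
  qed
  have "\<exists>a. \<forall>p. alpha p = a"
  proof (rule locally_constant_on_charts[OF atlas conn])
    fix c u assume c: "c \<in> A" and u: "u \<in> chart_img c"
    interpret C: einstein_chart "chart_img c" "g c" "\<phi> c" "\<xi> c" "\<eta> c" by (rule einstein_chart_at[OF c])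
    have "dder (al c) u = (\<lambda>_. 0)" using dal[OF c u] by auto
    then have "(al c has_derivative (\<lambda>_. 0)) (at u)"
      using smooth_on_has_derivative[OF C.smooth_al u] by simp
    then show "((alpha \<circ> param c) has_derivative (\<lambda>_. 0)) (at u)"
      by (rule has_derivative_transform_within_open[OF _ C.open_U u]) (simp add: coefficients_param[OF c])
  qed
  then obtain a where a: "\<And>p. alpha p = a" by blast
  have "beta p = 0" for p
  proof -
    obtain c where c: "c \<in> A" "p \<in> chart_dom c" using chart_around .
    interpret C: einstein_chart "chart_img c" "g c" "\<phi> c" "\<xi> c" "\<eta> c" by (rule einstein_chart_at[OF c(1)])
    show ?thesis
      using C.dder_al_xi[OF coord_in_img[OF c(2)]] dal[OF c(1) coord_in_img[OF c(2)]] nz[of p]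
        alpha_coord[OF c] beta_coord[OF c] by simp
  qed
  then show ?thesis using that[of a] a nz by auto
qed

end

theorem theorem4p4:
  fixes A :: "('a::{t2_space,second_countable_topology}, 3) chart set"
    and \<phi> g :: "('a, 3) mat_field"
    and \<xi> \<eta> :: "('a, 3) vec_field"
  assumes "smooth_atlas A"
    and "connected (UNIV :: 'a set)"
    and "compact (UNIV :: 'a set)"
    and "acm_structure A \<phi> \<xi> \<eta> g"
    and "normal_structure A \<phi> \<xi> \<eta>"
    and "constant_rank A \<eta>"
    and "eta_einstein A \<eta> g"
  shows "(\<exists>\<alpha>. alpha_sasakian A \<phi> \<xi> \<eta> g \<alpha>) \<and> homothetic_to_sasakian A \<phi> \<xi> \<eta> g \<or>
    beta_kenmotsu A \<phi> \<xi> \<eta> g (expansion A \<phi> \<xi> g) \<and>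
    (\<forall>V e2 e3. adapted_frame A \<phi> \<xi> g V e2 e3 \<longrightarrow>
       (\<forall>c\<in>A. \<forall>p \<in> chart_dom c \<inter> V. del_deriv c e2 e3 (expansion A \<phi> \<xi> g) p = 0))"
proof -
  interpret einstein_manifold A \<phi> g \<xi> \<eta>
    using assms by unfold_locales
  consider "\<And>p. alpha p = 0" | "\<And>p. alpha p \<noteq> 0" using alpha_dichotomy[OF assms(6)] by blast
  then show ?thesis
  proof cases
    case 1
    then show ?thesis unfolding expansion_eq_beta using kenmotsu_case by blast
  next
    case 2
    then obtain a where a: "a \<noteq> 0" "alpha = (\<lambda>_. a)" "beta = (\<lambda>_. 0)"
      using sasaki_case[OF _ assms(2,3)] by metis
    then have "trans_sasakian A \<phi> \<xi> \<eta> g (\<lambda>_. a) (\<lambda>_. 0)"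
      using trans_sasakian_coefficients by simp
    then show ?thesis
      using homothetic_to_sasakian_of_constant[OF _ a(1)] unfolding alpha_sasakian_def by blast
  qed
qed

end
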